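(* Let $F$ be a field of characteristic zero and $W$ a unital $\mathbb{Z}_2$-graded $F$-algebra. Let $UT_2$ be the $\mathbb{Z}_2$-graded $W$-algebra of $2\times2$ upper triangular matrices over $F$ with the canonical grading, where $W$ acts as the full algebra $UT_2$ by left and right multiplication. Let $n\ge1$, $0\le r\le n$, and let $$\chi_{r,n-r}^{\mathbb{Z}_2,W}(UT_2)=\sum_{\lambda\vdash r,\ \mu\vdash n-r}m_{\lambda,\mu}(\chi_\lambda\otimes\chi_\mu)$$ be the $(r,n-r)$th generalized graded cocharacter of $UT_2$. If $r=n$, then $m_{\lambda,\mu}=n+3$ for $\lambda=(n)$, $\mu=\emptyset$; $m_{\lambda,\mu}=q+1$ for $\lambda=(p+q,p)$, $\mu=\emptyset$ with $p\ge1$, $q\ge0$, $2p+q=n$; and $m_{\lambda,\mu}=0$ otherwise. If $r=n-1$, then $m_{\lambda,\mu}=n$ for $\lambda=(n-1)$, $\mu=(1)$; $m_{\lambda,\mu}=q+1$ for $\lambda=(p+q,p)$, $\mu=(1)$ with $p\ge1$, $q\ge0$, $2p+q=n-1$; and $m_{\lambda,\mu}=0$ otherwise. If $r\le n-2$, then all $m_{\lambda,\mu}=0$.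
   Context: The canonical grading is $UT_2^0=Fe_{11}\oplus Fe_{22}$, $UT_2^1=Fe_{12}$. "$W$ acts as a unital graded subalgebra $B\subseteq UT_2$ by left and right multiplication" means there is a surjective unital graded homomorphism $\varphi:W\to B$ with $wa=\varphi(w)a$, $aw=a\varphi(w)$ (here $B=UT_2$). Let $\{w_i\}$ be a vector space basis of $W$, $y_1,y_2,\dots$ variables of degree $0$ and $z_1,z_2,\dots$ variables of degree $1$. The free $\mathbb{Z}_2$-graded $W$-algebra $W\langle Y,Z\rangle$ has vector space basis the monomials $w_{i_0}u_1w_{i_1}\cdots w_{i_{n-1}}u_nw_{i_n}$, $n\ge1$, each $u_j$ a variable; product is juxtaposition followed by multiplication in $W$, $W$ acts by multiplication at the two ends, and a variable $x$ is identified with $1_Wx1_W$. $\mathrm{Id}^{\mathbb{Z}_2,W}(A)$ is the set of elements vanishing under all substitutions of $y$'s by elements of $A^0$ and $z$'s by elements of $A^1$. $P^{\mathbb{Z}_2,W}_{r,n-r}$ is the space of multilinear elements in $y_1,\dots,y_r,z_1,\dots,z_{n-r}$ (span of monomials in which each of these variables occurs exactly once, with arbitrary basis elements of $W$ in between). $S_r\times S_{n-r}$ acts on it by permuting the $y$'s and the $z$'s respectively, and $\chi^{\mathbb{Z}_2,W}_{r,n-r}(A)$ is the character of $P^{\mathbb{Z}_2,W}_{r,n-r}/(P^{\mathbb{Z}_2,W}_{r,n-r}\cap\mathrm{Id}^{\mathbb{Z}_2,W}(A))$. $\chi_\lambda$, $\chi_\mu$ are the irreducible characters of $S_r$, $S_{n-r}$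 attached to the partitions $\lambda,\mu$, and $\chi_\lambda\otimes\chi_\mu$ is their outer product. *)

theory Defs
  imports
    "HOL-Analysis.Finite_Cartesian_Product"
    "HOL-Library.Poly_Mapping"
    "HOL-Library.Z2"
    "HOL-Combinatorics.Permutations"
begin

section \<open>Graded algebras and upper triangular matrices\<close>

text \<open>The grading group is the additive group of the two-element type \<^typ>\<open>bit\<close>.\<close>

locale z2_graded_algebra = vector_space sc
  for sc :: "'f::field \<Rightarrow> 'w::ring_1 \<Rightarrow> 'w" +
  fixes W :: "bit \<Rightarrow> 'w set"
  assumes scale_mult_left: "sc c x * y = sc c (x * y)"
    and scale_mult_right: "x * sc c y = sc c (x * y)"
    and subspace_component: "subspace (W i)"
    and direct_sum: "\<exists>!(a, b). a \<in> W 0 \<and> b \<in> W 1 \<and> x = a + b"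
    and graded_mult: "a \<in> W i \<Longrightarrow> b \<in> W j \<Longrightarrow> a * b \<in> W (i + j)"

definition UT2 :: "('f::field^2^2) set" where
  "UT2 = {A. A $ 2 $ 1 = 0}"

definition UT2_grade :: "bit \<Rightarrow> ('f::field^2^2) set" where
  "UT2_grade i = (if i = 0 then {A \<in> UT2. A $ 1 $ 2 = 0}
                  else {A \<in> UT2. A $ 1 $ 1 = 0 \<and> A $ 2 $ 2 = 0})"

definition matrix_scale :: "'f::field \<Rightarrow> 'f^2^2 \<Rightarrow> 'f^2^2" where
  "matrix_scale c = map_matrix ((*) c)"

text \<open>Surjective unital graded homomorphisms onto \<^const>\<open>UT2\<close>. The ring structure on matrices is
  given by \<open>**\<close> and \<open>mat 1\<close> (the type class operation \<open>*\<close> would be entrywise).\<close>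

definition graded_epi_UT2 ::
  "('f::field \<Rightarrow> 'w::ring_1 \<Rightarrow> 'w) \<Rightarrow> (bit \<Rightarrow> 'w set) \<Rightarrow> ('w \<Rightarrow> 'f^2^2) \<Rightarrow> bool" where
  "graded_epi_UT2 sc W \<phi> \<longleftrightarrow>
     Vector_Spaces.linear sc matrix_scale \<phi> \<and>
     (\<forall>v w. \<phi> (v * w) = \<phi> v ** \<phi> w) \<and> \<phi> 1 = mat 1 \<and>
     (\<forall>i. \<phi> ` W i \<subseteq> UT2_grade i) \<and>
     range \<phi> = UT2"

text \<open>The data of a graded \<open>W\<close>-algebra; the underlying space is the sum of its two components.\<close>

record ('f, 'w, 'a) graded_W_algebra =
  smul :: "'f \<Rightarrow> 'a \<Rightarrow> 'a"
  amul :: "'a \<Rightarrow> 'a \<Rightarrow> 'a"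
  lact :: "'w \<Rightarrow> 'a \<Rightarrow> 'a"
  ract :: "'a \<Rightarrow> 'w \<Rightarrow> 'a"
  grade :: "bit \<Rightarrow> 'a set"

definition UT2_alg :: "('w \<Rightarrow> 'f::field^2^2) \<Rightarrow> ('f, 'w, 'f^2^2) graded_W_algebra" where
  "UT2_alg \<phi> = \<lparr>smul = matrix_scale, amul = (**),
     lact = (\<lambda>w a. \<phi> w ** a), ract = (\<lambda>a w. a ** \<phi> w), grade = UT2_grade\<rparr>"


section \<open>The free graded \<open>W\<close>-algebra and generalized graded identities\<close>

datatype gvar = Y nat | Z nat

fun deg :: "gvar \<Rightarrow> bit" where
  "deg (Y i) = 0"
| "deg (Z i) = 1"

text \<open>\<open>Pre w\<^sub>0 u\<^sub>1 (Pre w\<^sub>1 u\<^sub>2 (\<dots> (Last w\<^sub>n\<^sub>-\<^sub>1 u\<^sub>n w\<^sub>n)))\<close> is the monomial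
  \<open>w\<^sub>0 u\<^sub>1 w\<^sub>1 u\<^sub>2 \<dots> w\<^sub>n\<^sub>-\<^sub>1 u\<^sub>n w\<^sub>n\<close>; every monomial contains at least one variable.\<close>

datatype (coeffs: 'w, var_set: 'v) wmono = Last 'w 'v 'w | Pre 'w 'v "('w, 'v) wmono"

fun vars :: "('w, 'v) wmono \<Rightarrow> 'v list" where
  "vars (Last w u w') = [u]"
| "vars (Pre w u m) = u # vars m"

type_synonym ('w, 'f) gpoly = "('w, gvar) wmono \<Rightarrow>\<^sub>0 'f"

text \<open>Finite linear combinations of the monomials with coefficients from the basis \<open>B\<close> of \<open>W\<close>.\<close>

definition free_W_algebra :: "'w set \<Rightarrow> ('w, 'f::field) gpoly set" where
  "free_W_algebra B = {f. \<forall>m \<in> Poly_Mapping.keys f. coeffs m \<subseteq> B}"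

fun eval_mono :: "('f, 'w, 'a) graded_W_algebra \<Rightarrow> ('v \<Rightarrow> 'a) \<Rightarrow> ('w, 'v) wmono \<Rightarrow> 'a" where
  "eval_mono A s (Last w u w') = ract A (lact A w (s u)) w'"
| "eval_mono A s (Pre w u m) = amul A (lact A w (s u)) (eval_mono A s m)"

definition eval_gpoly ::
  "('f::field, 'w, 'a::ab_group_add) graded_W_algebra \<Rightarrow> (gvar \<Rightarrow> 'a) \<Rightarrow> ('w, 'f) gpoly \<Rightarrow> 'a" where
  "eval_gpoly A s f =
     (\<Sum>m \<in> Poly_Mapping.keys f. smul A (Poly_Mapping.lookup f m) (eval_mono A s m))"

definition graded_identities ::
  "('f::field, 'w, 'a::ab_group_add) graded_W_algebra \<Rightarrow> 'w set \<Rightarrow> ('w, 'f) gpoly set" where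
  "graded_identities A B =
     {f \<in> free_W_algebra B. \<forall>s. (\<forall>u. s u \<in> grade A (deg u)) \<longrightarrow> eval_gpoly A s f = 0}"

definition multilinear :: "'w set \<Rightarrow> nat \<Rightarrow> nat \<Rightarrow> ('w, 'f::field) gpoly set" where
  "multilinear B r k =
     {f \<in> free_W_algebra B. \<forall>m \<in> Poly_Mapping.keys f.
        distinct (vars m) \<and> set (vars m) = Y ` {1..r} \<union> Z ` {1..k}}"

fun perm_var :: "(nat \<Rightarrow> nat) \<Rightarrow> (nat \<Rightarrow> nat) \<Rightarrow> gvar \<Rightarrow> gvar" where
  "perm_var \<sigma> \<tau> (Y i) = Y (\<sigma> i)"
| "perm_var \<sigma> \<tau> (Z i) = Z (\<tau> i)"

definition perm_gpoly ::
  "(nat \<Rightarrow> nat) \<Rightarrow> (nat \<Rightarrow> nat) \<Rightarrow> ('w, 'f::field) gpoly \<Rightarrow> ('w, 'f) gpoly" where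
  "perm_gpoly \<sigma> \<tau> f = (\<Sum>m \<in> Poly_Mapping.keys f.
     Poly_Mapping.single (map_wmono id (perm_var \<sigma> \<tau>) m) (Poly_Mapping.lookup f m))"


section \<open>Characters\<close>

text \<open>A finite \<open>E \<subseteq> V\<close> is a basis modulo \<open>U\<close> if its elements represent a basis of the quotient
  space \<open>V/U\<close>. The trace below does not depend on the chosen basis if \<open>g\<close> is a linear map that
  preserves \<open>V\<close> and \<open>U\<close>, and \<open>V/U\<close> is finite-dimensional.\<close>

definition fscale :: "'f::field \<Rightarrow> ('x \<Rightarrow>\<^sub>0 'f) \<Rightarrow> ('x \<Rightarrow>\<^sub>0 'f)" where
  "fscale c = Poly_Mapping.map ((*) c)"

definition coords_mod ::
  "('x \<Rightarrow>\<^sub>0 'f::field) set \<Rightarrow> ('x \<Rightarrow>\<^sub>0 'f) set \<Rightarrow> ('x \<Rightarrow>\<^sub>0 'f) \<Rightarrow> (('x \<Rightarrow>\<^sub>0 'f) \<Rightarrow> 'f) \<Rightarrow> bool" where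
  "coords_mod U E v c \<longleftrightarrow> (\<forall>b. b \<notin> E \<longrightarrow> c b = 0) \<and> v - (\<Sum>b\<in>E. fscale (c b) b) \<in> U"

definition basis_mod ::
  "('x \<Rightarrow>\<^sub>0 'f::field) set \<Rightarrow> ('x \<Rightarrow>\<^sub>0 'f) set \<Rightarrow> ('x \<Rightarrow>\<^sub>0 'f) set \<Rightarrow> bool" where
  "basis_mod V U E \<longleftrightarrow> finite E \<and> E \<subseteq> V \<and> (\<forall>v\<in>V. \<exists>!c. coords_mod U E v c)"

definition quotient_trace ::
  "('x \<Rightarrow>\<^sub>0 'f::field) set \<Rightarrow> ('x \<Rightarrow>\<^sub>0 'f) set \<Rightarrow> (('x \<Rightarrow>\<^sub>0 'f) \<Rightarrow> ('x \<Rightarrow>\<^sub>0 'f)) \<Rightarrow> 'f" where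
  "quotient_trace V U g =
     (let E = (SOME E. basis_mod V U E) in \<Sum>b\<in>E. (THE c. coords_mod U E (g b) c) b)"

definition graded_cocharacter ::
  "('f::field, 'w, 'a::ab_group_add) graded_W_algebra \<Rightarrow> 'w set \<Rightarrow> nat \<Rightarrow> nat \<Rightarrow>
     (nat \<Rightarrow> nat) \<Rightarrow> (nat \<Rightarrow> nat) \<Rightarrow> 'f" where
  "graded_cocharacter A B r k \<sigma> \<tau> =
     quotient_trace (multilinear B r k) (multilinear B r k \<inter> graded_identities A B) (perm_gpoly \<sigma> \<tau>)"

text \<open>Partitions are weakly decreasing lists of positive parts; the empty partition is \<open>[]\<close>.\<close>

definition partitions :: "nat \<Rightarrow> nat list set" where
  "partitions n = {p. sorted_wrt (\<ge>) p \<and> 0 \<notin> set p \<and> sum_list p = n}"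

text \<open>The partition \<open>(k)\<close>, where \<open>(0)\<close> is the empty partition.\<close>

definition one_row :: "nat \<Rightarrow> nat list" where
  "one_row k = (if k = 0 then [] else [k])"

text \<open>Row (counted from 0) and column (counted from 1) of the entry \<open>k\<close> in the Young tableau of
  shape \<open>p\<close> whose rows are filled from left to right, top to bottom, with \<open>1, 2, \<dots>\<close>.\<close>

definition tab_row :: "nat list \<Rightarrow> nat \<Rightarrow> nat" where
  "tab_row p k = (LEAST i. k \<le> sum_list (take (Suc i) p))"

definition tab_col :: "nat list \<Rightarrow> nat \<Rightarrow> nat" where
  "tab_col p k = k - sum_list (take (tab_row p k) p)"

definition row_stabilizer :: "nat list \<Rightarrow> (nat \<Rightarrow> nat) set" where
  "row_stabilizer p = {\<sigma>. \<sigma> permutes {1..sum_list p} \<and>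
     (\<forall>k\<in>{1..sum_list p}. tab_row p (\<sigma> k) = tab_row p k)}"

definition col_stabilizer :: "nat list \<Rightarrow> (nat \<Rightarrow> nat) set" where
  "col_stabilizer p = {\<sigma>. \<sigma> permutes {1..sum_list p} \<and>
     (\<forall>k\<in>{1..sum_list p}. tab_col p (\<sigma> k) = tab_col p k)}"

definition group_algebra :: "nat \<Rightarrow> ((nat \<Rightarrow> nat) \<Rightarrow>\<^sub>0 'f::field) set" where
  "group_algebra n = {a. \<forall>\<sigma> \<in> Poly_Mapping.keys a. \<sigma> permutes {1..n}}"

definition galg_mult ::
  "((nat \<Rightarrow> nat) \<Rightarrow>\<^sub>0 'f::field) \<Rightarrow> ((nat \<Rightarrow> nat) \<Rightarrow>\<^sub>0 'f) \<Rightarrow> ((nat \<Rightarrow> nat) \<Rightarrow>\<^sub>0 'f)" where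
  "galg_mult a b = (\<Sum>\<sigma> \<in> Poly_Mapping.keys a. \<Sum>\<tau> \<in> Poly_Mapping.keys b.
     Poly_Mapping.single (\<sigma> \<circ> \<tau>) (Poly_Mapping.lookup a \<sigma> * Poly_Mapping.lookup b \<tau>))"

definition young_symmetrizer :: "nat list \<Rightarrow> ((nat \<Rightarrow> nat) \<Rightarrow>\<^sub>0 'f::field)" where
  "young_symmetrizer p = (\<Sum>\<sigma> \<in> row_stabilizer p. \<Sum>\<tau> \<in> col_stabilizer p.
     Poly_Mapping.single (\<sigma> \<circ> \<tau>) (of_int (sign \<tau>)))"

text \<open>The minimal left ideal of the group algebra generated by the Young symmetrizer, and the
  character it affords; \<open>(n)\<close> gives the trivial character.\<close>

definition specht_module :: "nat list \<Rightarrow> ((nat \<Rightarrow> nat) \<Rightarrow>\<^sub>0 'f::field) set" where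
  "specht_module p = (\<lambda>a. galg_mult a (young_symmetrizer p)) ` group_algebra (sum_list p)"

definition irr_char :: "nat list \<Rightarrow> (nat \<Rightarrow> nat) \<Rightarrow> 'f::field" where
  "irr_char p \<sigma> = quotient_trace (specht_module p) {0} (galg_mult (Poly_Mapping.single \<sigma> 1))"

text \<open>A class function on the product of two symmetric groups is the sum of the outer products of
  irreducible characters with multiplicities \<open>m\<close>.\<close>

definition decomposes_with ::
  "nat \<Rightarrow> nat \<Rightarrow> ((nat \<Rightarrow> nat) \<Rightarrow> (nat \<Rightarrow> nat) \<Rightarrow> 'f::field) \<Rightarrow> (nat list \<Rightarrow> nat list \<Rightarrow> nat) \<Rightarrow> bool" where
  "decomposes_with r k ch m \<longleftrightarrow>
     (\<forall>\<sigma> \<tau>. \<sigma> permutes {1..r} \<longrightarrow> \<tau> permutes {1..k} \<longrightarrow>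
        ch \<sigma> \<tau> = (\<Sum>p \<in> partitions r. \<Sum>q \<in> partitions k. of_nat (m p q) * (irr_char p \<sigma> * irr_char q \<tau>)))"

end

theory Submission
  imports Defs "HOL-Analysis.Cartesian_Space"
begin

text \<open>
  Write \<open>k = n - r\<close> for the number of odd variables. An even substitution sends \<open>y\<^sub>i\<close> to a
  diagonal matrix with entries \<open>a\<^sub>i, b\<^sub>i\<close>, an odd one sends \<open>z\<close> to a multiple of the
  matrix unit \<open>e\<^sub>1\<^sub>2\<close>. The product of two multiples of \<open>e\<^sub>1\<^sub>2\<close> vanishes
  even with coefficients from \<open>UT\<^sub>2\<close> in between, so everything multilinear is an identity
  when \<open>k \<ge> 2\<close>. For \<open>k \<le> 1\<close> the upper right entry of a multilinear element is a
  combination of the products of the \<open>a\<^sub>i\<close> for \<open>i \<in> I\<close> and the \<open>b\<^sub>i\<close> for \<open>i \<notin> I\<close>, where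
  \<open>I\<close> runs over the subsets of \<open>{1..r}\<close>. All these coefficients occur independently because
  coefficients from \<open>W\<close> provide the matrix units. For \<open>k = 0\<close> the two diagonal entries contribute the
  product of all \<open>a\<^sub>i\<close> and the product of all \<open>b\<^sub>i\<close>, while for \<open>k = 1\<close> they vanish. Hence
  the cocharacter is the permutation character of the symmetric group on the subsets of \<open>{1..r}\<close>,
  increased by 2 if \<open>k = 0\<close> (\<open>cocharacter_few_odd\<close>).

  It remains to decompose the permutation characters on \<open>j\<close>-subsets. For \<open>2 j \<le> r\<close> the Specht
  module of the shape \<open>(r - j, j)\<close> is isomorphic to the space of harmonic functions, the kernel of the
  map that sends a function on \<open>j\<close>-subsets to its sums over the \<open>j\<close>-subsets containing a given
  \<open>(j - 1)\<close>-subset. This map is onto by an \<open>sl\<^sub>2\<close> argument (\<open>lower_surj\<close>), so the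
  irreducible character is a difference of two consecutive permutation characters
  (\<open>irr_char_two_row_shape\<close>). Summing up, and identifying \<open>j\<close>-subsets with their complements, the
  shape \<open>(r - i, i)\<close> occurs once for every \<open>j\<close> with \<open>i \<le> j \<le> r - i\<close>, that is,
  \<open>r - 2 i + 1\<close> times.

  That the multiplicities are determined by the cocharacter is the linear independence of the
  irreducible characters (\<open>irr_char_independent\<close>). It follows from Young's combinatorial lemma: the
  Young symmetrizer of \<open>p\<close> annihilates the Specht module of \<open>q\<close> unless \<open>q\<close> dominates
  \<open>p\<close>, and its trace on its own Specht module is not zero.

  All traces are computed with frames (\<open>quotient_trace_frame\<close>), that is, with a finite family of
  vectors and functionals that recover every vector as a combination of this family.
\<close>

section \<open>Traces on quotient spaces\<close>

abbreviation lookup :: "('x \<Rightarrow>\<^sub>0 'f::zero) \<Rightarrow> 'x \<Rightarrow> 'f" where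
  "lookup \<equiv> Poly_Mapping.lookup"
abbreviation keys :: "('x \<Rightarrow>\<^sub>0 'f::zero) \<Rightarrow> 'x set" where
  "keys \<equiv> Poly_Mapping.keys"
abbreviation single :: "'x \<Rightarrow> 'f::zero \<Rightarrow> ('x \<Rightarrow>\<^sub>0 'f)" where
  "single \<equiv> Poly_Mapping.single"

lemma lookup_fscale [simp]: "lookup (fscale c v) x = c * lookup v x"
  by (simp add: fscale_def Poly_Mapping.map.rep_eq when_def)

global_interpretation pm: vector_space "fscale :: 'f::field \<Rightarrow> ('x \<Rightarrow>\<^sub>0 'f) \<Rightarrow> _"
  by unfold_locales (auto intro!: poly_mapping_eqI simp: lookup_add algebra_simps)

abbreviation linear_functional :: "(('x \<Rightarrow>\<^sub>0 'f::field) \<Rightarrow> 'f) \<Rightarrow> bool" where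
  "linear_functional \<equiv> module_hom fscale (*)"
abbreviation linear_operator :: "(('x \<Rightarrow>\<^sub>0 'f::field) \<Rightarrow> ('y \<Rightarrow>\<^sub>0 'f)) \<Rightarrow> bool" where
  "linear_operator \<equiv> module_hom fscale fscale"

lemma module_times: "module ((*) :: 'f::field \<Rightarrow> 'f \<Rightarrow> 'f)"
  by unfold_locales (auto simp: algebra_simps)

lemma linear_functionalI:
  assumes "\<And>u v. d (u + v) = d u + d v" and "\<And>c v. d (fscale c v) = c * d v"
  shows "linear_functional d"
  using assms by (simp add: module_hom_iff module_times pm.module_axioms)

lemma linear_operatorI:
  assumes "\<And>u v. g (u + v) = g u + g v" and "\<And>c v. g (fscale c v) = fscale c (g v)"
  shows "linear_operator g"
  using assms by (simp add: module_hom_iff pm.module_axioms)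

lemma linear_functional_lookup: "linear_functional (\<lambda>v. lookup v x)"
  by (rule linear_functionalI) (simp_all add: lookup_add)

text \<open>A spanning family of least cardinality represents a basis: a nontrivial relation modulo \<open>U\<close> would
  allow one of its members to be eliminated.\<close>

lemma finite_frame_basis_mod:
  fixes V U :: "('x \<Rightarrow>\<^sub>0 'f::field) set"
  assumes V: "pm.subspace V" and U: "pm.subspace U" and UV: "U \<subseteq> V"
    and X: "finite X" "e ` X \<subseteq> V"
    and frame: "\<And>v. v \<in> V \<Longrightarrow> v - (\<Sum>x\<in>X. fscale (d x v) (e x)) \<in> U"
  shows "\<exists>E. basis_mod V U E"
proof -
  define spans where "spans E \<longleftrightarrow> finite E \<and> E \<subseteq> V \<and> (\<forall>v\<in>V. \<exists>c. coords_mod U E v c)" for E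
  have "spans (e ` X)"
  proof -
    have "\<exists>c. coords_mod U (e ` X) v c" if v: "v \<in> V" for v
    proof -
      define c where "c b = (if b \<in> e ` X then (\<Sum>x | x \<in> X \<and> e x = b. d x v) else 0)" for b
      have "(\<Sum>b\<in>e ` X. fscale (c b) b) = (\<Sum>b\<in>e ` X. \<Sum>x | x \<in> X \<and> e x = b. fscale (d x v) (e x))"
        by (intro sum.cong refl) (auto simp: c_def pm.scale_sum_left intro!: sum.cong)
      also have "\<dots> = (\<Sum>x\<in>X. fscale (d x v) (e x))"
        by (rule sum.image_gen[OF X(1), symmetric])
      finally show ?thesis
        using frame[OF v] by (intro exI[of _ c]) (simp add: coords_mod_def c_def)
    qed
    then show ?thesis using X by (simp add: spans_def)
  qed
  then obtain E where E: "spans E" and min: "\<And>E'. spans E' \<Longrightarrow> card E \<le> card E'"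
    using ex_has_least_nat[of spans _ card] by blast
  have fin: "finite E" and EV: "E \<subseteq> V" using E by (auto simp: spans_def)
  have "c = c'" if v: "v \<in> V" and c: "coords_mod U E v c" and c': "coords_mod U E v c'" for v c c'
  proof (rule ccontr)
    assume "c \<noteq> c'"
    then obtain b0 where b0: "c b0 \<noteq> c' b0" by auto
    then have b0E: "b0 \<in> E" using c c' unfolding coords_mod_def by metis
    \<comment> \<open>the relation between the two coordinate families, normalized so that it eliminates \<open>b0\<close>\<close>
    define k where "k b = (c b - c' b) / (c b0 - c' b0)" for b
    have k0: "k b0 = 1" using b0 by (simp add: k_def)
    have "(v - (\<Sum>b\<in>E. fscale (c' b) b)) - (v - (\<Sum>b\<in>E. fscale (c b) b)) \<in> U"
      using c c' unfolding coords_mod_def by (blast intro: pm.subspace_diff[OF U])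
    also have "(v - (\<Sum>b\<in>E. fscale (c' b) b)) - (v - (\<Sum>b\<in>E. fscale (c b) b))
      = (\<Sum>b\<in>E. fscale (c b - c' b) b)"
      by (simp add: sum_subtractf pm.scale_left_diff_distrib)
    finally have "fscale (1 / (c b0 - c' b0)) (\<Sum>b\<in>E. fscale (c b - c' b) b) \<in> U"
      by (rule pm.subspace_scale[OF U])
    then have kU: "(\<Sum>b\<in>E. fscale (k b) b) \<in> U"
      by (simp add: pm.scale_sum_right k_def)
    have "spans (E - {b0})"
    proof -
      have "\<exists>c. coords_mod U (E - {b0}) w c" if w: "w \<in> V" for w
      proof -
        obtain a where a: "coords_mod U E w a" using E w by (auto simp: spans_def)
        define a' where "a' b = a b - a b0 * k b" for b
        have zero: "a' b = 0" if "b \<notin> E - {b0}" for b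
          using that a c c' k0 by (cases "b = b0") (auto simp: a'_def k_def coords_mod_def)
        have "(\<Sum>b\<in>E - {b0}. fscale (a' b) b) = (\<Sum>b\<in>E. fscale (a' b) b)"
          using fin zero by (intro sum.mono_neutral_left) auto
        also have "\<dots> = (\<Sum>b\<in>E. fscale (a b) b) - fscale (a b0) (\<Sum>b\<in>E. fscale (k b) b)"
          by (simp add: a'_def pm.scale_left_diff_distrib sum_subtractf pm.scale_sum_right)
        finally have "w - (\<Sum>b\<in>E - {b0}. fscale (a' b) b)
          = (w - (\<Sum>b\<in>E. fscale (a b) b)) + fscale (a b0) (\<Sum>b\<in>E. fscale (k b) b)"
          by simp
        also have "\<dots> \<in> U"
          using a kU by (intro pm.subspace_add[OF U] pm.subspace_scale[OF U])
            (auto simp: coords_mod_def)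
        finally show ?thesis using zero by (auto simp: coords_mod_def)
      qed
      then show ?thesis using fin EV by (auto simp: spans_def)
    qed
    then show False using min[of "E - {b0}"] b0E fin card_Diff1_less[of E b0] by simp
  qed
  then have "basis_mod V U E" using E by (auto simp: basis_mod_def spans_def)
  then show ?thesis ..
qed

text \<open>The members of a frame may be dependent, so that group elements or subsets can serve as indices.
  The coordinate functionals \<open>d x\<close> recover each basis vector from the frame, and exchanging the two
  sums turns the sum over the basis into the sum over the frame.\<close>

theorem quotient_trace_frame:
  fixes V U :: "('x \<Rightarrow>\<^sub>0 'f::field) set"
  assumes V: "pm.subspace V" and U: "pm.subspace U" and UV: "U \<subseteq> V"
    and g: "linear_operator g" and gV: "g ` V \<subseteq> V" and gU: "g ` U \<subseteq> U"
    and X: "finite X" "e ` X \<subseteq> V"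
    and d: "\<And>x. x \<in> X \<Longrightarrow> linear_functional (d x)"
    and dU: "\<And>x u. x \<in> X \<Longrightarrow> u \<in> U \<Longrightarrow> d x u = 0"
    and frame: "\<And>v. v \<in> V \<Longrightarrow> v - (\<Sum>x\<in>X. fscale (d x v) (e x)) \<in> U"
  shows "quotient_trace V U g = (\<Sum>x\<in>X. d x (g (e x)))"
proof -
  define E where "E = (SOME E. basis_mod V U E)"
  have bE: "basis_mod V U E"
    unfolding E_def using finite_frame_basis_mod[OF V U UV X frame] by (rule someI_ex)
  then have fin: "finite E" and EV: "E \<subseteq> V" by (auto simp: basis_mod_def)
  define C where "C v = (THE c. coords_mod U E v c)" for v
  have ex1: "\<exists>!c. coords_mod U E v c" if "v \<in> V" for v
    using bE that unfolding basis_mod_def by (elim conjE bspec)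
  have C: "coords_mod U E v (C v)" if "v \<in> V" for v
    unfolding C_def by (rule theI'[OF ex1[OF that]])
  have C_eq: "C v = c" if "v \<in> V" "coords_mod U E v c" for v c
    unfolding C_def using the1_equality[where P = "coords_mod U E v", OF ex1[OF that(1)] that(2)] .
  have C_U: "C v = C w" if "v \<in> V" "w \<in> V" "v - w \<in> U" for v w
  proof (rule C_eq[OF that(1)])
    have "(v - w) + (w - (\<Sum>b\<in>E. fscale (C w b) b)) \<in> U"
      using C[OF that(2)] that(3) by (intro pm.subspace_add[OF U]) (auto simp: coords_mod_def)
    then show "coords_mod U E v (C w)" using C[OF that(2)] by (simp add: coords_mod_def)
  qed
  have C_sum: "C (\<Sum>x\<in>X. fscale (k x) (h x)) b = (\<Sum>x\<in>X. k x * C (h x) b)"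
    if h: "\<And>x. x \<in> X \<Longrightarrow> h x \<in> V" for k h b
  proof -
    have "C (\<Sum>x\<in>X. fscale (k x) (h x)) = (\<lambda>b. \<Sum>x\<in>X. k x * C (h x) b)"
    proof (rule C_eq)
      show "(\<Sum>x\<in>X. fscale (k x) (h x)) \<in> V"
        using h by (intro pm.subspace_sum[OF V] pm.subspace_scale[OF V])
      have "(\<Sum>x\<in>X. fscale (k x) (h x - (\<Sum>b\<in>E. fscale (C (h x) b) b))) \<in> U"
        using C[OF h] by (intro pm.subspace_sum[OF U] pm.subspace_scale[OF U])
          (auto simp: coords_mod_def)
      also have "(\<Sum>x\<in>X. fscale (k x) (h x - (\<Sum>b\<in>E. fscale (C (h x) b) b)))
        = (\<Sum>x\<in>X. fscale (k x) (h x)) - (\<Sum>b\<in>E. fscale (\<Sum>x\<in>X. k x * C (h x) b) b)"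
        unfolding pm.scale_right_diff_distrib sum_subtractf pm.scale_sum_right pm.scale_sum_left
          pm.scale_scale
        by (subst (2) sum.swap) rule
      finally show "coords_mod U E (\<Sum>x\<in>X. fscale (k x) (h x)) (\<lambda>b. \<Sum>x\<in>X. k x * C (h x) b)"
        using C[OF h] by (auto simp: coords_mod_def intro!: sum.neutral)
    qed
    then show ?thesis by simp
  qed
  have geV: "g (e x) \<in> V" if "x \<in> X" for x using gV X that by auto
  have d_E: "(\<Sum>b\<in>E. d x b * C v b) = d x v" if x: "x \<in> X" and v: "v \<in> V" for x v
  proof -
    have "d x (v - (\<Sum>b\<in>E. fscale (C v b) b)) = 0"
      using C[OF v] by (intro dU[OF x]) (simp add: coords_mod_def)
    then show ?thesis
      by (simp add: module_hom.diff[OF d[OF x]] module_hom.sum[OF d[OF x]]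
          module_hom.scale[OF d[OF x]] mult.commute)
  qed
  have "quotient_trace V U g = (\<Sum>b\<in>E. C (g b) b)"
    by (simp add: quotient_trace_def E_def[symmetric] C_def)
  also have "\<dots> = (\<Sum>b\<in>E. \<Sum>x\<in>X. d x b * C (g (e x)) b)"
  proof (rule sum.cong[OF refl])
    fix b assume b: "b \<in> E"
    then have bV: "b \<in> V" using EV by auto
    have "g (b - (\<Sum>x\<in>X. fscale (d x b) (e x))) \<in> U" using frame[OF bV] gU by auto
    then have "g b - (\<Sum>x\<in>X. fscale (d x b) (g (e x))) \<in> U"
      by (simp add: module_hom.diff[OF g] module_hom.sum[OF g] module_hom.scale[OF g])
    then have "C (g b) = C (\<Sum>x\<in>X. fscale (d x b) (g (e x)))"
      using gV bV geV by (intro C_U pm.subspace_sum[OF V] pm.subspace_scale[OF V]) auto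
    then show "C (g b) b = (\<Sum>x\<in>X. d x b * C (g (e x)) b)" using C_sum[OF geV] by simp
  qed
  also have "\<dots> = (\<Sum>x\<in>X. \<Sum>b\<in>E. d x b * C (g (e x)) b)" by (rule sum.swap)
  also have "\<dots> = (\<Sum>x\<in>X. d x (g (e x)))" using geV d_E by (intro sum.cong refl) auto
  finally show ?thesis .
qed

lemma poly_mapping_sum_single:
  fixes v :: "'x \<Rightarrow>\<^sub>0 'f::comm_monoid_add"
  assumes "finite K" "keys v \<subseteq> K"
  shows "(\<Sum>k\<in>K. single k (lookup v k)) = v"
proof (rule poly_mapping_eqI)
  fix x
  have "lookup (\<Sum>k\<in>K. single k (lookup v k)) x = (\<Sum>k\<in>K. if k = x then lookup v x else 0)"
    by (auto simp: lookup_sum lookup_single when_def intro!: sum.cong)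
  also have "\<dots> = lookup v x"
    using assms by (auto simp: in_keys_iff)
  finally show "lookup (\<Sum>k\<in>K. single k (lookup v k)) x = lookup v x" .
qed

lemma fscale_single [simp]: "fscale c (single k x) = single k (c * x)"
  by (rule poly_mapping_eqI) (simp add: lookup_single when_def)

lemma linear_operator_eqI:
  assumes "linear_operator g" "linear_operator h"
    and "\<And>k. k \<in> keys v \<Longrightarrow> g (single k 1) = h (single k 1)"
  shows "g v = h v"
proof -
  have "v = (\<Sum>k\<in>keys v. fscale (lookup v k) (single k 1))"
    using poly_mapping_sum_single[of "keys v" v] by simp
  moreover have "g (\<Sum>k\<in>keys v. fscale (lookup v k) (single k 1))
    = h (\<Sum>k\<in>keys v. fscale (lookup v k) (single k 1))"
    unfolding module_hom.sum[OF assms(1)] module_hom.sum[OF assms(2)]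
      module_hom.scale[OF assms(1)] module_hom.scale[OF assms(2)]
    using assms(3) by (intro sum.cong) simp_all
  ultimately show ?thesis by simp
qed

lemma linear_operator_sum_keys:
  fixes h :: "'x \<Rightarrow> 'y \<Rightarrow>\<^sub>0 'f::field"
  shows "linear_operator (\<lambda>v. \<Sum>k\<in>keys v. fscale (lookup v k) (h k))"
proof -
  have eq: "(\<Sum>k\<in>keys v. fscale (lookup v k) (h k)) = (\<Sum>k\<in>K. fscale (lookup v k) (h k))"
    if "finite K" "keys v \<subseteq> K" for v :: "'x \<Rightarrow>\<^sub>0 'f" and K
    using that by (intro sum.mono_neutral_left) (auto simp: in_keys_iff)
  show ?thesis
  proof (rule linear_operatorI)
    fix u v :: "'x \<Rightarrow>\<^sub>0 'f" and c
    have K: "finite (keys u \<union> keys v)" "keys (u + v) \<subseteq> keys u \<union> keys v"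
      by (auto simp: in_keys_iff lookup_add)
    show "(\<Sum>k\<in>keys (u + v). fscale (lookup (u + v) k) (h k)) =
      (\<Sum>k\<in>keys u. fscale (lookup u k) (h k)) + (\<Sum>k\<in>keys v. fscale (lookup v k) (h k))"
      unfolding eq[OF K] eq[OF K(1) Un_upper1] eq[OF K(1) Un_upper2]
      by (simp add: lookup_add pm.scale_left_distrib sum.distrib)
    have K': "finite (keys v)" "keys (fscale c v) \<subseteq> keys v" by (auto simp: in_keys_iff)
    show "(\<Sum>k\<in>keys (fscale c v). fscale (lookup (fscale c v) k) (h k)) =
      fscale c (\<Sum>k\<in>keys v. fscale (lookup v k) (h k))"
      unfolding eq[OF K'] by (simp add: pm.scale_sum_right)
  qed
qed

lemma linear_functional_sum_keys:
  fixes h :: "'x \<Rightarrow> 'f::field"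
  shows "linear_functional (\<lambda>v. \<Sum>k\<in>keys v. lookup v k * h k)"
proof -
  \<comment> \<open>a functional is an operator into the polynomials with a single monomial\<close>
  have eq: "(\<Sum>k\<in>keys v. lookup v k * h k)
    = lookup (\<Sum>k\<in>keys v. fscale (lookup v k) (single () (h k))) ()" for v
    by (simp add: lookup_sum)
  note lin = linear_operator_sum_keys[of "\<lambda>k. single () (h k)"]
  show ?thesis
    unfolding eq
  proof (rule linear_functionalI, unfold module_hom.add[OF lin] module_hom.scale[OF lin])
  qed (simp_all only: lookup_add lookup_fscale)
qed

section \<open>The group algebra of the symmetric group\<close>

type_synonym 'f galg = "(nat \<Rightarrow> nat) \<Rightarrow>\<^sub>0 'f"

notation galg_mult (infixl "\<star>" 70)

abbreviation perms :: "nat \<Rightarrow> (nat \<Rightarrow> nat) set" where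
  "perms n \<equiv> {\<sigma>. \<sigma> permutes {1..n}}"

declare finite_permutations [simp]

lemma permutes_comp: "\<sigma> permutes S \<Longrightarrow> \<tau> permutes S \<Longrightarrow> \<sigma> \<circ> \<tau> permutes S"
  by (rule permutes_compose)

lemma galg_mult_eq_sum:
  "a \<star> b = (\<Sum>\<sigma>\<in>keys a. fscale (lookup a \<sigma>)
     (\<Sum>\<tau>\<in>keys b. fscale (lookup b \<tau>) (single (\<sigma> \<circ> \<tau>) 1)))"
  by (simp add: galg_mult_def pm.scale_sum_right)

lemma galg_mult_eq_sum':
  "a \<star> b = (\<Sum>\<tau>\<in>keys b. fscale (lookup b \<tau>)
     (\<Sum>\<sigma>\<in>keys a. fscale (lookup a \<sigma>) (single (\<sigma> \<circ> \<tau>) 1)))"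
  unfolding galg_mult_def by (subst sum.swap) (simp add: pm.scale_sum_right mult.commute)

lemma linear_galg_mult_left: "linear_operator (\<lambda>a. a \<star> b)"
  unfolding galg_mult_eq_sum by (rule linear_operator_sum_keys)

lemma linear_galg_mult_right: "linear_operator ((\<star>) a)"
  unfolding galg_mult_eq_sum' by (rule linear_operator_sum_keys)

lemmas galg_mult_add_left = module_hom.add[OF linear_galg_mult_left]
  and galg_mult_scale_left = module_hom.scale[OF linear_galg_mult_left]
  and galg_mult_sum_left = module_hom.sum[OF linear_galg_mult_left]
  and galg_mult_scale_right = module_hom.scale[OF linear_galg_mult_right]
  and galg_mult_sum_right = module_hom.sum[OF linear_galg_mult_right]
  and galg_mult_0_right = module_hom.zero[OF linear_galg_mult_right]
  and galg_mult_uminus_right = module_hom.neg[OF linear_galg_mult_right]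

lemma galg_mult_single [simp]: "single \<sigma> x \<star> single \<tau> y = single (\<sigma> \<circ> \<tau>) (x * y)"
  by (simp add: galg_mult_def)

lemma linear_compose: "linear_operator f \<Longrightarrow> linear_operator g \<Longrightarrow> linear_operator (\<lambda>v. g (f v))"
  by (simp add: module_hom_iff)

lemma galg_mult_assoc: "a \<star> b \<star> c = a \<star> (b \<star> c)"
proof -
  let ?s = "\<lambda>\<sigma>. single \<sigma> 1 :: 'a galg"
  have 1: "?s \<sigma> \<star> ?s \<tau> \<star> c = ?s \<sigma> \<star> (?s \<tau> \<star> c)" for \<sigma> \<tau> c
  proof (rule linear_operator_eqI[of "\<lambda>c. ?s \<sigma> \<star> ?s \<tau> \<star> c" "\<lambda>c. ?s \<sigma> \<star> (?s \<tau> \<star> c)"])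
    show "linear_operator (\<lambda>c. ?s \<sigma> \<star> (?s \<tau> \<star> c))"
      by (rule linear_compose[OF linear_galg_mult_right[of "?s \<tau>"] linear_galg_mult_right])
  qed (rule linear_galg_mult_right, simp add: o_assoc)
  have 2: "?s \<sigma> \<star> b \<star> c = ?s \<sigma> \<star> (b \<star> c)" for \<sigma>
  proof (rule linear_operator_eqI[of "\<lambda>b. ?s \<sigma> \<star> b \<star> c" "\<lambda>b. ?s \<sigma> \<star> (b \<star> c)"])
    show "linear_operator (\<lambda>b. ?s \<sigma> \<star> b \<star> c)"
      by (rule linear_compose[OF linear_galg_mult_right[of "?s \<sigma>"] linear_galg_mult_left])
    show "linear_operator (\<lambda>b. ?s \<sigma> \<star> (b \<star> c))"
      by (rule linear_compose[OF linear_galg_mult_left[of c] linear_galg_mult_right])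
  qed (rule 1)
  show ?thesis
  proof (rule linear_operator_eqI[of "\<lambda>a. a \<star> b \<star> c" "\<lambda>a. a \<star> (b \<star> c)"])
    show "linear_operator (\<lambda>a. a \<star> b \<star> c)"
      by (rule linear_compose[OF linear_galg_mult_left[of b] linear_galg_mult_left])
  qed (rule linear_galg_mult_left, rule 2)
qed

lemma linear_ident: "linear_operator (\<lambda>v. v)"
  by (rule linear_operatorI) simp_all

lemma galg_mult_1_left: "single id 1 \<star> a = a"
  by (rule linear_operator_eqI[OF linear_galg_mult_right linear_ident]) simp

lemma group_algebra_single: "\<sigma> permutes {1..n} \<Longrightarrow> single \<sigma> c \<in> group_algebra n"
  by (auto simp: group_algebra_def split: if_splits)

lemma subspace_group_algebra: "pm.subspace (group_algebra n)"
proof (rule pm.subspaceI)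
  fix x y :: "_ \<Rightarrow>\<^sub>0 'a"
  assume "x \<in> group_algebra n" "y \<in> group_algebra n"
  then show "x + y \<in> group_algebra n"
    using Poly_Mapping.keys_add[of x y] by (auto simp: group_algebra_def)
qed (auto simp: group_algebra_def in_keys_iff)

lemma group_algebra_sum_single:
  "a \<in> group_algebra n \<Longrightarrow> (\<Sum>\<sigma>\<in>perms n. single \<sigma> (lookup a \<sigma>)) = a"
  by (rule poly_mapping_sum_single) (auto simp: group_algebra_def)

lemma group_algebra_mult:
  "a \<in> group_algebra n \<Longrightarrow> b \<in> group_algebra n \<Longrightarrow> a \<star> b \<in> group_algebra n"
  unfolding galg_mult_def
  by (intro pm.subspace_sum[OF subspace_group_algebra] group_algebra_single permutes_comp)
    (auto simp: group_algebra_def)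

lemma lookup_galg_mult_single_left:
  assumes "\<sigma> permutes {1..n}"
  shows "lookup (single \<sigma> 1 \<star> a) \<rho> = lookup a (inv \<sigma> \<circ> \<rho>)"
proof -
  have "\<sigma> \<circ> \<tau> = \<rho> \<longleftrightarrow> \<tau> = inv \<sigma> \<circ> \<rho>" for \<tau>
    using permutes_inv_o[OF assms] by (metis comp_assoc comp_id id_comp)
  then show ?thesis
    by (simp add: galg_mult_def lookup_sum lookup_single when_def in_keys_iff)
qed

lemma lookup_galg_mult_single_right:
  assumes "\<tau> permutes {1..n}"
  shows "lookup (a \<star> single \<tau> c) \<rho> = lookup a (\<rho> \<circ> inv \<tau>) * c"
proof -
  have "\<sigma> \<circ> \<tau> = \<rho> \<longleftrightarrow> \<sigma> = \<rho> \<circ> inv \<tau>" for \<sigma>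
    using permutes_inv_o[OF assms] by (metis comp_assoc comp_id)
  then show ?thesis
    by (simp add: galg_mult_def lookup_sum lookup_single when_def in_keys_iff)
qed

lemma group_algebra_eqI:
  assumes "a \<in> group_algebra n" "b \<in> group_algebra n"
    and "\<And>\<sigma>. \<sigma> permutes {1..n} \<Longrightarrow> lookup a \<sigma> = lookup b \<sigma>"
  shows "a = b"
proof (rule poly_mapping_eqI)
  fix \<sigma>
  have "\<not> \<sigma> permutes {1..n} \<Longrightarrow> lookup a \<sigma> = 0 \<and> lookup b \<sigma> = 0"
    using assms(1,2) in_keys_iff[of \<sigma> a] in_keys_iff[of \<sigma> b] unfolding group_algebra_def by blast
  then show "lookup a \<sigma> = lookup b \<sigma>" using assms(3)[of \<sigma>] by argo
qed

subsection \<open>The adjoint and positivity\<close>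

text \<open>The adjoint of left multiplication for the bilinear form in which the permutations are
  orthonormal.\<close>

definition adjoint :: "('f::field) galg \<Rightarrow> 'f galg" where
  "adjoint a = (\<Sum>\<sigma>\<in>keys a. fscale (lookup a \<sigma>) (single (inv \<sigma>) 1))"

lemma linear_adjoint: "linear_operator adjoint"
  unfolding adjoint_def by (rule linear_operator_sum_keys)

lemma adjoint_single [simp]: "adjoint (single \<sigma> c) = single (inv \<sigma>) c"
  by (simp add: adjoint_def)

lemma inv_permutes_comp:
  "\<sigma> permutes S \<Longrightarrow> \<tau> permutes S \<Longrightarrow> inv (\<sigma> \<circ> \<tau>) = inv \<tau> \<circ> inv \<sigma>"
  by (intro o_inv_distrib permutes_bij)

lemma adjoint_mult:
  assumes "a \<in> group_algebra n" "b \<in> group_algebra n"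
  shows "adjoint (a \<star> b) = adjoint b \<star> adjoint a"
proof -
  let ?s = "\<lambda>\<sigma>. single \<sigma> 1 :: 'a galg"
  have 1: "adjoint (?s \<sigma> \<star> b) = adjoint b \<star> adjoint (?s \<sigma>)" if \<sigma>: "\<sigma> permutes {1..n}" for \<sigma>
  proof (rule linear_operator_eqI[of "\<lambda>b. adjoint (?s \<sigma> \<star> b)" "\<lambda>b. adjoint b \<star> adjoint (?s \<sigma>)"])
    show "linear_operator (\<lambda>b. adjoint (?s \<sigma> \<star> b))"
      by (rule linear_compose[OF linear_galg_mult_right[of "?s \<sigma>"] linear_adjoint])
    show "linear_operator (\<lambda>b. adjoint b \<star> adjoint (?s \<sigma>))"
      by (rule linear_compose[OF linear_adjoint linear_galg_mult_left])
    fix \<tau> assume "\<tau> \<in> keys b"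
    then show "adjoint (?s \<sigma> \<star> ?s \<tau>) = adjoint (?s \<tau>) \<star> adjoint (?s \<sigma>)"
      using \<sigma> assms(2) by (simp add: group_algebra_def inv_permutes_comp[where S = "{1..n}"])
  qed
  show ?thesis
  proof (rule linear_operator_eqI[of "\<lambda>a. adjoint (a \<star> b)" "\<lambda>a. adjoint b \<star> adjoint a"])
    show "linear_operator (\<lambda>a. adjoint (a \<star> b))"
      by (rule linear_compose[OF linear_galg_mult_left[of b] linear_adjoint])
    show "linear_operator (\<lambda>a. adjoint b \<star> adjoint a)"
      by (rule linear_compose[OF linear_adjoint linear_galg_mult_right])
  qed (use 1 assms(1) in \<open>auto simp: group_algebra_def\<close>)
qed

text \<open>Positivity is only available for coefficients from the prime field; integers suffice because row
  and column sums have coefficients 0, 1 and -1.\<close>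

definition integer_coeffs :: "('x \<Rightarrow>\<^sub>0 'f::field_char_0) \<Rightarrow> bool" where
  "integer_coeffs a \<longleftrightarrow> (\<forall>x. lookup a x \<in> \<int>)"

lemma integer_coeffs_mult: "integer_coeffs a \<Longrightarrow> integer_coeffs b \<Longrightarrow> integer_coeffs (a \<star> b)"
  unfolding integer_coeffs_def galg_mult_def by (auto simp: lookup_sum lookup_single when_def intro!: Ints_sum)

text \<open>The coefficient of the identity in the product is the sum of the squares of the coefficients.\<close>

lemma adjoint_mult_eq_0_imp:
  assumes a: "a \<in> group_algebra n" "integer_coeffs a" and 0: "adjoint a \<star> a = 0"
  shows "a = 0"
proof -
  obtain z where z: "\<And>\<sigma>. lookup a \<sigma> = of_int (z \<sigma>)"
  proof -
    have "\<forall>\<sigma>. \<exists>z. lookup a \<sigma> = of_int z" using a(2) by (auto simp: integer_coeffs_def elim: Ints_cases)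
    then show ?thesis using that by metis
  qed
  have eq: "inv \<sigma> \<circ> \<tau> = id \<longleftrightarrow> \<tau> = \<sigma>" if "\<sigma> \<in> keys a" for \<sigma> \<tau>
  proof -
    have "\<sigma> permutes {1..n}" using a that by (auto simp: group_algebra_def)
    from permutes_inv_o[OF this] show ?thesis by (metis comp_assoc comp_id id_comp)
  qed
  have "adjoint a \<star> a = (\<Sum>\<sigma>\<in>keys a. \<Sum>\<tau>\<in>keys a. single (inv \<sigma> \<circ> \<tau>) (lookup a \<sigma> * lookup a \<tau>))"
    (is "_ = ?s")
  proof -
    have "single (inv \<sigma>) x \<star> a = (\<Sum>\<tau>\<in>keys a. single (inv \<sigma>) x \<star> single \<tau> (lookup a \<tau>))" for \<sigma> x
      unfolding galg_mult_sum_right[symmetric] by (simp add: poly_mapping_sum_single)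
    then show ?thesis by (simp add: adjoint_def galg_mult_sum_left)
  qed
  then have "0 = lookup ?s id" using 0 by simp
  also have "\<dots> = (\<Sum>\<sigma>\<in>keys a. \<Sum>\<tau>\<in>keys a. if \<tau> = \<sigma> then lookup a \<sigma> * lookup a \<sigma> else 0)"
    by (auto simp: lookup_sum lookup_single when_def eq intro!: sum.cong)
  also have "\<dots> = of_int (\<Sum>\<sigma>\<in>keys a. (z \<sigma>)\<^sup>2)"
    by (simp add: z power2_eq_square)
  finally have "(\<Sum>\<sigma>\<in>keys a. (z \<sigma>)\<^sup>2) = 0" by (metis of_int_eq_0_iff)
  then have "\<forall>\<sigma>\<in>keys a. z \<sigma> = 0" by (subst (asm) sum_nonneg_eq_0_iff) auto
  then show "a = 0" using z by (intro poly_mapping_eqI) (metis in_keys_iff lookup_zero of_int_0)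
qed

subsection \<open>Signed sums over subgroups\<close>

definition signed_sum :: "((nat \<Rightarrow> nat) \<Rightarrow> int) \<Rightarrow> (nat \<Rightarrow> nat) set \<Rightarrow> ('f::field) galg" where
  "signed_sum \<epsilon> H = (\<Sum>\<sigma>\<in>H. single \<sigma> (of_int (\<epsilon> \<sigma>)))"

text \<open>Row groups with the trivial sign and column groups with the sign of permutations are instances of
  the same situation: a subgroup with a homomorphism into \<open>{1, -1}\<close>.\<close>

locale signed_subgroup =
  fixes n :: nat and H :: "(nat \<Rightarrow> nat) set" and \<epsilon> :: "(nat \<Rightarrow> nat) \<Rightarrow> int"
  assumes sub: "H \<subseteq> perms n" and id_H: "id \<in> H"
    and comp_H: "\<sigma> \<in> H \<Longrightarrow> \<tau> \<in> H \<Longrightarrow> \<sigma> \<circ> \<tau> \<in> H"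
    and inv_H: "\<sigma> \<in> H \<Longrightarrow> inv \<sigma> \<in> H"
    and mult: "\<sigma> \<in> H \<Longrightarrow> \<tau> \<in> H \<Longrightarrow> \<epsilon> (\<sigma> \<circ> \<tau>) = \<epsilon> \<sigma> * \<epsilon> \<tau>"
    and square: "\<sigma> \<in> H \<Longrightarrow> \<epsilon> \<sigma> * \<epsilon> \<sigma> = 1"
begin

lemma permutes: "\<sigma> \<in> H \<Longrightarrow> \<sigma> permutes {1..n}" using sub by auto

lemma finite_H: "finite H" using finite_subset[OF sub] by simp

lemma sum_shift_left: "\<tau> \<in> H \<Longrightarrow> (\<Sum>\<sigma>\<in>H. f (\<tau> \<circ> \<sigma>)) = (\<Sum>\<sigma>\<in>H. f \<sigma>)"
  using permutes_inv_o[OF permutes[of \<tau>]]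
  by (intro sum.reindex_bij_witness[of _ "\<lambda>\<sigma>. inv \<tau> \<circ> \<sigma>" "\<lambda>\<sigma>. \<tau> \<circ> \<sigma>"])
    (auto simp: o_assoc comp_H inv_H)

lemma sum_shift_right: "\<tau> \<in> H \<Longrightarrow> (\<Sum>\<sigma>\<in>H. f (\<sigma> \<circ> \<tau>)) = (\<Sum>\<sigma>\<in>H. f \<sigma>)"
  using permutes_inv_o[OF permutes[of \<tau>]]
  by (intro sum.reindex_bij_witness[of _ "\<lambda>\<sigma>. \<sigma> \<circ> inv \<tau>" "\<lambda>\<sigma>. \<sigma> \<circ> \<tau>"])
    (auto simp: o_assoc[symmetric] comp_H inv_H)

lemma sum_inv: "(\<Sum>\<sigma>\<in>H. f (inv \<sigma>)) = (\<Sum>\<sigma>\<in>H. f \<sigma>)"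
  by (intro sum.reindex_bij_witness[of _ inv inv])
    (auto simp: inv_H permutes_inv_inv[OF permutes])

lemma sign_id: "\<epsilon> id = 1"
  using mult[OF id_H id_H] square[OF id_H] by simp

lemma sign_inv: "\<sigma> \<in> H \<Longrightarrow> \<epsilon> (inv \<sigma>) = \<epsilon> \<sigma>"
proof -
  assume \<sigma>: "\<sigma> \<in> H"
  have "\<epsilon> (inv \<sigma>) * \<epsilon> \<sigma> = 1"
    using mult[OF inv_H[OF \<sigma>] \<sigma>] sign_id permutes_inv_o(2)[OF permutes[OF \<sigma>]] by simp
  then show ?thesis
    using square[OF \<sigma>] by (metis mult.assoc mult_1 mult.right_neutral)
qed

lemma signed_sum_absorb_left:
  assumes "\<tau> \<in> H"
  shows "single \<tau> 1 \<star> signed_sum \<epsilon> H = fscale (of_int (\<epsilon> \<tau>)) (signed_sum \<epsilon> H)"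
proof -
  have "single \<tau> 1 \<star> signed_sum \<epsilon> H
    = (\<Sum>\<sigma>\<in>H. fscale (of_int (\<epsilon> \<tau>)) (single (\<tau> \<circ> \<sigma>) (of_int (\<epsilon> (\<tau> \<circ> \<sigma>)))))"
    using assms square[of \<tau>]
    by (auto simp: signed_sum_def galg_mult_sum_right mult mult.assoc[symmetric]
        simp flip: of_int_mult intro!: sum.cong)
  also have "\<dots> = fscale (of_int (\<epsilon> \<tau>)) (signed_sum \<epsilon> H)"
    by (subst sum_shift_left[OF assms]) (simp add: signed_sum_def pm.scale_sum_right)
  finally show ?thesis .
qed

lemma signed_sum_absorb_right:
  assumes "\<tau> \<in> H"
  shows "signed_sum \<epsilon> H \<star> single \<tau> 1 = fscale (of_int (\<epsilon> \<tau>)) (signed_sum \<epsilon> H)"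
proof -
  have "signed_sum \<epsilon> H \<star> single \<tau> 1
    = (\<Sum>\<sigma>\<in>H. fscale (of_int (\<epsilon> \<tau>)) (single (\<sigma> \<circ> \<tau>) (of_int (\<epsilon> (\<sigma> \<circ> \<tau>)))))"
    using assms square[of \<tau>]
    by (auto simp: signed_sum_def galg_mult_sum_left mult mult.left_commute
        simp flip: of_int_mult intro!: sum.cong)
  also have "\<dots> = fscale (of_int (\<epsilon> \<tau>)) (signed_sum \<epsilon> H)"
    by (subst sum_shift_right[OF assms]) (simp add: signed_sum_def pm.scale_sum_right)
  finally show ?thesis .
qed

lemma lookup_mult_signed_sum:
  "lookup (a \<star> signed_sum \<epsilon> H) \<sigma> = (\<Sum>h\<in>H. of_int (\<epsilon> h) * lookup a (\<sigma> \<circ> h))"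
proof -
  have "lookup (a \<star> signed_sum \<epsilon> H) \<sigma> = (\<Sum>h\<in>H. of_int (\<epsilon> (inv h)) * lookup a (\<sigma> \<circ> inv h))"
    unfolding signed_sum_def galg_mult_sum_right lookup_sum
    by (intro sum.cong refl) (simp add: lookup_galg_mult_single_right[OF permutes] sign_inv)
  then show ?thesis by (simp add: sum_inv[of "\<lambda>h. of_int (\<epsilon> h) * lookup a (\<sigma> \<circ> h)"])
qed

lemma signed_sum_square: "signed_sum \<epsilon> H \<star> signed_sum \<epsilon> H = fscale (of_nat (card H)) (signed_sum \<epsilon> H)"
proof -
  have "signed_sum \<epsilon> H \<star> signed_sum \<epsilon> H
    = (\<Sum>\<sigma>\<in>H. fscale (of_int (\<epsilon> \<sigma>)) (single \<sigma> 1 \<star> signed_sum \<epsilon> H))"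
    by (subst signed_sum_def) (simp add: galg_mult_sum_left flip: galg_mult_scale_left)
  also have "\<dots> = (\<Sum>\<sigma>\<in>H. signed_sum \<epsilon> H)"
    using square by (intro sum.cong refl) (auto simp: signed_sum_absorb_left simp flip: of_int_mult)
  also have "\<dots> = fscale (of_nat (card H)) (signed_sum \<epsilon> H)"
    by (rule poly_mapping_eqI) (simp add: lookup_sum)
  finally show ?thesis .
qed

lemma signed_sum_in_group_algebra: "signed_sum \<epsilon> H \<in> group_algebra n"
  unfolding signed_sum_def
  by (intro pm.subspace_sum[OF subspace_group_algebra] group_algebra_single permutes)

lemma adjoint_signed_sum: "adjoint (signed_sum \<epsilon> H) = signed_sum \<epsilon> H"
  unfolding signed_sum_def module_hom.sum[OF linear_adjoint] adjoint_single
  by (subst (2) sum_inv[symmetric]) (simp add: sign_inv)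

lemma integer_coeffs_signed_sum: "integer_coeffs (signed_sum \<epsilon> H)"
  by (auto simp: integer_coeffs_def signed_sum_def lookup_sum lookup_single when_def intro!: Ints_sum)

end

section \<open>Young tableaux\<close>

lemma sum_list_take_mono: "i \<le> j \<Longrightarrow> sum_list (take i p) \<le> sum_list (take j (p :: nat list))"
  using take_add[of i "j - i" p] by simp

text \<open>The entries of the first \<open>i\<close> rows are the smallest ones. This characterization of \<open>tab_row\<close> is the
  basis of all computations with tableaux.\<close>

lemma tab_row_less_iff:
  assumes "1 \<le> k" "k \<le> sum_list p"
  shows "tab_row p k < i \<longleftrightarrow> k \<le> sum_list (take i p)"
proof
  have "k \<le> sum_list (take (Suc (length p)) p)" using assms by simp
  then have "k \<le> sum_list (take (Suc (tab_row p k)) p)"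
    unfolding tab_row_def by (rule LeastI)
  then show "tab_row p k < i \<Longrightarrow> k \<le> sum_list (take i p)"
    using sum_list_take_mono[of "Suc (tab_row p k)" i p] by simp
next
  assume k: "k \<le> sum_list (take i p)"
  then obtain j where "i = Suc j" using assms by (cases i) auto
  with k show "tab_row p k < i" by (auto simp: tab_row_def less_Suc_eq_le intro: Least_le)
qed

lemma tab_row_col:
  assumes "1 \<le> k" "k \<le> sum_list p"
  shows "tab_row p k < length p" "1 \<le> tab_col p k" "tab_col p k \<le> p ! tab_row p k"
    "k = sum_list (take (tab_row p k) p) + tab_col p k"
proof -
  let ?i = "tab_row p k"
  show len: "?i < length p" using assms by (simp add: tab_row_less_iff)
  have "\<not> k \<le> sum_list (take ?i p)" using tab_row_less_iff[OF assms, of ?i] by simp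
  moreover have "k \<le> sum_list (take (Suc ?i) p)" using tab_row_less_iff[OF assms, of "Suc ?i"] by simp
  ultimately show "1 \<le> tab_col p k" "tab_col p k \<le> p ! ?i" "k = sum_list (take ?i p) + tab_col p k"
    using len by (auto simp: tab_col_def take_Suc_conv_app_nth)
qed

lemma tab_cell:
  assumes "i < length p" "1 \<le> c" "c \<le> p ! i"
  defines "k \<equiv> sum_list (take i p) + c"
  shows "k \<in> {1..sum_list p}" "tab_row p k = i" "tab_col p k = c"
proof -
  have le: "k \<le> sum_list (take (Suc i) p)"
    using assms by (simp add: take_Suc_conv_app_nth)
  also have "\<dots> \<le> sum_list p"
    using sum_list_take_mono[of "Suc i" "length p" p] assms(1) by simp
  finally show k: "k \<in> {1..sum_list p}" using assms by simp
  have "tab_row p k < Suc i" using k le by (subst tab_row_less_iff) auto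
  moreover have "\<not> tab_row p k < i" using k assms by (subst tab_row_less_iff) auto
  ultimately show "tab_row p k = i" by simp
  then show "tab_col p k = c" by (simp add: tab_col_def k_def)
qed

lemma inj_on_tab: "inj_on (\<lambda>k. (tab_row p k, tab_col p k)) {1..sum_list p}"
proof (rule inj_onI)
  fix k l assume "k \<in> {1..sum_list p}" "l \<in> {1..sum_list p}"
    and "(tab_row p k, tab_col p k) = (tab_row p l, tab_col p l)"
  then show "k = l" using tab_row_col(4)[of k p] tab_row_col(4)[of l p] by simp
qed

definition col_height :: "nat list \<Rightarrow> nat \<Rightarrow> nat" where
  "col_height p c = card {i. i < length p \<and> c \<le> p ! i}"

lemma down_closed_eq_lessThan:
  assumes "finite D" and down: "\<And>i j. i \<in> D \<Longrightarrow> j < i \<Longrightarrow> j \<in> D"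
  shows "D = {..<card D :: nat}"
proof -
  obtain m0 where "m0 \<notin> D" using assms(1) ex_new_if_finite infinite_UNIV_nat by blast
  define m where "m = (LEAST m. m \<notin> D)"
  have "m \<notin> D" unfolding m_def using \<open>m0 \<notin> D\<close> by (rule LeastI)
  moreover have "j \<in> D" if "j < m" for j using not_less_Least that unfolding m_def by blast
  moreover have "j < m" if "j \<in> D" for j
    using down[OF that, of m] \<open>m \<notin> D\<close> that by (cases j m rule: linorder_cases) auto
  ultimately have "D = {..<m}" by auto
  then show ?thesis by simp
qed

text \<open>Since the rows get shorter, a column occupies an initial segment of the rows.\<close>

lemma less_col_height_iff:
  assumes "sorted_wrt (\<ge>) p"
  shows "i < col_height p c \<longleftrightarrow> i < length p \<and> c \<le> p ! i"
proof -
  let ?D = "{i. i < length p \<and> c \<le> p ! i}"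
  have "?D = {..<card ?D}"
  proof (rule down_closed_eq_lessThan)
    fix i j assume "i \<in> ?D" "j < i"
    then show "j \<in> ?D" using sorted_wrt_nth_less[OF assms, of j i] by auto
  qed simp
  then show ?thesis unfolding col_height_def by blast
qed

lemma card_column:
  assumes p: "sorted_wrt (\<ge>) p" and c: "1 \<le> c"
  shows "card {k \<in> {1..sum_list p}. tab_col p k = c \<and> tab_row p k < i} = min i (col_height p c)"
proof -
  have "bij_betw (tab_row p) {k \<in> {1..sum_list p}. tab_col p k = c \<and> tab_row p k < i}
    {..<min i (col_height p c)}"
  proof (rule bij_betw_imageI)
    show "inj_on (tab_row p) {k \<in> {1..sum_list p}. tab_col p k = c \<and> tab_row p k < i}"
      using inj_on_tab[of p] by (auto simp: inj_on_def)
    show "tab_row p ` {k \<in> {1..sum_list p}. tab_col p k = c \<and> tab_row p k < i}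
      = {..<min i (col_height p c)}" (is "?L = ?R")
    proof
      show "?L \<subseteq> ?R" using tab_row_col by (auto simp: less_col_height_iff[OF p])
      show "?R \<subseteq> ?L"
      proof
        fix j assume "j \<in> ?R"
        then have "j < i" "j < length p" "c \<le> p ! j" by (auto simp: less_col_height_iff[OF p])
        then show "j \<in> ?L"
          using tab_cell[of j p c] c by (intro image_eqI[of _ _ "sum_list (take j p) + c"]) auto
      qed
    qed
  qed
  then show ?thesis by (simp add: bij_betw_same_card)
qed

lemma card_column_all:
  assumes p: "sorted_wrt (\<ge>) p" and c: "1 \<le> c"
  shows "card {k \<in> {1..sum_list p}. tab_col p k = c} = col_height p c"
proof -
  have "{k \<in> {1..sum_list p}. tab_col p k = c}
    = {k \<in> {1..sum_list p}. tab_col p k = c \<and> tab_row p k < length p}"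
    using tab_row_col(1) by auto
  moreover have "col_height p c \<le> length p"
    unfolding col_height_def by (rule order_trans[OF card_mono[of "{..<length p}"]]) auto
  ultimately show ?thesis using card_column[OF assms, of "length p"] by simp
qed

lemma card_rows:
  "card {k \<in> {1..sum_list p}. tab_row p k < i} = sum_list (take i p)"
proof -
  have "sum_list (take i p) \<le> sum_list p"
    using sum_list_take_mono[of i "max i (length p)" p] by simp
  then have "{k \<in> {1..sum_list p}. tab_row p k < i} = {1..sum_list (take i p)}"
    by (auto simp: tab_row_less_iff)
  then show ?thesis by (simp only: card_atLeastAtMost diff_Suc_1')
qed

lemma sum_card_fibres:
  assumes "finite A" "finite D" "c ` A \<subseteq> D"
  shows "card A = (\<Sum>d\<in>D. card {k \<in> A. c k = d})"
proof -
  have "A = (\<Union>d\<in>D. {k \<in> A. c k = d})" using assms(3) by auto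
  then have "card A = card (\<Union>d\<in>D. {k \<in> A. c k = d})" by simp
  also have "\<dots> = (\<Sum>d\<in>D. card {k \<in> A. c k = d})"
    using assms by (intro card_UN_disjoint) auto
  finally show ?thesis .
qed

lemma tab_col_range: "k \<in> {1..sum_list p} \<Longrightarrow> tab_col p k \<in> {1..sum_list p}"
  using tab_row_col(2,4)[of k p] by auto

text \<open>Both sides count the cells in the first \<open>i\<close> rows, once by columns and once by rows.\<close>

lemma sum_min_col_height:
  assumes p: "sorted_wrt (\<ge>) p"
  shows "(\<Sum>c\<in>{1..sum_list p}. min i (col_height p c)) = sum_list (take i p)"
proof -
  let ?A = "{k \<in> {1..sum_list p}. tab_row p k < i}"
  have "sum_list (take i p) = card ?A" by (rule card_rows[symmetric])
  also have "\<dots> = (\<Sum>c\<in>{1..sum_list p}. card {k \<in> ?A. tab_col p k = c})"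
  proof (rule sum_card_fibres)
    show "tab_col p ` ?A \<subseteq> {1..sum_list p}" using tab_col_range by blast
  qed auto
  also have "\<dots> = (\<Sum>c\<in>{1..sum_list p}. min i (col_height p c))"
  proof (rule sum.cong[OF refl])
    fix c assume "c \<in> {1..sum_list p}"
    moreover have "{k \<in> ?A. tab_col p k = c}
      = {k \<in> {1..sum_list p}. tab_col p k = c \<and> tab_row p k < i}" by auto
    ultimately show "card {k \<in> ?A. tab_col p k = c} = min i (col_height p c)"
      using card_column[OF p, of c i] by simp
  qed
  finally show ?thesis by simp
qed

text \<open>The canonical tableau of shape \<open>p\<close> is compared with the tableau of shape \<open>q\<close> in which \<open>\<sigma>\<close>
  has been applied to the entries. The last assumption says that no two entries share a row of the former and
  a column of the latter.\<close>

locale transversal_tableaux =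
  fixes p q :: "nat list" and n :: nat and \<sigma> :: "nat \<Rightarrow> nat"
  assumes p: "sorted_wrt (\<ge>) p" "sum_list p = n" and q: "sorted_wrt (\<ge>) q" "sum_list q = n"
    and \<sigma>: "\<sigma> permutes {1..n}"
    and inj: "inj_on (\<lambda>k. (tab_row p k, tab_col q (inv \<sigma> k))) {1..n}"
begin

abbreviation "c k \<equiv> tab_col q (inv \<sigma> k)"

lemma inv_in: "k \<in> {1..n} \<Longrightarrow> inv \<sigma> k \<in> {1..n}"
  using permutes_in_image[OF permutes_inv[OF \<sigma>]] by blast

lemma c_range: "k \<in> {1..n} \<Longrightarrow> c k \<in> {1..n}"
  using tab_col_range[of "inv \<sigma> k" q] inv_in q(2) by simp

lemma card_column_c: "1 \<le> d \<Longrightarrow> card {k \<in> {1..n}. c k = d} = col_height q d"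
proof -
  assume d: "1 \<le> d"
  have "bij_betw (inv \<sigma>) {k \<in> {1..n}. c k = d} {k \<in> {1..n}. tab_col q k = d}"
  proof (rule bij_betw_imageI)
    show "inj_on (inv \<sigma>) {k \<in> {1..n}. c k = d}"
      using permutes_inj[OF permutes_inv[OF \<sigma>]] by (rule inj_on_subset) simp
    show "inv \<sigma> ` {k \<in> {1..n}. c k = d} = {k \<in> {1..n}. tab_col q k = d}"
    proof
      show "{k \<in> {1..n}. tab_col q k = d} \<subseteq> inv \<sigma> ` {k \<in> {1..n}. c k = d}"
      proof
        fix k assume k: "k \<in> {k \<in> {1..n}. tab_col q k = d}"
        then have "\<sigma> k \<in> {1..n}" "inv \<sigma> (\<sigma> k) = k"
          using permutes_in_image[OF \<sigma>] permutes_inverses(2)[OF \<sigma>] by auto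
        then show "k \<in> inv \<sigma> ` {k \<in> {1..n}. c k = d}" using k by (intro image_eqI[of _ _ "\<sigma> k"]) auto
      qed
    qed (use inv_in in auto)
  qed
  then show ?thesis using card_column_all[OF q(1) d] q(2) by (simp add: bij_betw_same_card)
qed

text \<open>By transversality a column of the second tableau meets each of the first \<open>i\<close> rows at most once.\<close>

lemma card_column_rows_le:
  assumes "1 \<le> d"
  shows "card {k \<in> {1..n}. c k = d \<and> tab_row p k < i} \<le> min i (col_height q d)"
proof -
  have "card {k \<in> {1..n}. c k = d \<and> tab_row p k < i} \<le> card {..<i}"
  proof (rule card_inj_on_le[of "tab_row p"])
    show "inj_on (tab_row p) {k \<in> {1..n}. c k = d \<and> tab_row p k < i}"
    proof (rule inj_onI)
      fix k l assume kl: "k \<in> {k \<in> {1..n}. c k = d \<and> tab_row p k < i}"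
        "l \<in> {k \<in> {1..n}. c k = d \<and> tab_row p k < i}" "tab_row p k = tab_row p l"
      then show "k = l" by (intro inj_onD[OF inj]) auto
    qed
  qed auto
  moreover have "card {k \<in> {1..n}. c k = d \<and> tab_row p k < i} \<le> card {k \<in> {1..n}. c k = d}"
    by (intro card_mono) auto
  ultimately show ?thesis using card_column_c[OF assms] by simp
qed

lemma sum_card_column_rows:
  "(\<Sum>d\<in>{1..n}. card {k \<in> {1..n}. c k = d \<and> tab_row p k < i}) = sum_list (take i p)"
proof -
  let ?A = "{k \<in> {1..n}. tab_row p k < i}"
  have "card ?A = (\<Sum>d\<in>{1..n}. card {k \<in> ?A. c k = d})"
  proof (rule sum_card_fibres)
    show "c ` ?A \<subseteq> {1..n}" using c_range by blast
  qed auto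
  moreover have "{k \<in> ?A. c k = d} = {k \<in> {1..n}. c k = d \<and> tab_row p k < i}" for d by auto
  ultimately show ?thesis using card_rows[of p i] p(2) by simp
qed

text \<open>Summing the preceding estimate over all columns compares the numbers of cells in the first \<open>i\<close>
  rows of the two shapes.\<close>

lemma dominated: "sum_list (take i p) \<le> sum_list (take i q)"
proof -
  have "sum_list (take i p) = (\<Sum>d\<in>{1..n}. card {k \<in> {1..n}. c k = d \<and> tab_row p k < i})"
    by (rule sum_card_column_rows[symmetric])
  also have "\<dots> \<le> (\<Sum>d\<in>{1..n}. min i (col_height q d))"
    by (intro sum_mono card_column_rows_le) auto
  also have "\<dots> = sum_list (take i q)" using sum_min_col_height[OF q(1)] q(2) by simp
  finally show ?thesis .
qed

text \<open>For equal shapes the sums of the column-wise estimates agree, so every estimate is an equality. For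
  \<open>i\<close> equal to the height of the column it says that the whole column lies in the first \<open>i\<close> rows.\<close>

lemma row_less_col_height:
  assumes "p = q" and k: "k \<in> {1..n}"
  shows "tab_row p k < col_height p (c k)"
proof -
  define h where "h = col_height q (c k)"
  have d: "c k \<in> {1..n}" using c_range[OF k] .
  have "(\<Sum>d\<in>{1..n}. card {k \<in> {1..n}. c k = d \<and> tab_row p k < h})
    = (\<Sum>d\<in>{1..n}. min h (col_height q d))"
    using sum_card_column_rows[of h] sum_min_col_height[OF q(1), of h] q(2) assms(1) by simp
  then have "card {k' \<in> {1..n}. c k' = c k \<and> tab_row p k' < h} = min h (col_height q (c k))"
  proof (rule sum_mono_inv[OF _ _ d])
    fix e assume "e \<in> {1..n}"
    then show "card {k \<in> {1..n}. c k = e \<and> tab_row p k < h} \<le> min h (col_height q e)"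
      by (intro card_column_rows_le) simp
  qed simp
  then have "card {k' \<in> {1..n}. c k' = c k \<and> tab_row p k' < h} = card {k' \<in> {1..n}. c k' = c k}"
    using card_column_c[of "c k"] d by (simp add: h_def)
  then have "{k' \<in> {1..n}. c k' = c k \<and> tab_row p k' < h} = {k' \<in> {1..n}. c k' = c k}"
    by (intro card_subset_eq) auto
  then have "k \<in> {k' \<in> {1..n}. c k' = c k \<and> tab_row p k' < h}" using k by auto
  then show ?thesis using assms(1) by (simp add: h_def)
qed

text \<open>By the preceding lemma the row of an entry in the first tableau and its column in the second one
  determine a cell of the diagram. Moving every entry to this cell is a row permutation, and its composition
  with \<open>\<sigma>\<close> preserves the columns.\<close>

lemma row_col_factorization:
  assumes "p = q"
  shows "\<exists>\<rho>\<in>row_stabilizer p. \<exists>\<tau>\<in>col_stabilizer p. \<sigma> = \<rho> \<circ> \<tau>"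
proof -
  define \<eta> where "\<eta> k = (if k \<in> {1..n} then sum_list (take (tab_row p k) p) + c k else k)" for k
  have \<eta>: "\<eta> k \<in> {1..n}" "tab_row p (\<eta> k) = tab_row p k" "tab_col p (\<eta> k) = c k"
    if k: "k \<in> {1..n}" for k
  proof -
    have "tab_row p k < length p" "c k \<le> p ! tab_row p k"
      using row_less_col_height[OF assms k] p(1) by (auto simp: less_col_height_iff)
    then show "\<eta> k \<in> {1..n}" "tab_row p (\<eta> k) = tab_row p k" "tab_col p (\<eta> k) = c k"
      using tab_cell[of "tab_row p k" p "c k"] c_range[OF k] k p(2) by (auto simp: \<eta>_def)
  qed
  have "inj_on \<eta> {1..n}" 
  proof (rule inj_onI)
    fix k l assume k: "k \<in> {1..n}" and l: "l \<in> {1..n}" and "\<eta> k = \<eta> l"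
    then have "(tab_row p k, c k) = (tab_row p l, c l)" using \<eta>(2,3) by metis
    then show "k = l" using inj k l by (auto dest: inj_onD)
  qed
  moreover have "\<eta> ` {1..n} \<subseteq> {1..n}" using \<eta>(1) by blast
  ultimately have "bij_betw \<eta> {1..n} {1..n}"
    using endo_inj_surj[of "{1..n}" \<eta>] by (simp add: bij_betw_def)
  then have perm: "\<eta> permutes {1..n}" by (rule bij_imp_permutes) (auto simp: \<eta>_def)
  have in_inv: "inv \<eta> k \<in> {1..n}" if "k \<in> {1..n}" for k
    using permutes_in_image[OF permutes_inv[OF perm]] that by blast
  have "tab_row p (inv \<eta> k) = tab_row p k" if "k \<in> {1..n}" for k
    using \<eta>(2)[OF in_inv[OF that]] permutes_inverses(1)[OF perm] by simp
  then have 1: "inv \<eta> \<in> row_stabilizer p"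
    using permutes_inv[OF perm] p(2) by (simp add: row_stabilizer_def)
  have "tab_col p (\<eta> (\<sigma> k)) = tab_col p k" if "k \<in> {1..n}" for k
    using \<eta>(3)[of "\<sigma> k"] permutes_in_image[OF \<sigma>, of k] that permutes_inverses(2)[OF \<sigma>] assms by simp
  then have 2: "\<eta> \<circ> \<sigma> \<in> col_stabilizer p"
    using permutes_comp[OF perm \<sigma>] p(2) by (simp add: col_stabilizer_def)
  have "\<sigma> = inv \<eta> \<circ> (\<eta> \<circ> \<sigma>)" using permutes_inv_o(2)[OF perm] by (simp add: o_assoc)
  then show ?thesis using 1 2 by blast
qed

end

section \<open>Young symmetrizers and irreducible characters\<close>

abbreviation row_sum :: "nat list \<Rightarrow> ('f::field) galg" where
  "row_sum p \<equiv> signed_sum (\<lambda>_. 1) (row_stabilizer p)"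
abbreviation col_sum :: "nat list \<Rightarrow> ('f::field) galg" where
  "col_sum p \<equiv> signed_sum sign (col_stabilizer p)"

lemma young_symmetrizer_eq: "young_symmetrizer p = row_sum p \<star> col_sum p"
  unfolding young_symmetrizer_def signed_sum_def galg_mult_sum_left galg_mult_sum_right
  by (subst sum.swap) simp

lemma signed_subgroup_stabilizer:
  assumes "\<And>\<sigma> \<tau>. \<sigma> permutes {1..n} \<Longrightarrow> \<tau> permutes {1..n} \<Longrightarrow> \<epsilon> (\<sigma> \<circ> \<tau>) = \<epsilon> \<sigma> * \<epsilon> \<tau>"
    and "\<And>\<sigma>. \<epsilon> \<sigma> * \<epsilon> \<sigma> = 1"
  shows "signed_subgroup n {\<sigma>. \<sigma> permutes {1..n} \<and> (\<forall>k\<in>{1..n}. f (\<sigma> k) = f k)} \<epsilon>"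
proof
  fix \<sigma> \<tau>
  assume \<sigma>: "\<sigma> \<in> {\<sigma>. \<sigma> permutes {1..n} \<and> (\<forall>k\<in>{1..n}. f (\<sigma> k) = f k)}"
    and \<tau>: "\<tau> \<in> {\<sigma>. \<sigma> permutes {1..n} \<and> (\<forall>k\<in>{1..n}. f (\<sigma> k) = f k)}"
  have "f (\<sigma> (\<tau> k)) = f k" if "k \<in> {1..n}" for k
  proof -
    have "\<tau> k \<in> {1..n}" using \<tau> that permutes_in_image[of \<tau>] by blast
    then show ?thesis using \<sigma> \<tau> that by auto
  qed
  then show "\<sigma> \<circ> \<tau> \<in> {\<sigma>. \<sigma> permutes {1..n} \<and> (\<forall>k\<in>{1..n}. f (\<sigma> k) = f k)}"
    using \<sigma> \<tau> permutes_comp by auto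
  show "\<epsilon> (\<sigma> \<circ> \<tau>) = \<epsilon> \<sigma> * \<epsilon> \<tau>" using \<sigma> \<tau> assms(1) by simp
next
  fix \<sigma>
  assume \<sigma>: "\<sigma> \<in> {\<sigma>. \<sigma> permutes {1..n} \<and> (\<forall>k\<in>{1..n}. f (\<sigma> k) = f k)}"
  then have perm: "\<sigma> permutes {1..n}" by simp
  have "f (inv \<sigma> k) = f k" if "k \<in> {1..n}" for k
  proof -
    have "inv \<sigma> k \<in> {1..n}" using that permutes_in_image[OF permutes_inv[OF perm]] by blast
    then have "f (\<sigma> (inv \<sigma> k)) = f (inv \<sigma> k)" using \<sigma> by blast
    then show ?thesis by (simp add: permutes_inverses(1)[OF perm])
  qed
  then show "inv \<sigma> \<in> {\<sigma>. \<sigma> permutes {1..n} \<and> (\<forall>k\<in>{1..n}. f (\<sigma> k) = f k)}"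
    using permutes_inv[OF perm] by blast
qed (use assms in \<open>auto simp: permutes_id\<close>)

lemma permutes_permutation: "\<sigma> permutes {1..n::nat} \<Longrightarrow> permutation \<sigma>"
  by (rule permutes_imp_permutation[OF finite_atLeastAtMost])

interpretation row: signed_subgroup "sum_list p" "row_stabilizer p" "\<lambda>_. 1" for p
  unfolding row_stabilizer_def by (rule signed_subgroup_stabilizer) simp_all

interpretation col: signed_subgroup "sum_list p" "col_stabilizer p" sign for p
  unfolding col_stabilizer_def
  by (rule signed_subgroup_stabilizer)
    (rule sign_compose[OF permutes_permutation permutes_permutation], assumption+, rule sign_idempotent)

lemma young_in_group_algebra: "young_symmetrizer p \<in> group_algebra (sum_list p)"
  unfolding young_symmetrizer_eq
  by (intro group_algebra_mult row.signed_sum_in_group_algebra col.signed_sum_in_group_algebra)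

text \<open>The transposition of \<open>k\<close> and \<open>l\<close> is absorbed by the row sum from the left of \<open>\<sigma>\<close>. Moved to
  the right of \<open>\<sigma>\<close>, it becomes a transposition in the column group and changes the sign.\<close>

lemma row_single_col_eq_0:
  fixes p q :: "nat list"
  assumes n: "sum_list p = n" "sum_list q = n" and \<sigma>: "\<sigma> permutes {1..n}"
    and k: "k \<in> {1..n}" and l: "l \<in> {1..n}" and "k \<noteq> l"
    and row: "tab_row p k = tab_row p l" and col: "tab_col q (inv \<sigma> k) = tab_col q (inv \<sigma> l)"
  shows "row_sum p \<star> single \<sigma> 1 \<star> col_sum q = (0 :: _ \<Rightarrow>\<^sub>0 'f::field_char_0)"
proof -
  let ?k = "inv \<sigma> k" and ?l = "inv \<sigma> l"
  let ?x = "row_sum p \<star> single \<sigma> 1 \<star> col_sum q :: 'f galg"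
  have in_inv: "?k \<in> {1..n}" "?l \<in> {1..n}"
    using k l permutes_in_image[OF permutes_inv[OF \<sigma>]] by blast+
  have "transpose k l \<in> row_stabilizer p"
    using n permutes_swap_id[OF k l] row
    by (auto simp: row_stabilizer_def transpose_def)
  then have t: "row_sum p \<star> single (transpose k l) 1 = (row_sum p :: 'f galg)"
    by (simp add: row.signed_sum_absorb_right)
  have t': "transpose ?k ?l \<in> col_stabilizer q"
    using n permutes_swap_id[OF in_inv] col
    by (auto simp: col_stabilizer_def transpose_def)
  have "?k \<noteq> ?l" using \<open>k \<noteq> l\<close> permutes_inverses(1)[OF \<sigma>] by metis
  with col.signed_sum_absorb_left[OF t']
  have t': "single (transpose ?k ?l) 1 \<star> col_sum q = (- col_sum q :: 'f galg)"
    by (simp add: sign_swap_id)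
  have "transpose k l \<circ> \<sigma> = \<sigma> \<circ> transpose ?k ?l"
  proof
    fix x
    have "\<sigma> x = k \<longleftrightarrow> x = ?k" "\<sigma> x = l \<longleftrightarrow> x = ?l"
      using permutes_inverses[OF \<sigma>] by auto
    then show "(transpose k l \<circ> \<sigma>) x = (\<sigma> \<circ> transpose ?k ?l) x"
      using permutes_inverses(1)[OF \<sigma>] by (auto simp: transpose_def)
  qed
  then have comm: "single (transpose k l) 1 \<star> single \<sigma> 1
    = (single \<sigma> 1 \<star> single (transpose ?k ?l) 1 :: 'f galg)" by simp
  have "?x = (row_sum p \<star> single (transpose k l) 1) \<star> single \<sigma> 1 \<star> col_sum q" by (simp only: t)
  also have "\<dots> = row_sum p \<star> (single (transpose k l) 1 \<star> single \<sigma> 1) \<star> col_sum q"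
    by (simp only: galg_mult_assoc)
  also have "\<dots> = row_sum p \<star> single \<sigma> 1 \<star> (single (transpose ?k ?l) 1 \<star> col_sum q)"
    unfolding comm by (simp only: galg_mult_assoc)
  also have "\<dots> = - ?x" by (simp add: t' galg_mult_uminus_right)
  finally have eq: "?x = - ?x" .
  show "?x = 0"
  proof (rule poly_mapping_eqI)
    fix \<rho>
    from eq have "lookup ?x \<rho> = - lookup ?x \<rho>" by (metis lookup_uminus)
    then show "lookup ?x \<rho> = lookup 0 \<rho>" by simp
  qed
qed

definition dominated :: "nat list \<Rightarrow> nat list \<Rightarrow> bool" where
  "dominated p q \<longleftrightarrow> (\<forall>i. sum_list (take i p) \<le> sum_list (take i q))"

lemma row_single_col_not_dominated:
  assumes p: "p \<in> partitions n" and q: "q \<in> partitions n" and "\<not> dominated p q"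
    and \<sigma>: "\<sigma> permutes {1..n}"
  shows "row_sum p \<star> single \<sigma> 1 \<star> col_sum q = (0 :: _ \<Rightarrow>\<^sub>0 'f::field_char_0)"
proof (rule ccontr)
  assume nz: "row_sum p \<star> single \<sigma> 1 \<star> col_sum q \<noteq> (0 :: 'f galg)"
  have n: "sum_list p = n" "sum_list q = n" using p q by (auto simp: partitions_def)
  have "inj_on (\<lambda>k. (tab_row p k, tab_col q (inv \<sigma> k))) {1..n}"
  proof (rule inj_onI, rule ccontr)
    fix k l assume "k \<in> {1..n}" "l \<in> {1..n}" "k \<noteq> l"
      and "(tab_row p k, tab_col q (inv \<sigma> k)) = (tab_row p l, tab_col q (inv \<sigma> l))"
    then show False using row_single_col_eq_0[OF n \<sigma>, of k l] nz by blast
  qed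
  then interpret transversal_tableaux p q n \<sigma>
    using p q \<sigma> by unfold_locales (auto simp: partitions_def)
  show False using dominated \<open>\<not> dominated p q\<close> by (simp add: dominated_def)
qed

text \<open>Either two entries share a row and a column, or \<open>\<sigma>\<close> is a product of a row permutation and a
  column permutation, which the two sums absorb.\<close>

lemma row_single_col_multiple:
  assumes p: "p \<in> partitions n" and \<sigma>: "\<sigma> permutes {1..n}"
  shows "\<exists>t. row_sum p \<star> single \<sigma> 1 \<star> col_sum p = fscale t (young_symmetrizer p :: _ \<Rightarrow>\<^sub>0 'f::field_char_0)"
proof (cases "row_sum p \<star> single \<sigma> 1 \<star> col_sum p = (0 :: 'f galg)")
  case True
  then show ?thesis by (intro exI[of _ 0]) simp
next
  case False
  have n: "sum_list p = n" using p by (auto simp: partitions_def)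
  have "inj_on (\<lambda>k. (tab_row p k, tab_col p (inv \<sigma> k))) {1..n}"
  proof (rule inj_onI, rule ccontr)
    fix k l assume "k \<in> {1..n}" "l \<in> {1..n}" "k \<noteq> l"
      and "(tab_row p k, tab_col p (inv \<sigma> k)) = (tab_row p l, tab_col p (inv \<sigma> l))"
    then show False using row_single_col_eq_0[OF n n \<sigma>, of k l] False by blast
  qed
  then interpret transversal_tableaux p p n \<sigma>
    using p \<sigma> by unfold_locales (auto simp: partitions_def)
  obtain \<rho> \<tau> where \<rho>: "\<rho> \<in> row_stabilizer p" and \<tau>: "\<tau> \<in> col_stabilizer p" and "\<sigma> = \<rho> \<circ> \<tau>"
    using row_col_factorization by blast
  then have "single \<sigma> 1 = (single \<rho> 1 \<star> single \<tau> 1 :: 'f galg)" by simp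
  then have "row_sum p \<star> single \<sigma> 1 \<star> col_sum p
    = (row_sum p \<star> single \<rho> 1) \<star> (single \<tau> 1 \<star> col_sum p :: 'f galg)"
    by (simp only: galg_mult_assoc)
  also have "\<dots> = fscale (of_int (sign \<tau>)) (young_symmetrizer p)"
    by (simp add: row.signed_sum_absorb_right[OF \<rho>] col.signed_sum_absorb_left[OF \<tau>]
        galg_mult_scale_right young_symmetrizer_eq)
  finally show ?thesis ..
qed

lemma sandwich_expand:
  assumes "x \<in> group_algebra n"
  shows "a \<star> x \<star> b = (\<Sum>\<sigma>\<in>perms n. fscale (lookup x \<sigma>) (a \<star> single \<sigma> 1 \<star> b))"
proof -
  have "a \<star> x \<star> b = a \<star> (\<Sum>\<sigma>\<in>perms n. fscale (lookup x \<sigma>) (single \<sigma> 1)) \<star> b"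
    using group_algebra_sum_single[OF assms] by simp
  then show ?thesis
    by (simp only: galg_mult_sum_left galg_mult_sum_right galg_mult_scale_left galg_mult_scale_right)
qed

lemma row_col_sandwich_0:
  assumes "p \<in> partitions n" "q \<in> partitions n" "\<not> dominated p q" "x \<in> group_algebra n"
  shows "row_sum p \<star> x \<star> col_sum q = (0 :: _ \<Rightarrow>\<^sub>0 'f::field_char_0)"
  unfolding sandwich_expand[OF assms(4)]
  by (rule sum.neutral) (simp add: row_single_col_not_dominated[OF assms(1-3)])

lemma row_col_sandwich:
  assumes "p \<in> partitions n" "x \<in> group_algebra n"
  shows "\<exists>t. row_sum p \<star> x \<star> col_sum p = fscale t (young_symmetrizer p :: _ \<Rightarrow>\<^sub>0 'f::field_char_0)"
proof -
  have "\<forall>\<sigma>. \<exists>t. \<sigma> permutes {1..n} \<longrightarrow>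
      row_sum p \<star> single \<sigma> 1 \<star> col_sum p = fscale t (young_symmetrizer p :: 'f galg)"
    using row_single_col_multiple[OF assms(1)] by blast
  then obtain t where "\<And>\<sigma>. \<sigma> permutes {1..n} \<Longrightarrow>
      row_sum p \<star> single \<sigma> 1 \<star> col_sum p = fscale (t \<sigma>) (young_symmetrizer p :: 'f galg)"
    by metis
  then have "row_sum p \<star> x \<star> col_sum p
    = fscale (\<Sum>\<sigma>\<in>perms n. lookup x \<sigma> * t \<sigma>) (young_symmetrizer p)"
    unfolding sandwich_expand[OF assms(2)] by (simp add: pm.scale_sum_left)
  then show ?thesis ..
qed

text \<open>Only the identity preserves both rows and columns, so the product of the row sum and the column sum
  contains the identity exactly once.\<close>

lemma young_coeff_id: "lookup (young_symmetrizer p :: _ \<Rightarrow>\<^sub>0 'f::field_char_0) id = 1"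
proof -
  have eq: "\<sigma> \<circ> \<tau> = id \<longleftrightarrow> \<sigma> = id \<and> \<tau> = id"
    if \<sigma>: "\<sigma> \<in> row_stabilizer p" and \<tau>: "\<tau> \<in> col_stabilizer p" for \<sigma> \<tau>
  proof
    assume st: "\<sigma> \<circ> \<tau> = id"
    have "\<tau> k = k" if k: "k \<in> {1..sum_list p}" for k
    proof -
      have \<tau>k: "\<tau> k \<in> {1..sum_list p}" using permutes_in_image[OF col.permutes[OF \<tau>]] k by blast
      have "\<sigma> (\<tau> k) = k" using st by (metis comp_apply id_apply)
      moreover have "tab_row p (\<sigma> (\<tau> k)) = tab_row p (\<tau> k)" "tab_col p (\<tau> k) = tab_col p k"
        using \<sigma> \<tau> k \<tau>k unfolding row_stabilizer_def col_stabilizer_def by blast+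
      ultimately have "tab_row p (\<tau> k) = tab_row p k" "tab_col p (\<tau> k) = tab_col p k" by simp_all
      then show ?thesis using inj_on_tab[of p] k \<tau>k by (auto dest: inj_onD)
    qed
    then have "\<tau> = id" using permutes_not_in[OF col.permutes[OF \<tau>]] by fastforce
    then show "\<sigma> = id \<and> \<tau> = id" using st by simp
  qed simp
  have "lookup (young_symmetrizer p :: 'f galg) id
    = (\<Sum>\<sigma>\<in>row_stabilizer p. \<Sum>\<tau>\<in>col_stabilizer p. if \<sigma> \<circ> \<tau> = id then of_int (sign \<tau>) else 0)"
    by (simp add: young_symmetrizer_def lookup_sum lookup_single when_def)
  also have "\<dots> = (\<Sum>\<sigma>\<in>row_stabilizer p. \<Sum>\<tau>\<in>col_stabilizer p. if \<tau> = id then (if \<sigma> = id then 1 else 0) else 0)"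
    by (intro sum.cong refl) (auto simp: eq)
  also have "\<dots> = 1"
    by (simp add: row.finite_H col.finite_H row.id_H col.id_H)
  finally show ?thesis .
qed

text \<open>The scalar by which the square of the Young symmetrizer differs from it, classically the product of
  the hook lengths. It can be read off at the identity, where the symmetrizer has the coefficient 1.\<close>

definition hook_product :: "nat list \<Rightarrow> 'f::field_char_0" where
  "hook_product p = lookup (young_symmetrizer p \<star> young_symmetrizer p) id"

lemma young_square:
  assumes p: "p \<in> partitions n"
  shows "young_symmetrizer p \<star> young_symmetrizer p = fscale (hook_product p) (young_symmetrizer p)"
proof -
  have n: "sum_list p = n" using p by (auto simp: partitions_def)
  have "col_sum p \<star> row_sum p \<in> group_algebra n"
    using group_algebra_mult col.signed_sum_in_group_algebra row.signed_sum_in_group_algebra n by blast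
  from row_col_sandwich[OF p this]
  obtain t where t: "young_symmetrizer p \<star> young_symmetrizer p = fscale t (young_symmetrizer p :: 'a galg)"
    by (auto simp: young_symmetrizer_eq galg_mult_assoc)
  then have "hook_product p = t" by (simp add: hook_product_def young_coeff_id)
  with t show ?thesis by simp
qed

text \<open>Let \<open>a\<close> and \<open>b\<close> be the row and the column sum. If \<open>a b a b = 0\<close>, then \<open>h = b a b\<close>
  is self-adjoint with square zero, hence zero by positivity. But \<open>h\<close> is up to a positive factor the product
  of the adjoint \<open>b a\<close> of \<open>a b\<close> with \<open>a b\<close>, so \<open>a b = 0\<close>, again by positivity.\<close>

lemma hook_product_nonzero:
  assumes p: "p \<in> partitions n"
  shows "hook_product p \<noteq> (0 :: 'f::field_char_0)"
proof
  assume 0: "hook_product p = (0 :: 'f)"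
  let ?a = "row_sum p :: 'f galg" and ?b = "col_sum p :: 'f galg"
  let ?n = "sum_list p"
  have a: "?a \<in> group_algebra ?n" "integer_coeffs ?a" and b: "?b \<in> group_algebra ?n" "integer_coeffs ?b"
    using row.signed_sum_in_group_algebra row.integer_coeffs_signed_sum
      col.signed_sum_in_group_algebra col.integer_coeffs_signed_sum by blast+
  have adj: "adjoint (?b \<star> ?a) = ?a \<star> ?b" "adjoint (?a \<star> ?b) = ?b \<star> ?a"
    using adjoint_mult[OF b(1) a(1)] adjoint_mult[OF a(1) b(1)]
    by (simp_all add: row.adjoint_signed_sum col.adjoint_signed_sum)
  have abab: "?a \<star> ?b \<star> (?a \<star> ?b) = 0"
    by (simp add: young_square[OF p, unfolded young_symmetrizer_eq] 0)
  let ?h = "?b \<star> (?a \<star> ?b)"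
  have h: "?h \<in> group_algebra ?n" "integer_coeffs ?h"
    using a b by (auto intro: group_algebra_mult integer_coeffs_mult)
  have "adjoint ?h = ?h"
    using adjoint_mult[OF b(1) group_algebra_mult[OF a(1) b(1)]] adj(2)
    by (simp add: galg_mult_assoc col.adjoint_signed_sum)
  then have "adjoint ?h \<star> ?h = ?b \<star> ?a \<star> (?b \<star> ?b) \<star> (?a \<star> ?b)"
    by (simp only: galg_mult_assoc)
  also have "\<dots> = fscale (of_nat (card (col_stabilizer p))) (?b \<star> (?a \<star> ?b \<star> (?a \<star> ?b)))"
    by (simp only: col.signed_sum_square galg_mult_scale_left galg_mult_scale_right galg_mult_assoc)
  also have "\<dots> = 0" by (simp add: abab galg_mult_0_right)
  finally have "?h = 0" using adjoint_mult_eq_0_imp[OF h] by simp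
  have "adjoint (?a \<star> ?b) \<star> (?a \<star> ?b) = ?b \<star> (?a \<star> ?a) \<star> ?b"
    unfolding adj(2) by (simp only: galg_mult_assoc)
  also have "\<dots> = fscale (of_nat (card (row_stabilizer p))) ?h"
    by (simp only: row.signed_sum_square galg_mult_scale_left galg_mult_scale_right galg_mult_assoc)
  also have "\<dots> = 0" using \<open>?h = 0\<close> by simp
  finally have "?a \<star> ?b = 0"
    using adjoint_mult_eq_0_imp[OF group_algebra_mult[OF a(1) b(1)] integer_coeffs_mult[OF a(2) b(2)]]
    by simp
  then show False using young_coeff_id[of p, where 'f = 'f] by (simp add: young_symmetrizer_eq)
qed

lemma subspace_specht: "pm.subspace (specht_module p)"
  unfolding specht_module_def
  by (rule module_hom.subspace_image[OF linear_galg_mult_left subspace_group_algebra])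

lemma specht_mult_left:
  "a \<in> group_algebra (sum_list p) \<Longrightarrow> v \<in> specht_module p \<Longrightarrow> a \<star> v \<in> specht_module p"
  unfolding specht_module_def
  by (auto simp: galg_mult_assoc[symmetric] intro!: imageI group_algebra_mult)

lemma young_in_specht: "young_symmetrizer p \<in> specht_module p"
  unfolding specht_module_def
  by (rule image_eqI[of _ _ "single id 1"])
    (simp_all only: galg_mult_1_left group_algebra_single[OF permutes_id])

lemma specht_mult_young:
  assumes "p \<in> partitions n" "v \<in> specht_module p"
  shows "v \<star> young_symmetrizer p = fscale (hook_product p) v"
  using assms by (auto simp: specht_module_def galg_mult_assoc young_square galg_mult_scale_right)

lemma specht_in_group_algebra: "v \<in> specht_module p \<Longrightarrow> v \<in> group_algebra (sum_list p)"
  unfolding specht_module_def using group_algebra_mult young_in_group_algebra by blast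

lemma irr_char_frame:
  assumes \<sigma>: "\<sigma> permutes {1..sum_list p}"
    and X: "finite X" "\<And>x. x \<in> X \<Longrightarrow> e x \<in> specht_module p"
    and d: "\<And>x. x \<in> X \<Longrightarrow> linear_functional (d x)"
    and frame: "\<And>v. v \<in> specht_module p \<Longrightarrow> v = (\<Sum>x\<in>X. fscale (d x v) (e x))"
  shows "irr_char p \<sigma> = (\<Sum>x\<in>X. d x (single \<sigma> 1 \<star> e x))"
  unfolding irr_char_def
proof (rule quotient_trace_frame[OF subspace_specht pm.subspace_single_0])
  show "{0} \<subseteq> specht_module p" using pm.subspace_0[OF subspace_specht] by simp
  show "(\<star>) (single \<sigma> 1) ` specht_module p \<subseteq> specht_module p"
    using specht_mult_left[OF group_algebra_single[OF \<sigma>]] by blast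
  show "d x u = 0" if "x \<in> X" "u \<in> {0}" for x u
    using that module_hom.zero[OF d[OF that(1)]] by simp
  show "v - (\<Sum>x\<in>X. fscale (d x v) (e x)) \<in> {0}" if "v \<in> specht_module p" for v
    using frame[OF that] by simp
qed (use X d in \<open>auto simp: linear_galg_mult_right galg_mult_0_right\<close>)

text \<open>Right multiplication by the symmetrizer is the scalar \<open>hook_product p\<close> on the Specht module. Hence
  the translates of the normalized symmetrizer form a frame whose functionals are the coefficients.\<close>

lemma irr_char_eq:
  fixes p :: "nat list"
  assumes p: "p \<in> partitions n" and \<sigma>: "\<sigma> permutes {1..n}"
  shows "irr_char p \<sigma> = (\<Sum>\<rho>\<in>perms n. lookup (single \<sigma> 1 \<star> single \<rho> 1 \<star> young_symmetrizer p) \<rho>)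
    / (hook_product p :: 'f::field_char_0)"
proof -
  have n: "sum_list p = n" using p by (auto simp: partitions_def)
  let ?e = "\<lambda>\<rho>. fscale (1 / hook_product p) (single \<rho> 1 \<star> young_symmetrizer p) :: 'f galg"
  have "irr_char p \<sigma> = (\<Sum>\<rho>\<in>perms n. lookup (single \<sigma> 1 \<star> ?e \<rho>) \<rho>)"
  proof (rule irr_char_frame)
    show "?e \<rho> \<in> specht_module p" if "\<rho> \<in> perms n" for \<rho>
      using that n group_algebra_single[of \<rho> n]
      by (intro pm.subspace_scale[OF subspace_specht] specht_mult_left young_in_specht) simp
    show "v = (\<Sum>\<rho>\<in>perms n. fscale (lookup v \<rho>) (?e \<rho>))" if v: "v \<in> specht_module p" for v
    proof -
      have "fscale (hook_product p) v = (\<Sum>\<rho>\<in>perms n. single \<rho> (lookup v \<rho>)) \<star> young_symmetrizer p"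
        by (simp only: group_algebra_sum_single[OF specht_in_group_algebra[OF v, unfolded n]]
            specht_mult_young[OF p v])
      also have "\<dots> = (\<Sum>\<rho>\<in>perms n. fscale (lookup v \<rho>) (single \<rho> 1 \<star> young_symmetrizer p))"
        by (simp add: galg_mult_sum_left flip: galg_mult_scale_left)
      finally have "fscale (1 / hook_product p) (fscale (hook_product p) v)
        = fscale (1 / hook_product p) (\<Sum>\<rho>\<in>perms n. fscale (lookup v \<rho>) (single \<rho> 1 \<star> young_symmetrizer p))"
        by (rule arg_cong)
      then show ?thesis
        using hook_product_nonzero[OF p, where 'f = 'f] by (simp add: pm.scale_sum_right mult.commute)
    qed
  qed (use \<sigma> n in \<open>auto intro: linear_functional_lookup\<close>)
  then show ?thesis by (simp add: galg_mult_scale_right sum_divide_distrib galg_mult_assoc del: galg_mult_single)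
qed

lemma sum_coeff_irr_char:
  fixes a :: "(nat \<Rightarrow> nat) \<Rightarrow>\<^sub>0 'f::field_char_0"
  assumes p: "p \<in> partitions n" and a: "a \<in> group_algebra n"
  shows "(\<Sum>\<sigma>\<in>perms n. lookup a \<sigma> * irr_char p \<sigma>)
    = (\<Sum>\<rho>\<in>perms n. lookup (a \<star> single \<rho> 1 \<star> young_symmetrizer p) \<rho>) / hook_product p"
proof -
  have "lookup (a \<star> single \<rho> 1 \<star> young_symmetrizer p) \<rho>
    = (\<Sum>\<sigma>\<in>perms n. lookup a \<sigma> * lookup (single \<sigma> 1 \<star> single \<rho> 1 \<star> young_symmetrizer p) \<rho>)" for \<rho>
  proof -
    have "single id 1 \<star> a \<star> (single \<rho> 1 \<star> young_symmetrizer p)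
      = (\<Sum>\<sigma>\<in>perms n. fscale (lookup a \<sigma>) (single id 1 \<star> single \<sigma> 1 \<star> (single \<rho> 1 \<star> young_symmetrizer p)))"
      by (rule sandwich_expand[OF a])
    then show ?thesis
      by (simp only: galg_mult_1_left galg_mult_assoc[symmetric]) (simp only: lookup_sum lookup_fscale)
  qed
  then have "(\<Sum>\<rho>\<in>perms n. lookup (a \<star> single \<rho> 1 \<star> young_symmetrizer p) \<rho>)
    = (\<Sum>\<sigma>\<in>perms n. \<Sum>\<rho>\<in>perms n. lookup a \<sigma> * lookup (single \<sigma> 1 \<star> single \<rho> 1 \<star> young_symmetrizer p) \<rho>)"
    by (subst sum.swap) (simp only:)
  moreover have "(\<Sum>\<sigma>\<in>perms n. lookup a \<sigma> * irr_char p \<sigma>) = (\<Sum>\<sigma>\<in>perms n. \<Sum>\<rho>\<in>perms n.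
      lookup a \<sigma> * lookup (single \<sigma> 1 \<star> single \<rho> 1 \<star> young_symmetrizer p) \<rho>) / hook_product p"
    unfolding sum_divide_distrib[of _ "perms n"]
    by (intro sum.cong refl) (simp add: irr_char_eq[OF p] sum_distrib_left sum_divide_distrib
        del: galg_mult_single)
  ultimately show ?thesis by simp
qed

lemma young_irr_char_not_dominated:
  assumes p: "p \<in> partitions n" and q: "q \<in> partitions n" and "\<not> dominated p q"
  shows "(\<Sum>\<sigma>\<in>perms n. lookup (young_symmetrizer p) \<sigma> * irr_char q \<sigma>) = (0 :: 'f::field_char_0)"
proof -
  have n: "sum_list p = n" "sum_list q = n" using p q by (auto simp: partitions_def)
  have "young_symmetrizer p \<star> single \<rho> 1 \<star> young_symmetrizer q = (0 :: 'f galg)"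
    if \<rho>: "\<rho> \<in> perms n" for \<rho>
  proof -
    have "col_sum p \<star> single \<rho> 1 \<star> row_sum q \<in> (group_algebra n :: ('f galg) set)"
      using \<rho> n col.signed_sum_in_group_algebra[of p] row.signed_sum_in_group_algebra[of q]
      by (intro group_algebra_mult group_algebra_single) auto
    from row_col_sandwich_0[OF assms this] show ?thesis
      by (simp only: young_symmetrizer_eq galg_mult_assoc)
  qed
  then have "(\<Sum>\<rho>\<in>perms n. lookup (young_symmetrizer p \<star> single \<rho> 1 \<star> young_symmetrizer q) \<rho>) = (0 :: 'f)"
    by (intro sum.neutral) simp
  then show ?thesis
    unfolding sum_coeff_irr_char[OF q young_in_group_algebra[of p, unfolded n]] by simp
qed

text \<open>The Young symmetrizer maps its Specht module into the line that it spans, and it acts on this line as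
  the scalar \<open>hook_product p\<close>, so this scalar is its trace.\<close>

lemma young_irr_char_same:
  assumes p: "p \<in> partitions n"
  shows "(\<Sum>\<sigma>\<in>perms n. lookup (young_symmetrizer p) \<sigma> * irr_char p \<sigma>) = (hook_product p :: 'f::field_char_0)"
proof -
  have n: "sum_list p = n" using p by (auto simp: partitions_def)
  let ?y = "young_symmetrizer p :: 'f galg"
  have y: "?y \<in> group_algebra n" using young_in_group_algebra[of p] n by simp
  have "\<exists>t. ?y \<star> single \<rho> 1 \<star> ?y = fscale t ?y" if \<rho>: "\<rho> \<in> perms n" for \<rho>
  proof -
    have "col_sum p \<star> single \<rho> 1 \<star> row_sum p \<in> (group_algebra n :: ('f galg) set)"
      using \<rho> n col.signed_sum_in_group_algebra[of p] row.signed_sum_in_group_algebra[of p]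
      by (intro group_algebra_mult group_algebra_single) auto
    from row_col_sandwich[OF p this] show ?thesis
      by (simp only: young_symmetrizer_eq galg_mult_assoc)
  qed
  then obtain t where t: "?y \<star> single \<rho> 1 \<star> ?y = fscale (t \<rho>) ?y" if "\<rho> \<in> perms n" for \<rho>
    by metis
  have "?y \<star> ?y \<star> ?y = (\<Sum>\<rho>\<in>perms n. fscale (lookup ?y \<rho>) (fscale (t \<rho>) ?y))"
    unfolding sandwich_expand[OF y] using t by (intro sum.cong refl) simp
  then have "lookup (?y \<star> ?y \<star> ?y) id = (\<Sum>\<rho>\<in>perms n. lookup ?y \<rho> * t \<rho>)"
    by (simp add: lookup_sum young_coeff_id)
  moreover have "?y \<star> ?y \<star> ?y = fscale (hook_product p * hook_product p) ?y"
    by (simp add: young_square[OF p] galg_mult_scale_left)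
  ultimately have "(\<Sum>\<rho>\<in>perms n. t \<rho> * lookup ?y \<rho>) = hook_product p * hook_product p"
    by (simp add: young_coeff_id mult.commute)
  moreover have "(\<Sum>\<rho>\<in>perms n. lookup (?y \<star> single \<rho> 1 \<star> ?y) \<rho>) = (\<Sum>\<rho>\<in>perms n. t \<rho> * lookup ?y \<rho>)"
    using t by (intro sum.cong refl) simp
  ultimately show ?thesis
    unfolding sum_coeff_irr_char[OF p y] using hook_product_nonzero[OF p, where 'f = 'f] by simp
qed

subsection \<open>Linear independence of the irreducible characters\<close>

lemma length_le_sum_list: "0 \<notin> set p \<Longrightarrow> length p \<le> sum_list (p :: nat list)"
  by (induction p) auto

lemma finite_partitions [simp]: "finite (partitions n)"
proof (rule finite_subset)
  show "partitions n \<subseteq> {p. set p \<subseteq> {..n} \<and> length p \<le> n}"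
    using length_le_sum_list member_le_sum_list by (fastforce simp: partitions_def)
qed (simp add: finite_lists_length_le)

lemma eq_if_partial_sums_eq:
  "0 \<notin> set p \<Longrightarrow> 0 \<notin> set q \<Longrightarrow> (\<And>i. sum_list (take i p) = sum_list (take i (q :: nat list))) \<Longrightarrow> p = q"
proof (induction p arbitrary: q)
  case Nil
  show ?case using Nil(2) Nil(3)[of 1] by (cases q) auto
next
  case (Cons a p)
  from Cons.prems(1) Cons.prems(3)[of 1] obtain q' where q: "q = a # q'" by (cases q) auto
  have "sum_list (take i p) = sum_list (take i q')" for i
    using Cons.prems(3)[of "Suc i"] q by simp
  then have "p = q'" using Cons.prems q by (intro Cons.IH) auto
  then show ?case by (simp add: q)
qed

text \<open>A numerical function that is strictly increasing for the dominance order. It allows a maximal shape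
  to be chosen as a maximum of numbers.\<close>

definition weight :: "nat list \<Rightarrow> nat" where
  "weight p = (\<Sum>i\<le>sum_list p. sum_list (take i p))"

lemma dominated_weight:
  assumes p: "p \<in> partitions n" and q: "q \<in> partitions n" and d: "dominated p q"
    and le: "weight q \<le> weight p"
  shows "p = q"
proof -
  have n: "sum_list p = n" "sum_list q = n" "0 \<notin> set p" "0 \<notin> set q"
    using p q by (auto simp: partitions_def)
  have "weight p \<le> weight q"
    unfolding weight_def n using d by (intro sum_mono) (auto simp: dominated_def)
  with le have eq: "(\<Sum>i\<le>n. sum_list (take i p)) = (\<Sum>i\<le>n. sum_list (take i q))"
    by (simp add: weight_def n)
  have "sum_list (take i p) = sum_list (take i q)" for i
  proof (cases "i \<le> n")
    case True
    then show ?thesis using d by (intro sum_mono_inv[OF eq]) (auto simp: dominated_def)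
  next
    case False
    then show ?thesis using length_le_sum_list[of p] length_le_sum_list[of q] n by simp
  qed
  then show ?thesis using n by (intro eq_if_partial_sums_eq) auto
qed

text \<open>Among the shapes with a nonzero coefficient one of maximal weight is dominated by no other one. Hence
  its Young symmetrizer has trace zero on all other Specht modules that are involved.\<close>

theorem irr_char_independent:
  fixes d :: "nat list \<Rightarrow> 'f::field_char_0"
  assumes 0: "\<And>\<sigma>. \<sigma> permutes {1..n} \<Longrightarrow> (\<Sum>q\<in>partitions n. d q * irr_char q \<sigma>) = 0"
    and "p0 \<in> partitions n"
  shows "d p0 = 0"
proof (rule ccontr)
  assume "d p0 \<noteq> 0"
  define S where "S = {q \<in> partitions n. d q \<noteq> 0}"
  have "finite S" "S \<noteq> {}" using assms(2) \<open>d p0 \<noteq> 0\<close> by (auto simp: S_def)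
  then have "Max (weight ` S) \<in> weight ` S" by (intro Max_in) auto
  then obtain p where "p \<in> S" and "weight p = Max (weight ` S)" by auto
  then have max: "weight q \<le> weight p" if "q \<in> S" for q
    using Max_ge[of "weight ` S" "weight q"] that \<open>finite S\<close> by simp
  have p: "p \<in> partitions n" "d p \<noteq> 0" using \<open>p \<in> S\<close> by (auto simp: S_def)
  have "(\<Sum>q\<in>partitions n. d q * (\<Sum>\<sigma>\<in>perms n. lookup (young_symmetrizer p) \<sigma> * irr_char q \<sigma>))
    = (\<Sum>\<sigma>\<in>perms n. lookup (young_symmetrizer p) \<sigma> * (\<Sum>q\<in>partitions n. d q * irr_char q \<sigma>))"
    unfolding sum_distrib_left by (subst sum.swap) (simp add: mult.left_commute)
  also have "\<dots> = 0" using 0 by simp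
  finally have "(\<Sum>q\<in>partitions n. d q * (\<Sum>\<sigma>\<in>perms n. lookup (young_symmetrizer p) \<sigma> * irr_char q \<sigma>)) = 0" .
  moreover have "d q * (\<Sum>\<sigma>\<in>perms n. lookup (young_symmetrizer p) \<sigma> * irr_char q \<sigma>)
    = (if q = p then d p * hook_product p else 0)" if q: "q \<in> partitions n" for q
  proof (cases "q = p \<or> d q = 0")
    case True
    then show ?thesis using young_irr_char_same[OF p(1)] by auto
  next
    case False
    then have "\<not> dominated p q" using dominated_weight[OF p(1) q] max[of q] q by (auto simp: S_def)
    then show ?thesis using young_irr_char_not_dominated[OF p(1) q] False by simp
  qed
  ultimately have "d p * hook_product p = 0" using p(1) by simp
  then show False using p hook_product_nonzero[OF p(1), where 'f = 'f] by simp
qed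

section \<open>Raising and lowering operators on functions of subsets\<close>

definition lower :: "nat \<Rightarrow> (nat set \<Rightarrow> 'f::field_char_0) \<Rightarrow> nat set \<Rightarrow> 'f" where
  "lower n f S = (\<Sum>x\<in>{1..n} - S. f (insert x S))"

definition raise :: "(nat set \<Rightarrow> 'f::field_char_0) \<Rightarrow> nat set \<Rightarrow> 'f" where
  "raise f T = (\<Sum>x\<in>T. f (T - {x}))"

text \<open>The commutator of the two operators acts on functions of \<open>i\<close>-subsets as the scalar \<open>n - 2 i\<close>.
  So they generate an action of \<open>sl\<^sub>2\<close>.\<close>

lemma lower_raise:
  assumes S: "S \<subseteq> {1..n}"
  shows "lower n (raise f) S = raise (lower n f) S + (of_nat n - 2 * of_nat (card S)) * f S"
proof -
  let ?N = "{1..n}"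
  have fin: "finite S" using S by (rule finite_subset) simp
  let ?c = "\<Sum>x\<in>?N - S. \<Sum>y\<in>S. f (insert x (S - {y}))"
  have "lower n (raise f) S = (\<Sum>x\<in>?N - S. f S + (\<Sum>y\<in>S. f (insert x (S - {y}))))"
    unfolding lower_def
  proof (rule sum.cong[OF refl])
    fix x assume x: "x \<in> ?N - S"
    then have "raise f (insert x S) = f (insert x S - {x}) + (\<Sum>y\<in>S. f (insert x S - {y}))"
      using fin by (simp add: raise_def)
    also have "insert x S - {x} = S" using x by auto
    also have "(\<Sum>y\<in>S. f (insert x S - {y})) = (\<Sum>y\<in>S. f (insert x (S - {y})))"
      using x by (intro sum.cong refl arg_cong[where f = f]) auto
    finally show "raise f (insert x S) = f S + (\<Sum>y\<in>S. f (insert x (S - {y})))" .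
  qed
  also have "\<dots> = of_nat (card (?N - S)) * f S + ?c" by (simp add: sum.distrib)
  also have "card (?N - S) = n - card S" using S fin by (simp add: card_Diff_subset)
  finally have 1: "lower n (raise f) S = (of_nat n - of_nat (card S)) * f S + ?c"
    using card_mono[OF _ S] by (simp add: of_nat_diff)
  have "raise (lower n f) S = (\<Sum>y\<in>S. f S + (\<Sum>x\<in>?N - S. f (insert x (S - {y}))))"
    unfolding raise_def
  proof (rule sum.cong[OF refl])
    fix y assume y: "y \<in> S"
    then have "?N - (S - {y}) = insert y (?N - S)" using S by auto
    then have "lower n f (S - {y}) = f (insert y (S - {y})) + (\<Sum>x\<in>?N - S. f (insert x (S - {y})))"
      using y by (simp add: lower_def)
    then show "lower n f (S - {y}) = f S + (\<Sum>x\<in>?N - S. f (insert x (S - {y})))"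
      using y by (simp add: insert_absorb)
  qed
  also have "\<dots> = of_nat (card S) * f S + ?c" by (simp add: sum.distrib) (rule sum.swap)
  finally show ?thesis using 1 by (simp add: algebra_simps)
qed

lemma lower_raise_power:
  assumes "S \<subseteq> {1..n}"
  shows "lower n ((raise ^^ Suc k) f) S = (raise ^^ Suc k) (lower n f) S
    + of_nat (Suc k) * (of_nat n - 2 * of_nat (card S) + of_nat k) * (raise ^^ k) f S"
  using assms
proof (induction k arbitrary: S)
  case 0
  then show ?case by (simp add: lower_raise)
next
  case (Suc k)
  let ?m = "\<lambda>S. of_nat n - 2 * of_nat (card S) :: 'a"
  have fin: "finite S" using Suc.prems by (rule finite_subset) simp
  have "raise (lower n ((raise ^^ Suc k) f)) S = (\<Sum>y\<in>S. (raise ^^ Suc k) (lower n f) (S - {y})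
      + of_nat (Suc k) * (?m S + 2 + of_nat k) * (raise ^^ k) f (S - {y}))"
    unfolding raise_def[of "lower n _"]
  proof (rule sum.cong[OF refl])
    fix y assume y: "y \<in> S"
    have "of_nat (card (S - {y})) = (of_nat (card S) - 1 :: 'a)"
      using y fin by (metis card_Suc_Diff1 add_diff_cancel_left' of_nat_Suc)
    then have "?m (S - {y}) = ?m S + 2" by (simp only:) (simp add: algebra_simps)
    moreover have "S - {y} \<subseteq> {1..n}" using Suc.prems by blast
    ultimately show "lower n ((raise ^^ Suc k) f) (S - {y}) = (raise ^^ Suc k) (lower n f) (S - {y})
      + of_nat (Suc k) * (?m S + 2 + of_nat k) * (raise ^^ k) f (S - {y})"
      using Suc.IH[of "S - {y}"] by (simp only:)
  qed
  also have "\<dots> = raise ((raise ^^ Suc k) (lower n f)) S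
      + of_nat (Suc k) * (?m S + 2 + of_nat k) * raise ((raise ^^ k) f) S"
    by (simp only: sum.distrib sum_distrib_left raise_def[of "(raise ^^ Suc k) (lower n f)"]
        raise_def[of "(raise ^^ k) f"])
  finally have *: "raise (lower n ((raise ^^ Suc k) f)) S = raise ((raise ^^ Suc k) (lower n f)) S
      + of_nat (Suc k) * (?m S + 2 + of_nat k) * (raise ^^ Suc k) f S" by simp
  have "lower n (raise ((raise ^^ Suc k) f)) S
    = raise (lower n ((raise ^^ Suc k) f)) S + ?m S * (raise ^^ Suc k) f S"
    by (rule lower_raise[OF Suc.prems])
  also have "\<dots> = raise ((raise ^^ Suc k) (lower n f)) S
      + (of_nat (Suc k) * (?m S + 2 + of_nat k) + ?m S) * (raise ^^ Suc k) f S"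
    unfolding * by (simp only: distrib_right add.assoc)
  also have "of_nat (Suc k) * (?m S + 2 + of_nat k) + ?m S
    = of_nat (Suc (Suc k)) * (?m S + of_nat (Suc k))"
    by (simp add: algebra_simps)
  finally show ?case by simp
qed

lemma raise_power_eq_0: "finite S \<Longrightarrow> card S < k \<Longrightarrow> (raise ^^ k) f S = 0"
proof (induction k arbitrary: S)
  case (Suc k)
  have "(raise ^^ k) f (S - {x}) = 0" if "x \<in> S" for x
  proof (rule Suc.IH)
    show "finite (S - {x})" using Suc.prems(1) by simp
    show "card (S - {x}) < k" using card_Diff1_less[OF Suc.prems(1) that] Suc.prems(2) by linarith
  qed
  then show ?case by (simp add: raise_def[of "(raise ^^ k) f"])
qed simp

lemma lower_add: "lower n (\<lambda>T. f T + g T) S = lower n f S + lower n g S"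
  by (simp add: lower_def sum.distrib)

lemma lower_scale: "lower n (\<lambda>T. c * f T) S = c * lower n f S"
  by (simp add: lower_def sum_distrib_left)

lemma lower_sum: "lower n (\<lambda>T. \<Sum>a\<in>A. f a T) S = (\<Sum>a\<in>A. lower n (f a) S)"
  unfolding lower_def by (rule sum.swap)

text \<open>A preimage is a combination of the functions obtained from \<open>g\<close> by lowering \<open>k\<close> times and raising
  \<open>k + 1\<close> times. Each of them removes the error left by the previous ones and causes an error with one more
  lowering and raising. After more than \<open>i\<close> steps the error vanishes, because a set of size \<open>i\<close> does
  not have so many elements to be removed.\<close>

lemma lower_surj:
  fixes g :: "nat set \<Rightarrow> 'f::field_char_0"
  assumes i: "2 * i < n"
  shows "\<exists>f. \<forall>S. S \<subseteq> {1..n} \<longrightarrow> card S = i \<longrightarrow> lower n f S = g S"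
proof -
  have "\<exists>f c. \<forall>S. S \<subseteq> {1..n} \<longrightarrow> card S = i \<longrightarrow>
      lower n f S = g S + c * (raise ^^ k) ((lower n ^^ k) g) S" for k
  proof (induction k)
    case 0
    show ?case by (intro exI[of _ "\<lambda>_. 0"] exI[of _ "-1"]) (simp add: lower_def)
  next
    case (Suc k)
    then obtain f c where f: "\<And>S. S \<subseteq> {1..n} \<Longrightarrow> card S = i \<Longrightarrow>
      lower n f S = g S + c * (raise ^^ k) ((lower n ^^ k) g) S" by blast
    \<comment> \<open>the factor from \<open>lower_raise_power\<close> is invertible because \<open>2 i < n\<close>\<close>
    define m :: 'f where "m = of_nat (Suc k) * (of_nat n - 2 * of_nat i + of_nat k)"
    have "m = of_nat (Suc k * (n - 2 * i + k))"
      unfolding m_def of_nat_mult of_nat_add using i by (simp add: of_nat_diff)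
    then have m: "m \<noteq> 0" using i by (simp del: of_nat_mult of_nat_add of_nat_Suc mult_Suc)
    let ?f = "\<lambda>T. f T + (- c / m) * (raise ^^ Suc k) ((lower n ^^ k) g) T"
    have "lower n ?f S = g S + (- c / m) * (raise ^^ Suc k) ((lower n ^^ Suc k) g) S"
      if S: "S \<subseteq> {1..n}" "card S = i" for S
    proof -
      have "lower n ?f S = lower n f S + (- c / m) * lower n ((raise ^^ Suc k) ((lower n ^^ k) g)) S"
        by (simp only: lower_add lower_scale)
      also have "\<dots> = g S + (- c / m) * (raise ^^ Suc k) ((lower n ^^ Suc k) g) S"
        unfolding lower_raise_power[OF S(1)] f[OF S] S(2) m_def[symmetric]
        using m by (simp add: algebra_simps)
      finally show ?thesis .
    qed
    then show ?case by blast
  qed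
  from this[of "Suc i"] obtain f c where f: "\<And>S. S \<subseteq> {1..n} \<Longrightarrow> card S = i \<Longrightarrow>
      lower n f S = g S + c * (raise ^^ Suc i) ((lower n ^^ Suc i) g) S" by blast
  have "lower n f S = g S" if "S \<subseteq> {1..n}" "card S = i" for S
    using f[OF that] raise_power_eq_0[of S "Suc i" "(lower n ^^ Suc i) g"] that finite_subset[OF that(1)]
    by (simp del: funpow.simps)
  then show ?thesis by blast
qed

section \<open>Irreducible characters of two-row shapes\<close>

definition two_row_shape :: "nat \<Rightarrow> nat \<Rightarrow> nat list" where
  "two_row_shape n j = (if j = 0 then one_row n else [n - j, j])"

text \<open>The permutations that preserve the set of entries of the second row are the row permutations of the
  two-row shape. Therefore the cosets of the row group correspond to the \<open>j\<close>-subsets of \<open>{1..n}\<close>, and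
  functions of these subsets to the left ideal generated by the row sum.\<close>

locale two_row =
  fixes n j :: nat
  assumes le: "2 * j \<le> n"
begin

abbreviation "p \<equiv> two_row_shape n j"

lemma p_partition: "p \<in> partitions n"
  using le by (auto simp: two_row_shape_def one_row_def partitions_def)

lemma p_sum: "sum_list p = n"
  using p_partition by (auto simp: partitions_def)

definition second_row :: "nat set" where
  "second_row = {n - j + 1..n}"

lemma second_row: "second_row \<subseteq> {1..n}" "card second_row = j" "finite second_row"
  using le by (auto simp: second_row_def)

lemma tab_row_p:
  assumes k: "k \<in> {1..n}"
  shows "tab_row p k = (if k \<in> second_row then 1 else 0)"
proof -
  have *: "1 \<le> k" "k \<le> sum_list p" using k p_sum by auto
  have "tab_row p k < 2"
    using tab_row_col(1)[OF *] by (auto simp: two_row_shape_def one_row_def split: if_splits)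
  moreover have "tab_row p k < 1 \<longleftrightarrow> k \<notin> second_row"
    using tab_row_less_iff[OF *, of 1] k le
    by (auto simp: two_row_shape_def one_row_def second_row_def)
  ultimately show ?thesis by auto
qed

lemma image_second_row_iff:
  assumes \<sigma>: "\<sigma> permutes {1..n}"
  shows "\<sigma> ` second_row = second_row \<longleftrightarrow> \<sigma> \<in> row_stabilizer p"
proof
  have inj: "inj \<sigma>" using permutes_inj[OF \<sigma>] .
  assume eq: "\<sigma> ` second_row = second_row"
  have "\<sigma> k \<in> second_row \<longleftrightarrow> k \<in> second_row" for k
    using inj_image_mem_iff[OF inj, of k second_row] eq by simp
  then show "\<sigma> \<in> row_stabilizer p"
    using \<sigma> permutes_in_image[OF \<sigma>] by (simp add: row_stabilizer_def p_sum tab_row_p del: One_nat_def)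
next
  assume r: "\<sigma> \<in> row_stabilizer p"
  have mem: "\<sigma> k \<in> second_row" if k: "k \<in> second_row" for k
  proof -
    have "k \<in> {1..n}" using k second_row(1) by blast
    moreover from this have "\<sigma> k \<in> {1..n}" using permutes_in_image[OF \<sigma>] by blast
    moreover from calculation have "tab_row p (\<sigma> k) = tab_row p k"
      using r unfolding row_stabilizer_def p_sum by blast
    ultimately show ?thesis using k by (simp add: tab_row_p del: One_nat_def split: if_splits)
  qed
  then show "\<sigma> ` second_row = second_row"
    using second_row(3) permutes_inj_on[OF \<sigma>] by (intro endo_inj_surj) auto
qed

lemma column_transposition:
  assumes y: "y \<in> second_row"
  shows "\<exists>k. k \<in> {1..n} - second_row \<and> transpose k y \<in> col_stabilizer p"
proof -
  define k where "k = y - (n - j)"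
  have j: "0 < j" and k: "1 \<le> k" "k \<le> j" "y = n - j + k" using y le by (auto simp: second_row_def k_def)
  then have kN: "k \<in> {1..n}" "k \<notin> second_row" "y \<in> {1..n}" using le by (auto simp: second_row_def)
  have "tab_col p k = k" "tab_col p y = k"
    using tab_row_p[OF kN(1)] tab_row_p[OF kN(3)] kN y j k(3)
    by (auto simp: tab_col_def two_row_shape_def)
  then have "transpose k y \<in> col_stabilizer p"
    using permutes_swap_id[OF kN(1) kN(3)] by (auto simp: col_stabilizer_def p_sum transpose_def)
  then show ?thesis using kN by blast
qed

definition subsets :: "nat set set" where
  "subsets = {T. T \<subseteq> {1..n} \<and> card T = j}"

text \<open>The subsets with \<open>j - 1\<close> elements; there are none if \<open>j = 0\<close>.\<close>

definition facets :: "nat set set" where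
  "facets = {S. S \<subseteq> {1..n} \<and> Suc (card S) = j}"

lemma finite_subsets: "finite subsets" "finite facets"
  unfolding subsets_def facets_def by (rule finite_subset[of _ "Pow {1..n}"], auto)+

lemma second_row_in_subsets: "second_row \<in> subsets"
  using second_row by (simp add: subsets_def)

lemma insert_facet: "S \<in> facets \<Longrightarrow> x \<in> {1..n} - S \<Longrightarrow> insert x S \<in> subsets"
  using finite_subset[of S "{1..n}"] by (auto simp: facets_def subsets_def)

lemma image_subsets: "\<sigma> permutes {1..n} \<Longrightarrow> T \<in> subsets \<Longrightarrow> \<sigma> ` T \<in> subsets"
  using permutes_image[of \<sigma> "{1..n}"] card_image[OF permutes_inj_on[of \<sigma> "{1..n}" T]]
  by (auto simp: subsets_def)

lemma vimage_eq_image_inv: "\<sigma> permutes {1..n} \<Longrightarrow> \<sigma> -` T = inv \<sigma> ` T"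
  by (metis bij_vimage_eq_inv_image permutes_bij)

lemma vimage_subsets: "\<sigma> permutes {1..n} \<Longrightarrow> T \<in> subsets \<Longrightarrow> \<sigma> -` T \<in> subsets"
  by (simp add: vimage_eq_image_inv image_subsets permutes_inv del: One_nat_def)

lemma vimage_facets: "\<sigma> permutes {1..n} \<Longrightarrow> S \<in> facets \<Longrightarrow> \<sigma> -` S \<in> facets"
  using permutes_image[OF permutes_inv, of \<sigma> "{1..n}"]
    card_image[OF permutes_inj_on[OF permutes_inv, of \<sigma> "{1..n}" S]]
  by (auto simp: facets_def vimage_eq_image_inv)

lemma ex_image_second_row:
  assumes "T \<in> subsets"
  shows "\<exists>\<sigma>. \<sigma> permutes {1..n} \<and> \<sigma> ` second_row = T"
proof -
  have T: "T \<subseteq> {1..n}" "card T = j" "finite T"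
    using assms finite_subset[of T "{1..n}"] by (auto simp: subsets_def)
  obtain e where e: "bij_betw e second_row T"
    using finite_same_card_bij[OF second_row(3) T(3)] second_row(2) T(2) by auto
  have "card ({1..n} - second_row) = card ({1..n} - T)"
    using second_row T by (simp add: card_Diff_subset)
  then obtain e' where e': "bij_betw e' ({1..n} - second_row) ({1..n} - T)"
    using finite_same_card_bij[of "{1..n} - second_row" "{1..n} - T"] by auto
  define \<sigma> where "\<sigma> x = (if x \<in> second_row then e x else if x \<in> {1..n} then e' x else x)" for x
  have "bij_betw \<sigma> second_row T"
    using e by (subst bij_betw_cong[of _ _ e]) (auto simp: \<sigma>_def)
  moreover have "bij_betw \<sigma> ({1..n} - second_row) ({1..n} - T)"
    using e' by (subst bij_betw_cong[of _ _ e']) (auto simp: \<sigma>_def)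
  ultimately have "bij_betw \<sigma> (second_row \<union> ({1..n} - second_row)) (T \<union> ({1..n} - T))"
    by (rule bij_betw_combine) auto
  moreover have "second_row \<union> ({1..n} - second_row) = {1..n}" "T \<union> ({1..n} - T) = {1..n}"
    using second_row(1) T(1) by blast+
  ultimately have "bij_betw \<sigma> {1..n} {1..n}" by simp
  then have "\<sigma> permutes {1..n}"
    using second_row(1) by (rule_tac bij_imp_permutes) (auto simp: \<sigma>_def)
  moreover have "\<sigma> ` second_row = T"
    using \<open>bij_betw \<sigma> second_row T\<close> by (simp add: bij_betw_def)
  ultimately show ?thesis by blast
qed

text \<open>The coefficients of \<open>v\<close> summed over cosets of the row group, with cosets written as subsets.\<close>

definition to_fun :: "('f::field_char_0) galg \<Rightarrow> nat set \<Rightarrow> 'f" where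
  "to_fun v T = (\<Sum>\<sigma> | \<sigma> permutes {1..n} \<and> \<sigma> ` second_row = T. lookup v \<sigma>)"

definition coset_sum :: "(nat set \<Rightarrow> 'f::field_char_0) \<Rightarrow> 'f galg" where
  "coset_sum f = (\<Sum>\<sigma>\<in>perms n. single \<sigma> (f (\<sigma> ` second_row)))"

text \<open>The natural equivariant map from functions of subsets to the Specht module. Composed with
  \<open>to_fun\<close> it is the scalar \<open>hook_product p\<close>, on the Specht module as well as on harmonic functions.\<close>

definition of_fun :: "(nat set \<Rightarrow> 'f::field_char_0) \<Rightarrow> 'f galg" where
  "of_fun f = coset_sum f \<star> col_sum p"

lemma linear_to_fun: "linear_functional (\<lambda>v. to_fun v T)"
  by (rule linear_functionalI) (simp_all add: to_fun_def lookup_add sum.distrib sum_distrib_left)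

lemma to_fun_shift:
  assumes \<tau>: "\<tau> permutes {1..n}"
  shows "to_fun (single \<tau> 1 \<star> v) T = to_fun v (\<tau> -` T)"
  unfolding to_fun_def
proof (rule sum.reindex_bij_witness[of _ "\<lambda>\<sigma>. \<tau> \<circ> \<sigma>" "\<lambda>\<sigma>. inv \<tau> \<circ> \<sigma>"])
  note inv = permutes_inv_o[OF \<tau>]
  fix \<sigma> assume \<sigma>: "\<sigma> \<in> {\<sigma>. \<sigma> permutes {1..n} \<and> \<sigma> ` second_row = T}"
  show "\<tau> \<circ> (inv \<tau> \<circ> \<sigma>) = \<sigma>" using inv by (simp add: o_assoc)
  show "inv \<tau> \<circ> \<sigma> \<in> {\<sigma>. \<sigma> permutes {1..n} \<and> \<sigma> ` second_row = \<tau> -` T}"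
    using \<sigma> permutes_comp[OF permutes_inv[OF \<tau>]]
    by (auto simp: vimage_eq_image_inv[OF \<tau>] image_comp)
  show "lookup v (inv \<tau> \<circ> \<sigma>) = lookup (single \<tau> 1 \<star> v) \<sigma>"
    by (simp add: lookup_galg_mult_single_left[OF \<tau>])
next
  note inv = permutes_inv_o[OF \<tau>]
  fix \<sigma> assume \<sigma>: "\<sigma> \<in> {\<sigma>. \<sigma> permutes {1..n} \<and> \<sigma> ` second_row = \<tau> -` T}"
  show "inv \<tau> \<circ> (\<tau> \<circ> \<sigma>) = \<sigma>" using inv by (simp add: o_assoc)
  have "\<tau> ` (\<tau> -` T) = T" using permutes_surj[OF \<tau>] by (simp add: surj_image_vimage_eq)
  then have "(\<tau> \<circ> \<sigma>) ` second_row = T" using \<sigma> by (simp only: image_comp[symmetric] mem_Collect_eq)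
  then show "\<tau> \<circ> \<sigma> \<in> {\<sigma>. \<sigma> permutes {1..n} \<and> \<sigma> ` second_row = T}"
    using \<sigma> permutes_comp[OF \<tau>] by blast
qed

lemma coset_sum_in_group_algebra: "coset_sum f \<in> group_algebra n"
  unfolding coset_sum_def
  by (intro pm.subspace_sum[OF subspace_group_algebra] group_algebra_single) simp

lemma lookup_coset_sum: "\<sigma> permutes {1..n} \<Longrightarrow> lookup (coset_sum f) \<sigma> = f (\<sigma> ` second_row)"
  by (simp add: coset_sum_def lookup_sum lookup_single when_def)

lemma coset_sum_shift:
  assumes \<tau>: "\<tau> permutes {1..n}"
  shows "single \<tau> 1 \<star> coset_sum f = coset_sum (\<lambda>T. f (\<tau> -` T))"
proof (rule group_algebra_eqI)
  show "single \<tau> 1 \<star> coset_sum f \<in> group_algebra n"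
    by (intro group_algebra_mult group_algebra_single \<tau> coset_sum_in_group_algebra)
  fix \<sigma> assume "\<sigma> permutes {1..n}"
  then show "lookup (single \<tau> 1 \<star> coset_sum f) \<sigma> = lookup (coset_sum (\<lambda>T. f (\<tau> -` T))) \<sigma>"
    using permutes_comp[OF permutes_inv[OF \<tau>], of \<sigma>]
    by (simp only: lookup_galg_mult_single_left[OF \<tau>] lookup_coset_sum vimage_eq_image_inv[OF \<tau>] image_comp)
qed (rule coset_sum_in_group_algebra)

lemma of_fun_shift:
  "\<tau> permutes {1..n} \<Longrightarrow> single \<tau> 1 \<star> of_fun f = of_fun (\<lambda>T. f (\<tau> -` T))"
  unfolding of_fun_def galg_mult_assoc[symmetric] by (simp only: coset_sum_shift)

lemma same_image_iff:
  assumes \<sigma>: "\<sigma> permutes {1..n}" and \<rho>: "\<rho> permutes {1..n}"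
  shows "\<sigma> ` second_row = \<rho> ` second_row \<longleftrightarrow> inv \<rho> \<circ> \<sigma> \<in> row_stabilizer p"
proof -
  have "\<sigma> ` second_row = \<rho> ` second_row \<longleftrightarrow> inv \<rho> ` \<sigma> ` second_row = inv \<rho> ` \<rho> ` second_row"
    using permutes_inj[OF permutes_inv[OF \<rho>]] by (simp add: inj_image_eq_iff)
  also have "inv \<rho> ` \<rho> ` second_row = second_row"
    using permutes_inv_o[OF \<rho>] by (simp add: image_comp)
  finally show ?thesis
    using image_second_row_iff[OF permutes_comp[OF permutes_inv[OF \<rho>] \<sigma>]] by (simp add: image_comp)
qed

lemma row_perm: "h \<in> row_stabilizer p \<Longrightarrow> h permutes {1..n}"
  using row.permutes[of h p] p_sum by simp

lemma row_image: "h \<in> row_stabilizer p \<Longrightarrow> h ` second_row = second_row"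
  using image_second_row_iff row_perm by blast

lemma row_sum_in_group_algebra: "row_sum p \<in> group_algebra n"
  using row.signed_sum_in_group_algebra[of p] unfolding p_sum .

text \<open>Both sides have at a permutation the sum of the coefficients of \<open>v\<close> over its coset.\<close>

lemma coset_sum_to_fun:
  assumes v: "v \<in> group_algebra n"
  shows "coset_sum (to_fun v) = v \<star> row_sum p"
proof (rule group_algebra_eqI[OF coset_sum_in_group_algebra])
  show "v \<star> row_sum p \<in> group_algebra n"
    using v row_sum_in_group_algebra by (rule group_algebra_mult)
  fix \<sigma> assume \<sigma>: "\<sigma> permutes {1..n}"
  have cancel: "\<sigma> \<circ> (inv \<sigma> \<circ> \<rho>) = \<rho>" "inv \<sigma> \<circ> (\<sigma> \<circ> \<rho>) = \<rho>" for \<rho>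
    using permutes_inv_o[OF \<sigma>] by (simp_all add: o_assoc)
  have "to_fun v (\<sigma> ` second_row) = (\<Sum>h\<in>row_stabilizer p. lookup v (\<sigma> \<circ> h))"
    unfolding to_fun_def
  proof (rule sum.reindex_bij_witness[of _ "\<lambda>h. \<sigma> \<circ> h" "\<lambda>\<rho>. inv \<sigma> \<circ> \<rho>"])
    show "inv \<sigma> \<circ> \<rho> \<in> row_stabilizer p"
      if "\<rho> \<in> {\<rho>. \<rho> permutes {1..n} \<and> \<rho> ` second_row = \<sigma> ` second_row}" for \<rho>
      using that same_image_iff[of \<rho> \<sigma>] \<sigma> by blast
    show "\<sigma> \<circ> h \<in> {\<rho>. \<rho> permutes {1..n} \<and> \<rho> ` second_row = \<sigma> ` second_row}"
      if h: "h \<in> row_stabilizer p" for h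
    proof -
      have "(\<sigma> \<circ> h) ` second_row = \<sigma> ` second_row"
        by (simp only: image_comp[symmetric] row_image[OF h])
      then show ?thesis using permutes_comp[OF \<sigma> row_perm[OF h]] by blast
    qed
  qed (simp_all only: cancel)
  then show "lookup (coset_sum (to_fun v)) \<sigma> = lookup (v \<star> row_sum p) \<sigma>"
    by (simp add: lookup_coset_sum[OF \<sigma>] row.lookup_mult_signed_sum)
qed

lemma coset_sum_row_sum:
  "coset_sum f \<star> row_sum p = fscale (of_nat (card (row_stabilizer p))) (coset_sum f)"
proof (rule group_algebra_eqI)
  show "coset_sum f \<star> row_sum p \<in> group_algebra n"
    using coset_sum_in_group_algebra row_sum_in_group_algebra by (rule group_algebra_mult)
  fix \<sigma> assume \<sigma>: "\<sigma> permutes {1..n}"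
  have "lookup (coset_sum f) (\<sigma> \<circ> h) = f (\<sigma> ` second_row)" if h: "h \<in> row_stabilizer p" for h
    unfolding lookup_coset_sum[OF permutes_comp[OF \<sigma> row_perm[OF h]]]
    by (simp only: image_comp[symmetric] row_image[OF h])
  then show "lookup (coset_sum f \<star> row_sum p) \<sigma>
    = lookup (fscale (of_nat (card (row_stabilizer p))) (coset_sum f)) \<sigma>"
    by (simp add: row.lookup_mult_signed_sum lookup_coset_sum[OF \<sigma>])
qed (intro pm.subspace_scale[OF subspace_group_algebra] coset_sum_in_group_algebra)

lemma card_row_stabilizer_nonzero: "of_nat (card (row_stabilizer p)) \<noteq> (0 :: 'f::field_char_0)"
  using row.finite_H[of p] row.id_H[of p] by auto

lemma of_fun_in_specht: "of_fun f \<in> specht_module p"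
proof -
  let ?c = "of_nat (card (row_stabilizer p)) :: 'a"
  have "of_fun f = fscale (1 / ?c) (coset_sum f \<star> row_sum p) \<star> col_sum p"
    using card_row_stabilizer_nonzero[where 'f = 'a] by (simp add: coset_sum_row_sum of_fun_def)
  also have "\<dots> = fscale (1 / ?c) (coset_sum f) \<star> young_symmetrizer p"
    by (simp only: young_symmetrizer_eq galg_mult_scale_left galg_mult_assoc)
  finally show ?thesis
    unfolding specht_module_def using p_sum
    by (auto intro!: imageI pm.subspace_scale[OF subspace_group_algebra] coset_sum_in_group_algebra)
qed

lemma of_fun_to_fun:
  assumes v: "v \<in> specht_module p"
  shows "of_fun (to_fun v) = fscale (hook_product p) v"
proof -
  have "v \<in> group_algebra n" using specht_in_group_algebra[OF v] p_sum by simp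
  then have "of_fun (to_fun v) = v \<star> young_symmetrizer p"
    by (simp add: of_fun_def coset_sum_to_fun young_symmetrizer_eq galg_mult_assoc)
  then show ?thesis using specht_mult_young[OF p_partition v] by simp
qed

definition harmonic :: "(nat set \<Rightarrow> 'f::field_char_0) \<Rightarrow> bool" where
  "harmonic f \<longleftrightarrow> (\<forall>S\<in>facets. lower n f S = 0)"

text \<open>The value of \<open>lower\<close> at \<open>S\<close> sums the coefficients of \<open>v\<close> over the permutations that map the second
  row without one of its entries \<open>y\<close> onto \<open>S\<close>. Exchanging \<open>y\<close> with the entry above it does not
  affect this condition but changes the sign of the coefficients.\<close>

lemma harmonic_to_fun:
  fixes v :: "(nat \<Rightarrow> nat) \<Rightarrow>\<^sub>0 'f::field_char_0"
  assumes v: "v \<in> specht_module p"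
  shows "harmonic (to_fun v)"
  unfolding harmonic_def
proof
  fix S assume S: "S \<in> facets"
  then have SN: "S \<subseteq> {1..n}" and finS: "finite S" and cS: "Suc (card S) = j"
    using finite_subset[of S "{1..n}"] by (auto simp: facets_def)
  let ?G = "\<lambda>y. {\<sigma>. \<sigma> permutes {1..n} \<and> \<sigma> ` (second_row - {y}) = S}"
  have zero: "(\<Sum>\<sigma>\<in>?G y. lookup v \<sigma>) = 0" if y: "y \<in> second_row" for y
  proof -
    obtain k where k: "k \<in> {1..n} - second_row" and t: "transpose k y \<in> col_stabilizer p"
      using column_transposition[OF y] by blast
    let ?t = "transpose k y"
    have perm: "?t permutes {1..n}" using col.permutes[OF t] p_sum by simp
    have "k \<noteq> y" using k y by auto
    obtain a where "v = a \<star> young_symmetrizer p" using v by (auto simp: specht_module_def)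
    then have vt: "v \<star> single ?t 1 = - v"
      using \<open>k \<noteq> y\<close>
      by (simp add: col.signed_sum_absorb_right[OF t] young_symmetrizer_eq galg_mult_assoc sign_swap_id
          galg_mult_uminus_right)
    have lv: "lookup v (\<sigma> \<circ> ?t) = - lookup v \<sigma>" if \<sigma>: "\<sigma> permutes {1..n}" for \<sigma>
    proof -
      have "lookup (v \<star> single ?t 1) (\<sigma> \<circ> ?t) = lookup v \<sigma>"
        using permutes_inv_o(1)[OF perm] by (simp add: lookup_galg_mult_single_right[OF perm] o_assoc[symmetric])
      then have "lookup v \<sigma> = - lookup v (\<sigma> \<circ> ?t)" by (simp add: vt)
      then show ?thesis by simp
    qed
    have fix_t: "?t ` (second_row - {y}) = second_row - {y}"
      using k by (force simp: transpose_def image_iff)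
    have "(\<Sum>\<sigma>\<in>?G y. lookup v \<sigma>) = (\<Sum>\<sigma>\<in>?G y. lookup v (\<sigma> \<circ> ?t))"
    proof (rule sum.reindex_bij_witness[of _ "\<lambda>\<sigma>. \<sigma> \<circ> ?t" "\<lambda>\<sigma>. \<sigma> \<circ> ?t"])
      fix \<sigma> assume \<sigma>: "\<sigma> \<in> ?G y"
      show "\<sigma> \<circ> ?t \<circ> ?t = \<sigma>" by (simp add: o_assoc[symmetric])
      then show "\<sigma> \<circ> ?t \<circ> ?t = \<sigma>" .
      show "\<sigma> \<circ> ?t \<in> ?G y"
        using \<sigma> permutes_comp[OF _ perm] by (simp only: image_comp[symmetric] fix_t mem_Collect_eq)
      then show "\<sigma> \<circ> ?t \<in> ?G y" .
      show "lookup v (\<sigma> \<circ> ?t \<circ> ?t) = lookup v \<sigma>" by (simp add: o_assoc[symmetric])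
    qed
    also have "\<dots> = - (\<Sum>\<sigma>\<in>?G y. lookup v \<sigma>)"
      unfolding sum_negf[symmetric] using lv by (intro sum.cong) auto
    finally show ?thesis by simp
  qed
  have "lower n (to_fun v) S = (\<Sum>(x, \<sigma>)\<in>(SIGMA x:{1..n} - S.
      {\<sigma>. \<sigma> permutes {1..n} \<and> \<sigma> ` second_row = insert x S}). lookup v \<sigma>)"
    unfolding lower_def to_fun_def by (rule sum.Sigma) auto
  also have "\<dots> = (\<Sum>(y, \<sigma>)\<in>(SIGMA y:second_row. ?G y). lookup v \<sigma>)"
  proof (rule sum.reindex_bij_witness[of _ "\<lambda>(y, \<sigma>). (\<sigma> y, \<sigma>)" "\<lambda>(x, \<sigma>). (inv \<sigma> x, \<sigma>)"])
    fix a assume "a \<in> (SIGMA x:{1..n} - S. {\<sigma>. \<sigma> permutes {1..n} \<and> \<sigma> ` second_row = insert x S})"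
    then obtain x \<sigma> where a: "a = (x, \<sigma>)" and x: "x \<in> {1..n} - S"
      and \<sigma>: "\<sigma> permutes {1..n}" "\<sigma> ` second_row = insert x S" by blast
    note inv = permutes_inverses[OF \<sigma>(1)]
    show "(case case a of (x, \<sigma>) \<Rightarrow> (inv \<sigma> x, \<sigma>) of (y, \<sigma>) \<Rightarrow> (\<sigma> y, \<sigma>)) = a"
      using inv by (simp add: a)
    have "inv \<sigma> x \<in> second_row" using \<sigma>(2) inv(2) by (metis imageE insertI1)
    moreover have "\<sigma> ` (second_row - {inv \<sigma> x}) = insert x S - {x}"
      using \<sigma>(2) inv(1) image_set_diff[OF permutes_inj[OF \<sigma>(1)], of second_row "{inv \<sigma> x}"] by simp
    ultimately show "(case a of (x, \<sigma>) \<Rightarrow> (inv \<sigma> x, \<sigma>)) \<in> (SIGMA y:second_row. ?G y)"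
      using \<sigma>(1) x by (auto simp: a)
    show "(case case a of (x, \<sigma>) \<Rightarrow> (inv \<sigma> x, \<sigma>) of (y, \<sigma>) \<Rightarrow> lookup v \<sigma>)
      = (case a of (x, \<sigma>) \<Rightarrow> lookup v \<sigma>)" by (simp add: a)
  next
    fix b assume "b \<in> (SIGMA y:second_row. ?G y)"
    then obtain y \<sigma> where b: "b = (y, \<sigma>)" and y: "y \<in> second_row"
      and \<sigma>: "\<sigma> permutes {1..n}" "\<sigma> ` (second_row - {y}) = S" by blast
    note inv = permutes_inverses[OF \<sigma>(1)]
    show "(case case b of (y, \<sigma>) \<Rightarrow> (\<sigma> y, \<sigma>) of (x, \<sigma>) \<Rightarrow> (inv \<sigma> x, \<sigma>)) = b"
      using inv by (simp add: b)
    have "\<sigma> y \<in> {1..n}" using y second_row(1) permutes_in_image[OF \<sigma>(1)] by blast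
    moreover have "\<sigma> y \<notin> S" using \<sigma>(2) permutes_inj[OF \<sigma>(1)] by (auto dest: injD)
    moreover have "\<sigma> ` second_row = insert (\<sigma> y) S" using \<sigma>(2) y by (metis image_insert insert_Diff)
    ultimately show "(case b of (y, \<sigma>) \<Rightarrow> (\<sigma> y, \<sigma>)) \<in> (SIGMA x:{1..n} - S.
      {\<sigma>. \<sigma> permutes {1..n} \<and> \<sigma> ` second_row = insert x S})"
      using \<sigma>(1) by (auto simp: b)
  qed
  also have "\<dots> = (\<Sum>y\<in>second_row. \<Sum>\<sigma>\<in>?G y. lookup v \<sigma>)"
    using second_row(3) by (intro sum.Sigma[symmetric]) auto
  also have "\<dots> = 0" using zero by simp
  finally show "lower n (to_fun v) S = 0" .
qed

text \<open>Induction on the number of elements of \<open>T\<close> outside the second row. Let \<open>y\<close> be such an element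
  and consider the relation at \<open>T - {y}\<close>. The supersets obtained by adding an element of the second row have
  value zero by induction, and all the others have the same value as \<open>T\<close> by invariance. So harmonic functions
  invariant under the row group are determined by one value.\<close>

lemma invariant_harmonic_eq_0:
  fixes g :: "nat set \<Rightarrow> 'f::field_char_0"
  assumes harm: "harmonic g" and 0: "g second_row = 0"
    and inv: "\<And>h T. h \<in> row_stabilizer p \<Longrightarrow> T \<in> subsets \<Longrightarrow> g (h ` T) = g T"
    and "T \<in> subsets"
  shows "g T = 0"
  using \<open>T \<in> subsets\<close>
proof (induction "card (T - second_row)" arbitrary: T)
  case 0
  then have "finite T" "card T = card second_row"
    using finite_subset[of T "{1..n}"] second_row by (auto simp: subsets_def)
  moreover from this 0 have "T \<subseteq> second_row" by simp
  ultimately have "T = second_row" using second_row(3) by (intro card_subset_eq) auto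
  then show ?case using \<open>g second_row = 0\<close> by simp
next
  case (Suc i)
  have T: "T \<subseteq> {1..n}" "card T = j" "finite T"
    using Suc.prems finite_subset[of T "{1..n}"] by (auto simp: subsets_def)
  have "T - second_row \<noteq> {}" using Suc.hyps(2) by (metis card.empty nat.distinct(1))
  then obtain y where y: "y \<in> T" "y \<notin> second_row" by blast
  let ?S = "T - {y}"
  have "?S \<subseteq> {1..n}" "Suc (card ?S) = j" using T card_Suc_Diff1[OF T(3) y(1)] by auto
  then have S: "?S \<in> facets" by (simp only: facets_def mem_Collect_eq simp_thms)
  have val: "g (insert x ?S) = (if x \<in> second_row then 0 else g T)" if x: "x \<in> {1..n} - ?S" for x
  proof (cases "x \<in> second_row")
    case True
    then have "insert x ?S - second_row = (T - second_row) - {y}" by auto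
    then have "i = card (insert x ?S - second_row)" using Suc.hyps(2) y T(3) by simp
    then show ?thesis using Suc.hyps(1) insert_facet[OF S x] True by simp
  next
    case False
    have yN: "y \<in> {1..n}" "x \<in> {1..n}" using y x T(1) by auto
    have "transpose y x ` second_row = second_row"
      using y(2) False by (force simp: transpose_def image_iff)
    then have "transpose y x \<in> row_stabilizer p"
      using image_second_row_iff[OF permutes_swap_id[OF yN]] by simp
    moreover have "transpose y x ` T = insert x ?S"
    proof (cases "x = y")
      case True
      then show ?thesis using y by auto
    next
      case False
      then have "x \<notin> T" using x by auto
      moreover have "transpose y x ` T = insert (transpose y x y) (transpose y x ` ?S)"
        using y(1) by (metis image_insert insert_Diff)
      moreover have "transpose y x ` ?S = ?S"
        using \<open>x \<notin> T\<close> by (force simp: transpose_def image_iff)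
      ultimately show ?thesis by simp
    qed
    ultimately show ?thesis using inv[OF _ Suc.prems, of "transpose y x"] False by simp
  qed
  have "0 = lower n g ?S" using harm S by (simp add: harmonic_def)
  also have "\<dots> = (\<Sum>x\<in>{1..n} - ?S. if x \<in> second_row then 0 else g T)"
    unfolding lower_def using val by (intro sum.cong) auto
  also have "\<dots> = of_nat (card {x \<in> {1..n} - ?S. x \<notin> second_row}) * g T"
    by (simp add: sum.If_cases Int_def)
  finally have "card {x \<in> {1..n} - ?S. x \<notin> second_row} = 0 \<or> g T = 0" by simp
  moreover have "y \<in> {x \<in> {1..n} - ?S. x \<notin> second_row}" using y T(1) by auto
  then have "card {x \<in> {1..n} - ?S. x \<notin> second_row} \<noteq> 0" by (subst card_0_eq) (simp, blast)
  ultimately show ?case by blast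
qed


lemma to_fun_of_fun:
  fixes f :: "nat set \<Rightarrow> 'f::field_char_0"
  shows "to_fun (of_fun f) second_row
    = (\<Sum>\<tau>\<in>col_stabilizer p. of_int (sign \<tau>) * (\<Sum>h\<in>row_stabilizer p. f (h ` \<tau> ` second_row)))"
proof -
  have "{\<sigma>. \<sigma> permutes {1..n} \<and> \<sigma> ` second_row = second_row} = row_stabilizer p"
    using image_second_row_iff row_perm by blast
  then have "to_fun (of_fun f) second_row = (\<Sum>h\<in>row_stabilizer p. lookup (of_fun f) h)"
    by (simp only: to_fun_def)
  also have "\<dots> = (\<Sum>h\<in>row_stabilizer p. \<Sum>\<tau>\<in>col_stabilizer p. of_int (sign \<tau>) * f (h ` \<tau> ` second_row))"
  proof (rule sum.cong[OF refl])
    fix h assume h: "h \<in> row_stabilizer p"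
    have "lookup (coset_sum f) (h \<circ> \<tau>) = f (h ` \<tau> ` second_row)" if "\<tau> \<in> col_stabilizer p" for \<tau>
      using lookup_coset_sum[OF permutes_comp[OF row_perm[OF h]]] col.permutes[OF that] p_sum
      by (simp only: image_comp)
    then show "lookup (of_fun f) h = (\<Sum>\<tau>\<in>col_stabilizer p. of_int (sign \<tau>) * f (h ` \<tau> ` second_row))"
      by (simp add: of_fun_def col.lookup_mult_signed_sum)
  qed
  finally show ?thesis by (subst (asm) sum.swap) (simp add: sum_distrib_left)
qed

lemma lower_image:
  assumes \<sigma>: "\<sigma> permutes {1..n}"
  shows "lower n (\<lambda>T. f (\<sigma> ` T)) S = lower n f (\<sigma> ` S)"
  unfolding lower_def
proof (rule sum.reindex_bij_witness[of _ "inv \<sigma>" \<sigma>])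
  note inv = permutes_inverses[OF \<sigma>]
  show "inv \<sigma> (\<sigma> x) = x" "\<sigma> (inv \<sigma> x) = x" for x using inv by simp_all
  show "\<sigma> x \<in> {1..n} - \<sigma> ` S" if "x \<in> {1..n} - S" for x
    using that permutes_in_image[OF \<sigma>, of x] permutes_inj[OF \<sigma>] by (auto dest: injD)
  show "inv \<sigma> x \<in> {1..n} - S" if x: "x \<in> {1..n} - \<sigma> ` S" for x
  proof -
    have "inv \<sigma> x \<in> {1..n}" using x permutes_in_image[OF permutes_inv[OF \<sigma>], of x] by blast
    moreover have "inv \<sigma> x \<notin> S" using x inv(1)[of x] by (metis DiffD2 image_eqI)
    ultimately show ?thesis by blast
  qed
  show "f (insert (\<sigma> x) (\<sigma> ` S)) = f (\<sigma> ` insert x S)" for x by simp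
qed

lemma harmonic_image:
  assumes "harmonic f" "\<sigma> permutes {1..n}"
  shows "harmonic (\<lambda>T. f (\<sigma> ` T))"
  unfolding harmonic_def
proof
  fix S assume "S \<in> facets"
  then have "inv \<sigma> -` S \<in> facets" using vimage_facets[OF permutes_inv[OF assms(2)]] by blast
  then have "\<sigma> ` S \<in> facets"
    using vimage_eq_image_inv[OF permutes_inv[OF assms(2)]] permutes_inv_inv[OF assms(2)] by simp
  then show "lower n (\<lambda>T. f (\<sigma> ` T)) S = 0"
    using assms by (simp add: lower_image harmonic_def)
qed

lemma to_fun_of_fun_cong:
  assumes "\<And>T. T \<in> subsets \<Longrightarrow> f T = g T"
  shows "of_fun f = of_fun g"
  unfolding of_fun_def coset_sum_def
  using assms image_subsets[OF _ second_row_in_subsets] by (intro arg_cong2[where f = "(\<star>)"] sum.cong) auto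

lemma of_fun_linear:
  "of_fun (\<lambda>T. f T + g T) = of_fun f + of_fun g"
  "of_fun (\<lambda>T. c * f T) = fscale c (of_fun f)"
  by (simp_all add: of_fun_def coset_sum_def single_add sum.distrib galg_mult_add_left
      pm.scale_sum_right[symmetric] galg_mult_scale_left flip: fscale_single)

text \<open>At the second row the left-hand side depends only on the averages of \<open>f\<close> over the row group, and
  an invariant harmonic function is determined by its value at the second row. So it suffices to check one
  function with a nonzero value there, namely the image of the Young symmetrizer. By equivariance the second
  row can be replaced with any other subset.\<close>

lemma to_fun_of_fun_harmonic:
  fixes f :: "nat set \<Rightarrow> 'f::field_char_0"
  assumes harm: "harmonic f" and T: "T \<in> subsets"
  shows "to_fun (of_fun f) T = hook_product p * f T"
proof -
  let ?R = "row_stabilizer p"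
  let ?r = "of_nat (card ?R) :: 'f"
  define y where "y = (young_symmetrizer p :: 'f galg)"
  define f1 where "f1 = to_fun y"
  have f1_harm: "harmonic f1" unfolding f1_def y_def by (rule harmonic_to_fun[OF young_in_specht])
  have f1_img: "f1 (h ` T) = f1 T" if h: "h \<in> ?R" for h T
  proof -
    have "single h 1 \<star> y = y"
      by (simp add: row.signed_sum_absorb_left[OF h] y_def young_symmetrizer_eq galg_mult_assoc[symmetric])
    then have "f1 (h ` T) = f1 (h -` h ` T)"
      using to_fun_shift[OF row_perm[OF h], of y "h ` T"] by (simp add: f1_def)
    then show ?thesis using permutes_inj[OF row_perm[OF h]] by (simp add: inj_vimage_image_eq)
  qed
  have "f1 second_row = (\<Sum>h\<in>?R. lookup y h)"
    unfolding f1_def to_fun_def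
    using image_second_row_iff row_perm by (intro sum.cong) auto
  also have "\<dots> = (\<Sum>h\<in>?R. 1)"
  proof (rule sum.cong[OF refl])
    fix h assume h: "h \<in> ?R"
    then have "inv h \<in> ?R" by (rule row.inv_H)
    then have "single (inv h) 1 \<star> y = y"
      by (simp add: row.signed_sum_absorb_left y_def young_symmetrizer_eq galg_mult_assoc[symmetric])
    then have "lookup y id = lookup y (inv (inv h) \<circ> id)"
      using lookup_galg_mult_single_left[OF permutes_inv[OF row_perm[OF h]], of y id] by simp
    then show "lookup y h = 1"
      using young_coeff_id[of p, where 'f = 'f] permutes_inv_inv[OF row_perm[OF h]] by (simp add: y_def)
  qed
  also have "\<dots> = ?r" by simp
  finally have f1_row: "f1 second_row = ?r" .
  have r: "?r \<noteq> 0" by (rule card_row_stabilizer_nonzero)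
  have at_row: "to_fun (of_fun f) second_row = hook_product p * f second_row" if harm: "harmonic f"
    for f :: "nat set \<Rightarrow> 'f"
  proof -
    define c where "c = f second_row / ?r"
    \<comment> \<open>the part of \<open>f\<close> that vanishes at the second row; it does not contribute to the value there\<close>
    define f' where "f' T = f T + (- c) * f1 T" for T
    have f'_row: "f' second_row = 0" using r f1_row by (simp add: f'_def c_def)
    have f'_harm: "harmonic f'"
      using harm f1_harm unfolding f'_def harmonic_def lower_add lower_scale by simp
    define g where "g T = (\<Sum>h\<in>?R. f' (h ` T))" for T
    have "g T = 0" if T: "T \<in> subsets" for T
    proof (rule invariant_harmonic_eq_0[OF _ _ _ T])
      show "harmonic g"
        using harmonic_image[OF f'_harm row_perm] unfolding g_def harmonic_def lower_sum by simp
      show "g second_row = 0"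
        using image_second_row_iff[OF row_perm] f'_row by (simp add: g_def)
      show "g (h ` T) = g T" if h: "h \<in> ?R" for h T
        using row.sum_shift_right[OF h, of "\<lambda>h. f' (h ` T)"] by (simp add: g_def image_comp)
    qed
    moreover have "\<tau> ` second_row \<in> subsets" if "\<tau> \<in> col_stabilizer p" for \<tau>
      using image_subsets[OF _ second_row_in_subsets] col.permutes[OF that] p_sum by simp
    ultimately have 0: "to_fun (of_fun f') second_row = 0"
      unfolding to_fun_of_fun by (simp add: g_def)
    have "f = (\<lambda>T. f' T + c * f1 T)" by (simp add: f'_def fun_eq_iff)
    then have "of_fun f = of_fun f' + fscale c (of_fun f1)"
      by (simp only: of_fun_linear)
    moreover have "of_fun f1 = fscale (hook_product p) y"
      unfolding f1_def y_def by (rule of_fun_to_fun[OF young_in_specht])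
    ultimately have "to_fun (of_fun f) second_row = c * (hook_product p * f1 second_row)"
      by (simp add: 0 f1_def module_hom.add[OF linear_to_fun] module_hom.scale[OF linear_to_fun])
    then show ?thesis using r f1_row by (simp add: c_def)
  qed
  obtain \<sigma> where \<sigma>: "\<sigma> permutes {1..n}" and T: "T = \<sigma> ` second_row"
    using ex_image_second_row[OF assms(2)] by blast
  note inv = permutes_inv[OF \<sigma>]
  have vimage: "inv \<sigma> -` T = \<sigma> ` T" for T
    using vimage_eq_image_inv[OF inv] permutes_inv_inv[OF \<sigma>] by simp
  have "to_fun (of_fun f) T = to_fun (single (inv \<sigma>) 1 \<star> of_fun f) second_row"
    using to_fun_shift[OF inv, of "of_fun f" second_row] by (simp add: vimage T)
  also have "\<dots> = to_fun (of_fun (\<lambda>T. f (\<sigma> ` T))) second_row"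
    using of_fun_shift[OF inv, of f] by (simp add: vimage)
  also have "\<dots> = hook_product p * f T"
    using at_row[OF harmonic_image[OF harm \<sigma>]] T by simp
  finally show ?thesis .
qed

lemma lower_section:
  "\<exists>s :: nat set \<Rightarrow> nat set \<Rightarrow> 'f::field_char_0.
    \<forall>S\<in>facets. \<forall>S'\<in>facets. lower n (s S) S' = (if S' = S then 1 else 0)"
proof (cases "j = 0")
  case True
  then have "facets = {}" unfolding facets_def by simp
  then show ?thesis by blast
next
  case False
  then have "2 * (j - 1) < n" using le by simp
  then have "\<exists>f. \<forall>S'. S' \<subseteq> {1..n} \<longrightarrow> card S' = j - 1 \<longrightarrow> lower n f S' = (if S' = S then 1 else 0 :: 'f)"
    for S by (rule lower_surj)
  then obtain s where s: "\<And>S S'. S' \<subseteq> {1..n} \<Longrightarrow> card S' = j - 1 \<Longrightarrow> lower n (s S) S' = (if S' = S then 1 else 0 :: 'f)"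
    by metis
  show ?thesis
  proof (intro exI ballI)
    fix S S' assume "S \<in> facets" "S' \<in> facets"
    then show "lower n (s S) S' = (if S' = S then 1 else 0)"
      by (intro s) (auto simp: facets_def)
  qed
qed

lemma lower_expand:
  assumes S: "S \<in> facets"
  shows "lower n f S = (\<Sum>T\<in>subsets. f T * lower n (\<lambda>T'. if T' = T then 1 else 0) S)"
proof -
  have "(\<Sum>T\<in>subsets. f T * lower n (\<lambda>T'. if T' = T then 1 else 0) S)
    = lower n (\<lambda>T'. \<Sum>T\<in>subsets. f T * (if T' = T then 1 else 0)) S"
    by (simp only: lower_sum lower_scale)
  also have "\<dots> = lower n f S"
    unfolding lower_def
  proof (rule sum.cong[OF refl])
    fix x assume "x \<in> {1..n} - S"
    then have "insert x S \<in> subsets" by (rule insert_facet[OF S])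
    then show "(\<Sum>T\<in>subsets. f T * (if insert x S = T then 1 else 0)) = f (insert x S)"
      using finite_subsets(1) by (simp add: if_distrib[of "(*) _"] cong: if_cong)
  qed
  finally show ?thesis ..
qed

text \<open>The Specht module is equivalent to the kernel of the equivariant map \<open>lower\<close> from functions on
  \<open>j\<close>-subsets onto functions on \<open>(j - 1)\<close>-subsets, so the trace is the difference of the traces on the two
  spaces of functions.\<close>

theorem irr_char_two_row_shape:
  assumes \<sigma>: "\<sigma> permutes {1..n}"
  shows "irr_char p \<sigma> = (of_nat (card {T \<in> subsets. \<sigma> -` T = T}) - of_nat (card {S \<in> facets. \<sigma> -` S = S}) :: 'f::field_char_0)"
proof -
  obtain s :: "nat set \<Rightarrow> nat set \<Rightarrow> 'f" where
    s: "\<And>S S'. S \<in> facets \<Longrightarrow> S' \<in> facets \<Longrightarrow> lower n (s S) S' = (if S' = S then 1 else 0)"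
    using lower_section by blast
  let ?\<delta> = "\<lambda>T T'. if T' = T then 1 else 0 :: 'f"
  \<comment> \<open>the indicator of \<open>T\<close>, projected to the harmonic functions along the section \<open>s\<close>\<close>
  define q where "q T T' = ?\<delta> T T' + (-1) * (\<Sum>S\<in>facets. lower n (?\<delta> T) S * s S T')" for T T'
  let ?h = "hook_product p :: 'f"
  have h: "?h \<noteq> 0" by (rule hook_product_nonzero[OF p_partition])
  let ?e = "\<lambda>T. fscale (1 / ?h) (of_fun (q T))"
  have q_harm: "harmonic (q T)" for T
    unfolding harmonic_def
  proof
    fix S assume S: "S \<in> facets"
    have "lower n (q T) S = lower n (?\<delta> T) S + (-1) * (\<Sum>S'\<in>facets. lower n (?\<delta> T) S' * lower n (s S') S)"
      unfolding q_def by (simp only: lower_add lower_scale lower_sum)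
    also have "(\<Sum>S'\<in>facets. lower n (?\<delta> T) S' * lower n (s S') S)
      = (\<Sum>S'\<in>facets. if S' = S then lower n (?\<delta> T) S else 0)"
      using s S by (intro sum.cong refl) auto
    also have "\<dots> = lower n (?\<delta> T) S" using S finite_subsets by simp
    finally show "lower n (q T) S = 0" by simp
  qed
  have "irr_char p \<sigma> = (\<Sum>T\<in>subsets. to_fun (single \<sigma> 1 \<star> ?e T) T)"
  proof (rule irr_char_frame)
    show "?e T \<in> specht_module p" for T
      by (intro pm.subspace_scale[OF subspace_specht] of_fun_in_specht)
    fix v :: "'f galg" assume v: "v \<in> specht_module p"
    have sum_of_fun: "of_fun (\<lambda>T'. \<Sum>T\<in>A. c T * F T T') = (\<Sum>T\<in>A. fscale (c T) (of_fun (F T)))"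
      if "finite A" for A c and F :: "nat set \<Rightarrow> nat set \<Rightarrow> 'f"
      using that
    proof (induction A)
      case empty
      have "of_fun (\<lambda>T. 0 * (0 :: 'f)) = fscale 0 (of_fun (\<lambda>_. 0))" by (rule of_fun_linear(2))
      then show ?case by simp
    next
      case (insert a A)
      then show ?case by (simp add: of_fun_linear)
    qed
    have "(\<Sum>T\<in>subsets. to_fun v T * q T T') = to_fun v T'" if T': "T' \<in> subsets" for T'
    proof -
      have "(\<Sum>T\<in>subsets. to_fun v T * q T T') = (\<Sum>T\<in>subsets. to_fun v T * ?\<delta> T T')
        - (\<Sum>S\<in>facets. (\<Sum>T\<in>subsets. to_fun v T * lower n (?\<delta> T) S) * s S T')"
      proof -
        have "(\<Sum>S\<in>facets. (\<Sum>T\<in>subsets. to_fun v T * lower n (?\<delta> T) S) * s S T')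
          = (\<Sum>T\<in>subsets. \<Sum>S\<in>facets. to_fun v T * lower n (?\<delta> T) S * s S T')"
          unfolding sum_distrib_right by (rule sum.swap)
        moreover have "q T T' = ?\<delta> T T' - (\<Sum>S\<in>facets. lower n (?\<delta> T) S * s S T')" for T
          by (simp add: q_def)
        ultimately show ?thesis
          by (simp only: right_diff_distrib sum_subtractf sum_distrib_left mult.assoc)
      qed
      also have "(\<Sum>S\<in>facets. (\<Sum>T\<in>subsets. to_fun v T * lower n (?\<delta> T) S) * s S T')
        = (\<Sum>S\<in>facets. lower n (to_fun v) S * s S T')"
        by (intro sum.cong refl arg_cong2[where f = "(*)"] lower_expand[symmetric])
      also have "\<dots> = 0" using harmonic_to_fun[OF v] by (intro sum.neutral) (simp add: harmonic_def)
      finally show ?thesis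
        using T' finite_subsets by (simp add: if_distrib[of "(*) _"] cong: if_cong)
    qed
    then have "of_fun (\<lambda>T'. \<Sum>T\<in>subsets. to_fun v T * q T T') = of_fun (to_fun v)"
      by (rule to_fun_of_fun_cong)
    then have "fscale ?h v = (\<Sum>T\<in>subsets. fscale (to_fun v T) (of_fun (q T)))"
      using of_fun_to_fun[OF v] sum_of_fun[OF finite_subsets(1)] by simp
    then have "fscale (1 / ?h) (fscale ?h v) = fscale (1 / ?h) (\<Sum>T\<in>subsets. fscale (to_fun v T) (of_fun (q T)))"
      by (rule arg_cong)
    then show "v = (\<Sum>T\<in>subsets. fscale (to_fun v T) (?e T))"
      using h by (simp add: pm.scale_sum_right mult.commute)
  qed (use \<sigma> p_sum finite_subsets linear_to_fun in auto)
  also have "\<dots> = (\<Sum>T\<in>subsets. q T (\<sigma> -` T))"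
  proof (rule sum.cong[OF refl])
    fix T assume T: "T \<in> subsets"
    have "to_fun (single \<sigma> 1 \<star> ?e T) T = (1 / ?h) * to_fun (of_fun (q T)) (\<sigma> -` T)"
      by (simp add: to_fun_shift[OF \<sigma>] module_hom.scale[OF linear_to_fun])
    then show "to_fun (single \<sigma> 1 \<star> ?e T) T = q T (\<sigma> -` T)"
      using to_fun_of_fun_harmonic[OF q_harm vimage_subsets[OF \<sigma> T]] h by simp
  qed
  also have "\<dots> = (\<Sum>T\<in>subsets. ?\<delta> T (\<sigma> -` T))
    - (\<Sum>S\<in>facets. \<Sum>T\<in>subsets. s S (\<sigma> -` T) * lower n (?\<delta> T) S)"
  proof -
    have "(\<Sum>S\<in>facets. \<Sum>T\<in>subsets. s S (\<sigma> -` T) * lower n (?\<delta> T) S)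
      = (\<Sum>T\<in>subsets. \<Sum>S\<in>facets. lower n (?\<delta> T) S * s S (\<sigma> -` T))"
      by (subst sum.swap) (simp add: mult.commute)
    then show ?thesis by (simp add: q_def sum_subtractf)
  qed
  also have "(\<Sum>S\<in>facets. \<Sum>T\<in>subsets. s S (\<sigma> -` T) * lower n (?\<delta> T) S)
    = (\<Sum>S\<in>facets. ?\<delta> S (\<sigma> -` S))"
  proof (rule sum.cong[OF refl])
    fix S assume S: "S \<in> facets"
    have "(\<Sum>T\<in>subsets. s S (\<sigma> -` T) * lower n (?\<delta> T) S) = lower n (\<lambda>T. s S (inv \<sigma> ` T)) S"
      using lower_expand[OF S, of "\<lambda>T. s S (inv \<sigma> ` T)"] by (simp add: vimage_eq_image_inv[OF \<sigma>])
    also have "\<dots> = lower n (s S) (\<sigma> -` S)"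
      by (simp add: lower_image[OF permutes_inv[OF \<sigma>]] vimage_eq_image_inv[OF \<sigma>])
    also have "\<dots> = ?\<delta> S (\<sigma> -` S)" using s[OF S vimage_facets[OF \<sigma> S]] .
    finally show "(\<Sum>T\<in>subsets. s S (\<sigma> -` T) * lower n (?\<delta> T) S) = ?\<delta> S (\<sigma> -` S)" .
  qed
  also have "(\<Sum>T\<in>subsets. ?\<delta> T (\<sigma> -` T)) = of_nat (card {T \<in> subsets. \<sigma> -` T = T})"
    using finite_subsets by (simp add: sum.If_cases Int_def)
  also have "(\<Sum>S\<in>facets. ?\<delta> S (\<sigma> -` S)) = of_nat (card {S \<in> facets. \<sigma> -` S = S})"
    using finite_subsets by (simp add: sum.If_cases Int_def)
  finally show ?thesis .
qed

end

section \<open>Upper triangular matrices of order two\<close>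

text \<open>The upper triangular matrix with diagonal \<open>a, d\<close> and remaining entry \<open>b\<close>.\<close>

definition ut :: "'f::field \<Rightarrow> 'f \<Rightarrow> 'f \<Rightarrow> 'f^2^2" where
  "ut a b d = (\<chi> i j. if i = 1 then (if j = 1 then a else b) else (if j = 1 then 0 else d))"

lemma ut_nth [simp]:
  "ut a b d $ 1 $ 1 = a" "ut a b d $ 1 $ 2 = b" "ut a b d $ 2 $ 1 = 0" "ut a b d $ 2 $ 2 = d"
  by (simp_all add: ut_def)

lemma matrix2_eq_iff:
  "A = (B :: 'f^2^2) \<longleftrightarrow> A $ 1 $ 1 = B $ 1 $ 1 \<and> A $ 1 $ 2 = B $ 1 $ 2 \<and> A $ 2 $ 1 = B $ 2 $ 1 \<and> A $ 2 $ 2 = B $ 2 $ 2"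
  by (simp add: vec_eq_iff forall_2)

lemma matrix_mult2_nth [simp]:
  "((A :: 'f::field^2^2) ** B) $ i $ j = A $ i $ 1 * B $ 1 $ j + A $ i $ 2 * B $ 2 $ j"
  by (simp add: matrix_matrix_mult_def sum_2)

lemma matrix_scale_nth [simp]: "matrix_scale c A $ i $ j = c * A $ i $ j"
  by (simp add: matrix_scale_def)

lemma ut_in_UT2 [simp]: "ut a b d \<in> UT2"
  by (simp add: UT2_def)

section \<open>The cocharacter as a permutation character\<close>

locale UT2_action = z2_graded_algebra sc W
  for sc :: "'f::field_char_0 \<Rightarrow> 'w::ring_1 \<Rightarrow> 'w" and W :: "bit \<Rightarrow> 'w set" +
  fixes B :: "'w set" and \<phi> :: "'w \<Rightarrow> 'f^2^2"
  assumes span_B: "span B = UNIV" and epi: "graded_epi_UT2 sc W \<phi>"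
begin

abbreviation alg :: "('f, 'w, 'f^2^2) graded_W_algebra" where "alg \<equiv> UT2_alg \<phi>"

lemma \<phi>_UT2: "\<phi> w \<in> UT2"
  using epi by (auto simp: graded_epi_UT2_def)

lemma \<phi>_surj:
  assumes "A \<in> UT2"
  shows "\<exists>w. \<phi> w = A"
proof -
  have "range \<phi> = UT2" using epi by (simp add: graded_epi_UT2_def)
  then show ?thesis using assms by (metis rangeE)
qed

lemma \<phi>_linear:
  "\<phi> (v + w) = \<phi> v + \<phi> w" "\<phi> (sc c w) = matrix_scale c (\<phi> w)" "\<phi> 0 = 0"
proof -
  interpret linear: Vector_Spaces.linear sc matrix_scale \<phi>
    using epi by (simp add: graded_epi_UT2_def)
  show "\<phi> (v + w) = \<phi> v + \<phi> w" "\<phi> (sc c w) = matrix_scale c (\<phi> w)" "\<phi> 0 = 0"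
    by (simp_all add: linear.add linear.scale)
qed

lemma alg_simps [simp]:
  "smul alg = matrix_scale" "amul alg = (**)" "lact alg w A = \<phi> w ** A" "ract alg A w = A ** \<phi> w"
  "grade alg = UT2_grade"
  by (simp_all add: UT2_alg_def)

lemma eval_nth:
  "eval_gpoly alg s f $ i $ j = (\<Sum>m\<in>keys f. lookup f m * eval_mono alg s m $ i $ j)"
  by (simp add: eval_gpoly_def)

lemma linear_eval_nth: "linear_functional (\<lambda>f. eval_gpoly alg s f $ i $ j)"
  unfolding eval_nth by (rule linear_functional_sum_keys)

lemma eval_add: "eval_gpoly alg s (f + g) = eval_gpoly alg s f + eval_gpoly alg s g"
  by (simp add: vec_eq_iff module_hom.add[OF linear_eval_nth])

lemma eval_scale: "eval_gpoly alg s (fscale c f) = matrix_scale c (eval_gpoly alg s f)"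
  by (simp add: vec_eq_iff module_hom.scale[OF linear_eval_nth])

lemma eval_0: "eval_gpoly alg s 0 = 0"
  by (simp add: eval_gpoly_def)

lemma eval_sum: "eval_gpoly alg s (\<Sum>a\<in>A. F a) = (\<Sum>a\<in>A. eval_gpoly alg s (F a))"
  by (simp add: vec_eq_iff module_hom.sum[OF linear_eval_nth])

lemma eval_single: "eval_gpoly alg s (single m c) = matrix_scale c (eval_mono alg s m)"
  by (simp add: vec_eq_iff eval_nth)

lemma eval_mono_cong: "(\<And>u. u \<in> set (vars m) \<Longrightarrow> s u = s' u) \<Longrightarrow> eval_mono alg s m = eval_mono alg s' m"
  by (induction m) auto

lemma eval_cong:
  assumes "\<And>u m. m \<in> keys f \<Longrightarrow> u \<in> set (vars m) \<Longrightarrow> s u = s' u"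
  shows "eval_gpoly alg s f = eval_gpoly alg s' f"
proof -
  have "eval_mono alg s m = eval_mono alg s' m" if "m \<in> keys f" for m
    using assms[OF that] by (rule eval_mono_cong)
  then show ?thesis by (simp add: eval_gpoly_def cong: sum.cong)
qed

lemma eval_mono_linear_var:
  assumes "distinct (vars m)" "u \<in> set (vars m)"
  shows "eval_mono alg (s(u := matrix_scale \<alpha> x + matrix_scale \<beta> y)) m
    = matrix_scale \<alpha> (eval_mono alg (s(u := x)) m) + matrix_scale \<beta> (eval_mono alg (s(u := y)) m)"
  using assms
proof (induction m)
  case (Last w v w')
  then show ?case by (simp add: matrix2_eq_iff algebra_simps)
next
  case (Pre w v m)
  show ?case
  proof (cases "u = v")
    case True
    have *: "eval_mono alg (s(v := z)) m = eval_mono alg s m" for z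
      using Pre.prems True by (intro eval_mono_cong) auto
    show ?thesis
      unfolding True eval_mono.simps fun_upd_same * by (simp add: matrix2_eq_iff algebra_simps)
  next
    case False
    then show ?thesis using Pre by (simp add: matrix2_eq_iff algebra_simps)
  qed
qed

lemma eval_mono_UT2:
  assumes "\<And>u. u \<in> set (vars m) \<Longrightarrow> s u \<in> UT2"
  shows "eval_mono alg s m \<in> UT2"
  using assms \<phi>_UT2 by (induction m) (auto simp: UT2_def)

lemma eval_mono_11_eq_0:
  assumes "\<And>u. s u \<in> UT2" "u \<in> set (vars m)" "s u $ 1 $ 1 = 0"
  shows "eval_mono alg s m $ 1 $ 1 = 0"
  using assms \<phi>_UT2 eval_mono_UT2[of _ s] by (induction m) (auto simp: UT2_def)

lemma eval_mono_22_eq_0: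
  assumes "\<And>u. s u \<in> UT2" "u \<in> set (vars m)" "s u $ 2 $ 2 = 0"
  shows "eval_mono alg s m $ 2 $ 2 = 0"
  using assms \<phi>_UT2 eval_mono_UT2[of _ s] by (induction m) (auto simp: UT2_def)

text \<open>Two factors without diagonal entries make a product of upper triangular matrices vanish.\<close>

lemma eval_mono_eq_0:
  assumes s: "\<And>u. s u \<in> UT2"
    and uv: "u \<in> set (vars m)" "v \<in> set (vars m)" "u \<noteq> v"
    and strict: "s u $ 1 $ 1 = 0" "s u $ 2 $ 2 = 0" "s v $ 1 $ 1 = 0" "s v $ 2 $ 2 = 0"
  shows "eval_mono alg s m = 0"
  using uv
proof (induction m)
  case (Last w x w')
  then show ?case by simp
next
  case (Pre w x m)
  have w: "\<phi> w $ 2 $ 1 = 0" and x: "s x $ 2 $ 1 = 0" and m: "eval_mono alg s m $ 2 $ 1 = 0"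
    using \<phi>_UT2[of w] s[of x] eval_mono_UT2[of m s] s by (auto simp: UT2_def)
  consider "x = u" "v \<in> set (vars m)" | "x = v" "u \<in> set (vars m)" | "u \<in> set (vars m)" "v \<in> set (vars m)"
    using Pre.prems by auto
  then show ?case
  proof cases
    case 1
    then show ?thesis
      using eval_mono_22_eq_0[of s v m, OF s 1(2) strict(4)] eval_mono_11_eq_0[of s v m, OF s 1(2) strict(3)] strict w x m
      by (simp add: matrix2_eq_iff)
  next
    case 2
    then show ?thesis
      using eval_mono_22_eq_0[of s u m, OF s 2(2) strict(2)] eval_mono_11_eq_0[of s u m, OF s 2(2) strict(1)] strict w x m
      by (simp add: matrix2_eq_iff)
  next
    case 3
    then show ?thesis using Pre.IH[OF 3 \<open>u \<noteq> v\<close>] by (simp add: matrix2_eq_iff)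
  qed
qed

subsection \<open>Multilinear functions realized by generalized polynomials\<close>

text \<open>A function of substitutions is realizable if some generalized polynomial evaluates to it with all
  monomials having the variables \<open>us\<close> in this order.\<close>

definition realizable :: "gvar list \<Rightarrow> ((gvar \<Rightarrow> 'f^2^2) \<Rightarrow> 'f^2^2) \<Rightarrow> bool" where
  "realizable us h \<longleftrightarrow> (\<exists>f \<in> free_W_algebra B. (\<forall>m\<in>keys f. vars m = us) \<and> (\<forall>s. eval_gpoly alg s f = h s))"

lemma realizable_add:
  assumes "realizable us h" "realizable us h'"
  shows "realizable us (\<lambda>s. h s + h' s)"
proof -
  obtain f g where f: "f \<in> free_W_algebra B" "\<forall>m\<in>keys f. vars m = us" "\<And>s. eval_gpoly alg s f = h s"
    and g: "g \<in> free_W_algebra B" "\<forall>m\<in>keys g. vars m = us" "\<And>s. eval_gpoly alg s g = h' s"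
    using assms by (auto simp: realizable_def)
  have "m \<in> keys f \<or> m \<in> keys g" if "m \<in> keys (f + g)" for m
    using that Poly_Mapping.keys_add[of f g] by blast
  then have "f + g \<in> free_W_algebra B" "\<forall>m\<in>keys (f + g). vars m = us"
    using f(1,2) g(1,2) unfolding free_W_algebra_def by blast+
  then show ?thesis
    unfolding realizable_def using f(3) g(3) by (intro bexI[of _ "f + g"]) (simp_all add: eval_add)
qed

lemma realizable_scale:
  assumes "realizable us h"
  shows "realizable us (\<lambda>s. matrix_scale c (h s))"
proof -
  obtain f where f: "f \<in> free_W_algebra B" "\<forall>m\<in>keys f. vars m = us" "\<And>s. eval_gpoly alg s f = h s"
    using assms by (auto simp: realizable_def)
  have "keys (fscale c f) \<subseteq> keys f" by (auto simp: in_keys_iff)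
  then show ?thesis
    unfolding realizable_def using f
    by (intro bexI[of _ "fscale c f"]) (auto simp: eval_scale free_W_algebra_def)
qed

lemma realizable_0: "realizable us (\<lambda>_. 0)"
  unfolding realizable_def by (intro bexI[of _ 0]) (auto simp: eval_0 free_W_algebra_def)

lemma realizable_mono:
  assumes "coeffs m \<subseteq> B"
  shows "realizable (vars m) (\<lambda>s. eval_mono alg s m)"
  unfolding realizable_def using assms
  by (intro bexI[of _ "single m 1"]) (auto simp: eval_single free_W_algebra_def matrix2_eq_iff)

text \<open>The coefficients of monomials are restricted to the basis \<open>B\<close>. Since \<open>B\<close> spans \<open>W\<close> and
  \<open>\<phi>\<close> is onto, any matrix in \<open>UT2\<close> may be used as a coefficient, provided the function depends linearly
  on it.\<close>

lemma realizable_coeff_induct: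
  assumes base: "\<And>b. b \<in> B \<Longrightarrow> realizable us (h (\<phi> b))"
    and add: "\<And>X Y s. h (X + Y) s = h X s + h Y s"
    and scale: "\<And>c X s. h (matrix_scale c X) s = matrix_scale c (h X s)"
    and A: "A \<in> UT2"
  shows "realizable us (h A)"
proof -
  obtain w where w: "\<phi> w = A" using \<phi>_surj[OF A] by blast
  have "h 0 s = 0" for s using add[of 0 0 s] by simp
  then have zero: "h 0 = (\<lambda>_. 0)" by auto
  have "w \<in> span B" using span_B by simp
  then have "realizable us (h (\<phi> w))"
  proof (induction rule: span_induct_alt)
    case base
    show ?case by (simp add: \<phi>_linear zero realizable_0)
  next
    case (step c x y)
    have "h (\<phi> (sc c x + y)) = (\<lambda>s. matrix_scale c (h (\<phi> x) s) + h (\<phi> y) s)"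
      by (simp add: \<phi>_linear add scale fun_eq_iff)
    then show ?case
      using realizable_add[OF realizable_scale[OF base[OF step(1)]] step(2)] by simp
  qed
  then show ?thesis by (simp add: w)
qed

lemma realizable_last:
  assumes "A \<in> UT2" "A' \<in> UT2"
  shows "realizable [u] (\<lambda>s. A ** s u ** A')"
proof -
  have 1: "realizable [u] (\<lambda>s. A ** s u ** \<phi> b')" if b': "b' \<in> B" for b'
  proof (rule realizable_coeff_induct[where h = "\<lambda>A s. A ** s u ** \<phi> b'", OF _ _ _ assms(1)])
    show "realizable [u] (\<lambda>s. \<phi> b ** s u ** \<phi> b')" if "b \<in> B" for b
      using realizable_mono[of "Last b u b'"] that b' by simp
  qed (simp_all add: matrix2_eq_iff algebra_simps)
  show ?thesis
    by (rule realizable_coeff_induct[where h = "\<lambda>A' s. A ** s u ** A'", OF 1 _ _ assms(2)])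
      (simp_all add: matrix2_eq_iff algebra_simps)
qed

lemma realizable_pre:
  assumes "A \<in> UT2" "realizable us h"
  shows "realizable (u # us) (\<lambda>s. A ** s u ** h s)"
proof (rule realizable_coeff_induct[where h = "\<lambda>A s. A ** s u ** h s", OF _ _ _ assms(1)])
  fix b assume b: "b \<in> B"
  obtain f where f: "f \<in> free_W_algebra B" "\<forall>m\<in>keys f. vars m = us" "\<And>s. eval_gpoly alg s f = h s"
    using assms(2) by (auto simp: realizable_def)
  let ?g = "\<Sum>m\<in>keys f. single (Pre b u m) (lookup f m)"
  have "keys ?g \<subseteq> (\<Union>m\<in>keys f. keys (single (Pre b u m) (lookup f m)))" by (rule keys_sum)
  also have "\<dots> \<subseteq> Pre b u ` keys f" by (auto split: if_splits)
  finally have keys: "keys ?g \<subseteq> Pre b u ` keys f" .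
  have "eval_gpoly alg s ?g = \<phi> b ** s u ** h s" for s
  proof -
    have "eval_gpoly alg s ?g = (\<Sum>m\<in>keys f. matrix_scale (lookup f m) (\<phi> b ** s u ** eval_mono alg s m))"
      by (simp add: eval_sum eval_single)
    also have "\<dots> = \<phi> b ** s u ** eval_gpoly alg s f"
      by (simp add: matrix2_eq_iff eval_nth sum.distrib sum_distrib_left algebra_simps)
    finally show ?thesis by (simp add: f(3))
  qed
  moreover have "coeffs (Pre b u m) \<subseteq> B" if "m \<in> keys f" for m
    using f(1) b that by (auto simp: free_W_algebra_def)
  then have "?g \<in> free_W_algebra B" using keys unfolding free_W_algebra_def by blast
  moreover have "\<forall>m\<in>keys ?g. vars m = u # us" using keys f(2) by auto
  ultimately show "realizable (u # us) (\<lambda>s. \<phi> b ** s u ** h s)" unfolding realizable_def by blast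
qed (simp_all add: matrix2_eq_iff algebra_simps)

definition prod11 :: "(gvar \<Rightarrow> 'f^2^2) \<Rightarrow> gvar list \<Rightarrow> 'f" where
  "prod11 s us = prod_list (map (\<lambda>u. s u $ 1 $ 1) us)"

definition prod22 :: "(gvar \<Rightarrow> 'f^2^2) \<Rightarrow> gvar list \<Rightarrow> 'f" where
  "prod22 s us = prod_list (map (\<lambda>u. s u $ 2 $ 2) us)"

lemma prod_simps [simp]:
  "prod11 s [] = 1" "prod11 s (u # us) = s u $ 1 $ 1 * prod11 s us"
  "prod22 s [] = 1" "prod22 s (u # us) = s u $ 2 $ 2 * prod22 s us"
  by (simp_all add: prod11_def prod22_def)

lemma realizable_pre_ut:
  assumes "realizable us h" and "\<And>s. ut a b d ** s u ** h s = h' s"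
  shows "realizable (u # us) h'"
  using realizable_pre[OF ut_in_UT2[of a b d] assms(1), of u] assms(2) by simp

lemma realizable_last_ut:
  assumes "\<And>s. ut a b d ** s u ** ut a' b' d' = h s"
  shows "realizable [u] h"
  using realizable_last[OF ut_in_UT2[of a b d] ut_in_UT2[of a' b' d'], of u] assms by simp

lemma realizable_11: "us \<noteq> [] \<Longrightarrow> realizable us (\<lambda>s. ut (prod11 s us) 0 0)"
proof (induction us rule: list_nonempty_induct)
  case (single u)
  show ?case by (rule realizable_last_ut[of 1 0 0 _ 1 0 0]) (simp add: matrix2_eq_iff)
next
  case (cons u us)
  show ?case by (rule realizable_pre_ut[OF cons(2), of 1 0 0]) (simp add: matrix2_eq_iff)
qed

lemma realizable_22: "us \<noteq> [] \<Longrightarrow> realizable us (\<lambda>s. ut 0 0 (prod22 s us))"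
proof (induction us rule: list_nonempty_induct)
  case (single u)
  show ?case by (rule realizable_last_ut[of 0 0 1 _ 0 0 1]) (simp add: matrix2_eq_iff)
next
  case (cons u us)
  show ?case by (rule realizable_pre_ut[OF cons(2), of 0 0 1]) (simp add: matrix2_eq_iff)
qed

text \<open>The unit \<open>e\<^sub>1\<^sub>1\<close> before each variable of \<open>xs\<close> and \<open>e\<^sub>2\<^sub>2\<close> after each variable of \<open>ys\<close>
  select the diagonal entries; between the two blocks \<open>e\<^sub>1\<^sub>2\<close> changes from the first to the second
  diagonal position.\<close>

lemma realizable_12:
  "xs @ ys \<noteq> [] \<Longrightarrow> realizable (xs @ ys) (\<lambda>s. ut 0 (prod11 s xs * prod22 s ys) 0)"
proof (induction xs)
  case Nil
  then obtain u us where ys: "ys = u # us" by (cases ys) auto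
  show ?case
  proof (cases "us = []")
    case True
    then show ?thesis
      using realizable_last_ut[of 0 1 0 u 0 0 1] by (simp add: ys matrix2_eq_iff)
  next
    case False
    show ?thesis
      using realizable_pre_ut[OF realizable_22[OF False], of 0 1 0 u] by (simp add: ys matrix2_eq_iff)
  qed
next
  case (Cons x xs)
  show ?case
  proof (cases "xs @ ys = []")
    case True
    then show ?thesis
      using realizable_last_ut[of 1 0 0 x 0 1 0] by (simp add: matrix2_eq_iff)
  next
    case False
    show ?thesis
      using realizable_pre_ut[OF Cons.IH[OF False], of 1 0 0 x] by (simp add: matrix2_eq_iff mult.assoc)
  qed
qed

text \<open>Here the odd variable \<open>z\<close> itself changes from the first to the second diagonal position.\<close>

lemma realizable_12_strict:
  "realizable (xs @ z # ys) (\<lambda>s. ut 0 (prod11 s xs * s z $ 1 $ 2 * prod22 s ys) 0)"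
proof (induction xs)
  case Nil
  show ?case
  proof (cases "ys = []")
    case True
    then show ?thesis
      using realizable_last_ut[of 1 0 0 z 0 0 1] by (simp add: matrix2_eq_iff)
  next
    case False
    show ?thesis
      using realizable_pre_ut[OF realizable_22[OF False], of 1 0 0 z] by (simp add: matrix2_eq_iff)
  qed
next
  case (Cons x xs)
  show ?case
    using realizable_pre_ut[OF Cons.IH, of 1 0 0 x] by (simp add: matrix2_eq_iff mult.assoc)
qed

subsection \<open>Substitution of matrix units\<close>

text \<open>The substitution of matrix units at which the coefficient of the product of the \<open>a\<^sub>i\<close> for
  \<open>i \<in> I\<close> and the \<open>b\<^sub>i\<close> for \<open>i \<notin> I\<close> can be read off.\<close>

fun unit_subst :: "nat set \<Rightarrow> gvar \<Rightarrow> 'f^2^2" where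
  "unit_subst I (Y i) = (if i \<in> I then ut 1 0 0 else ut 0 0 1)"
| "unit_subst I (Z i) = ut 0 1 0"

lemma unit_subst_UT2: "unit_subst I u \<in> UT2"
  by (cases u) auto

lemma unit_subst_graded: "unit_subst I u \<in> UT2_grade (deg u)"
  by (cases u) (auto simp: UT2_grade_def)

lemma multilinear_keysD:
  "f \<in> multilinear B r k \<Longrightarrow> m \<in> keys f \<Longrightarrow> distinct (vars m) \<and> set (vars m) = Y ` {1..r} \<union> Z ` {1..k}"
  by (simp add: multilinear_def)

lemma eval_linear_var:
  assumes f: "f \<in> multilinear B r k" and u: "u \<in> Y ` {1..r} \<union> Z ` {1..k}"
  shows "eval_gpoly alg (s(u := matrix_scale \<alpha> x + matrix_scale \<beta> y)) f
    = matrix_scale \<alpha> (eval_gpoly alg (s(u := x)) f) + matrix_scale \<beta> (eval_gpoly alg (s(u := y)) f)"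
proof -
  have "eval_mono alg (s(u := matrix_scale \<alpha> x + matrix_scale \<beta> y)) m
    = matrix_scale \<alpha> (eval_mono alg (s(u := x)) m) + matrix_scale \<beta> (eval_mono alg (s(u := y)) m)"
    if "m \<in> keys f" for m
    using multilinear_keysD[OF f that] u by (intro eval_mono_linear_var) auto
  then show ?thesis
    by (simp add: vec_eq_iff eval_nth sum.distrib sum_distrib_left algebra_simps cong: sum.cong)
qed

text \<open>An element of a homogeneous component is a combination of matrix units, so by multilinearity the
  variables can be replaced one after the other with matrix units.\<close>

lemma eval_eq_0_if_unit_subst:
  assumes f: "f \<in> multilinear B r k" and unit_subst: "\<And>I. I \<subseteq> {1..r} \<Longrightarrow> eval_gpoly alg (unit_subst I) f = 0"
    and s: "\<And>u. s u \<in> UT2_grade (deg u)"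
  shows "eval_gpoly alg s f = 0"
proof -
  let ?V = "Y ` {1..r} \<union> Z ` {1..k}"
  have "eval_gpoly alg s f = 0"
    \<comment> \<open>\<open>S\<close> collects the variables that have not yet been replaced\<close>
    if "S \<subseteq> ?V" and "\<And>u. s u \<in> UT2_grade (deg u)" and "\<And>u. u \<in> ?V - S \<Longrightarrow> \<exists>I. s u = unit_subst I u" for S s
  proof -
    have "finite S" using that(1) by (rule finite_subset) simp
    then show ?thesis using that
    proof (induction S arbitrary: s rule: finite_induct)
      case empty
      define I where "I = {i \<in> {1..r}. s (Y i) = ut 1 0 0}"
      have "s u = unit_subst I u" if u: "u \<in> ?V" for u
        using empty(3)[of u] u by (cases u) (auto simp: I_def split: if_splits)
      then have "eval_gpoly alg s f = eval_gpoly alg (unit_subst I) f"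
        using multilinear_keysD[OF f] by (intro eval_cong) auto
      also have "\<dots> = 0" by (rule unit_subst) (auto simp: I_def)
      finally show ?case .
    next
      case (insert v S)
      have zero: "eval_gpoly alg (s(v := unit_subst I v)) f = 0" for I
        using insert.prems unit_subst_graded by (intro insert.IH) auto
      obtain \<alpha> \<beta> I J where "s v = matrix_scale \<alpha> (unit_subst I v) + matrix_scale \<beta> (unit_subst J v)"
      proof (cases v)
        case (Y i)
        then have "s v = matrix_scale (s v $ 1 $ 1) (unit_subst UNIV v) + matrix_scale (s v $ 2 $ 2) (unit_subst {} v)"
          using insert.prems(2)[of v] by (simp add: UT2_grade_def UT2_def matrix2_eq_iff)
        then show ?thesis by (rule that)
      next
        case (Z i)
        then have "s v = matrix_scale (s v $ 1 $ 2) (unit_subst {} v) + matrix_scale 0 (unit_subst {} v)"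
          using insert.prems(2)[of v] by (simp add: UT2_grade_def UT2_def matrix2_eq_iff)
        then show ?thesis by (rule that)
      qed
      then have "s = s(v := matrix_scale \<alpha> (unit_subst I v) + matrix_scale \<beta> (unit_subst J v))"
        by (metis fun_upd_triv)
      then have "eval_gpoly alg s f = matrix_scale \<alpha> (eval_gpoly alg (s(v := unit_subst I v)) f)
        + matrix_scale \<beta> (eval_gpoly alg (s(v := unit_subst J v)) f)"
        using eval_linear_var[OF f, of v s] insert.prems(1) by (metis insert_subset)
      then show ?case by (simp add: zero matrix2_eq_iff)
    qed
  qed
  from this[of ?V s] show ?thesis using s by simp
qed

definition multilinear_mono :: "nat \<Rightarrow> nat \<Rightarrow> ('w, gvar) wmono \<Rightarrow> bool" where
  "multilinear_mono r k m \<longleftrightarrow>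
     coeffs m \<subseteq> B \<and> distinct (vars m) \<and> set (vars m) = Y ` {1..r} \<union> Z ` {1..k}"

lemma multilinear_iff: "f \<in> multilinear B r k \<longleftrightarrow> (\<forall>m\<in>keys f. multilinear_mono r k m)"
  by (auto simp: multilinear_def free_W_algebra_def multilinear_mono_def)

lemma subspace_multilinear: "pm.subspace (multilinear B r k :: ('w, 'f) gpoly set)"
proof (rule pm.subspaceI)
  fix f g :: "('w, 'f) gpoly" assume "f \<in> multilinear B r k" "g \<in> multilinear B r k"
  then show "f + g \<in> multilinear B r k"
    using Poly_Mapping.keys_add[of f g] unfolding multilinear_iff by blast
next
  fix c and f :: "('w, 'f) gpoly" assume "f \<in> multilinear B r k"
  moreover have "keys (fscale c f) \<subseteq> keys f" by (auto simp: in_keys_iff)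
  ultimately show "fscale c f \<in> multilinear B r k" unfolding multilinear_iff by blast
qed (simp add: multilinear_iff)

lemma subspace_identities: "pm.subspace (multilinear B r k \<inter> graded_identities alg B)"
proof (rule pm.subspaceI)
  show "0 \<in> multilinear B r k \<inter> graded_identities alg B"
    using pm.subspace_0[OF subspace_multilinear] by (auto simp: graded_identities_def eval_0 free_W_algebra_def)
next
  fix f g assume "f \<in> multilinear B r k \<inter> graded_identities alg B" "g \<in> multilinear B r k \<inter> graded_identities alg B"
  then show "f + g \<in> multilinear B r k \<inter> graded_identities alg B"
    using pm.subspace_add[OF subspace_multilinear, of f r k g]
    by (auto simp: graded_identities_def eval_add) (auto simp: multilinear_def)
next
  fix c f assume "f \<in> multilinear B r k \<inter> graded_identities alg B"
  then show "fscale c f \<in> multilinear B r k \<inter> graded_identities alg B"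
    using pm.subspace_scale[OF subspace_multilinear, of f r k c]
    by (auto simp: graded_identities_def eval_scale matrix2_eq_iff) (auto simp: multilinear_def)
qed

lemma perm_gpoly_eq:
  "perm_gpoly \<sigma> \<tau> f = (\<Sum>m\<in>keys f. fscale (lookup f m) (single (map_wmono id (perm_var \<sigma> \<tau>) m) 1))"
  by (simp add: perm_gpoly_def)

lemma linear_perm_gpoly: "linear_operator (perm_gpoly \<sigma> \<tau>)"
  unfolding perm_gpoly_eq by (rule linear_operator_sum_keys)

lemma vars_map_wmono: "vars (map_wmono id g m) = map g (vars m)"
  by (induction m) auto

lemma eval_map_wmono: "eval_mono alg s (map_wmono id g m) = eval_mono alg (s \<circ> g) m"
  by (induction m) auto

lemma eval_perm: "eval_gpoly alg s (perm_gpoly \<sigma> \<tau> f) = eval_gpoly alg (s \<circ> perm_var \<sigma> \<tau>) f"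
  unfolding perm_gpoly_def eval_sum eval_single eval_map_wmono by (simp add: eval_gpoly_def)

lemma perm_var_image:
  assumes "\<sigma> permutes {1..r}" "\<tau> permutes {1..k}"
  shows "perm_var \<sigma> \<tau> ` (Y ` {1..r} \<union> Z ` {1..k}) = Y ` {1..r} \<union> Z ` {1..k}"
proof -
  have "perm_var \<sigma> \<tau> ` Y ` {1..r} = Y ` \<sigma> ` {1..r}" "perm_var \<sigma> \<tau> ` Z ` {1..k} = Z ` \<tau> ` {1..k}"
    by (simp_all add: image_image)
  then show ?thesis
    by (simp only: image_Un permutes_image[OF assms(1)] permutes_image[OF assms(2)])
qed

lemma inj_perm_var:
  assumes "\<sigma> permutes {1..r}" "\<tau> permutes {1..k}"
  shows "inj (perm_var \<sigma> \<tau>)"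
proof (rule injI)
  fix u v assume "perm_var \<sigma> \<tau> u = perm_var \<sigma> \<tau> v"
  then show "u = v"
    using permutes_inj[OF assms(1)] permutes_inj[OF assms(2)] by (cases u; cases v) (auto dest: injD)
qed

lemma perm_multilinear:
  assumes \<sigma>: "\<sigma> permutes {1..r}" and \<tau>: "\<tau> permutes {1..k}" and f: "f \<in> multilinear B r k"
  shows "perm_gpoly \<sigma> \<tau> f \<in> multilinear B r k"
proof -
  have "keys (perm_gpoly \<sigma> \<tau> f) \<subseteq>
    (\<Union>m\<in>keys f. keys (single (map_wmono id (perm_var \<sigma> \<tau>) m) (lookup f m)))"
    unfolding perm_gpoly_def by (rule keys_sum)
  also have "\<dots> \<subseteq> map_wmono id (perm_var \<sigma> \<tau>) ` keys f" by (auto split: if_splits)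
  finally have keys: "keys (perm_gpoly \<sigma> \<tau> f) \<subseteq> map_wmono id (perm_var \<sigma> \<tau>) ` keys f" .
  have "coeffs (map_wmono id (perm_var \<sigma> \<tau>) m) \<subseteq> B" "distinct (vars (map_wmono id (perm_var \<sigma> \<tau>) m))"
    "set (vars (map_wmono id (perm_var \<sigma> \<tau>) m)) = Y ` {1..r} \<union> Z ` {1..k}" if m: "m \<in> keys f" for m
  proof -
    show "coeffs (map_wmono id (perm_var \<sigma> \<tau>) m) \<subseteq> B"
      using f m by (simp add: multilinear_def free_W_algebra_def wmono.set_map)
    have "distinct (vars m)" "set (vars m) = Y ` {1..r} \<union> Z ` {1..k}" using multilinear_keysD[OF f m] by auto
    then show "distinct (vars (map_wmono id (perm_var \<sigma> \<tau>) m))"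
      "set (vars (map_wmono id (perm_var \<sigma> \<tau>) m)) = Y ` {1..r} \<union> Z ` {1..k}"
      using perm_var_image[OF \<sigma> \<tau>] inj_on_subset[OF inj_perm_var[OF \<sigma> \<tau>] subset_UNIV]
      by (simp_all only: vars_map_wmono distinct_map set_map simp_thms)
  qed
  then have "multilinear_mono r k (map_wmono id (perm_var \<sigma> \<tau>) m)" if "m \<in> keys f" for m
    using that unfolding multilinear_mono_def by blast
  then show ?thesis using keys unfolding multilinear_iff by blast
qed

lemma perm_identities:
  assumes "\<sigma> permutes {1..r}" "\<tau> permutes {1..k}" "f \<in> multilinear B r k \<inter> graded_identities alg B"
  shows "perm_gpoly \<sigma> \<tau> f \<in> multilinear B r k \<inter> graded_identities alg B"
proof -
  have "deg (perm_var \<sigma> \<tau> u) = deg u" for u by (cases u) auto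
  then have "\<forall>u. (s \<circ> perm_var \<sigma> \<tau>) u \<in> grade alg (deg u)" if "\<forall>u. s u \<in> grade alg (deg u)" for s
    using that by (metis comp_apply)
  then have "eval_gpoly alg s (perm_gpoly \<sigma> \<tau> f) = 0" if "\<forall>u. s u \<in> grade alg (deg u)" for s
    using assms(3) that unfolding eval_perm graded_identities_def by blast
  moreover have "perm_gpoly \<sigma> \<tau> f \<in> multilinear B r k" using perm_multilinear assms by blast
  ultimately show ?thesis by (auto simp: graded_identities_def multilinear_def)
qed

lemma identity_iff:
  assumes "f \<in> multilinear B r k"
  shows "f \<in> graded_identities alg B \<longleftrightarrow> (\<forall>I\<subseteq>{1..r}. eval_gpoly alg (unit_subst I) f = 0)"
proof
  assume "f \<in> graded_identities alg B"
  then show "\<forall>I\<subseteq>{1..r}. eval_gpoly alg (unit_subst I) f = 0"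
    using unit_subst_graded by (auto simp: graded_identities_def)
next
  assume "\<forall>I\<subseteq>{1..r}. eval_gpoly alg (unit_subst I) f = 0"
  then show "f \<in> graded_identities alg B"
    using eval_eq_0_if_unit_subst[OF assms] assms by (auto simp: graded_identities_def multilinear_def)
qed

text \<open>Every monomial contains two odd variables, so the quotient is zero and has the empty frame.\<close>

theorem cocharacter_many_odd:
  assumes "\<sigma> permutes {1..r}" "\<tau> permutes {1..k}" and k: "2 \<le> k"
  shows "graded_cocharacter alg B r k \<sigma> \<tau> = 0"
proof -
  have "eval_mono alg (unit_subst I) m = 0" if "set (vars m) = Y ` {1..r} \<union> Z ` {1..k}" for I m
    by (rule eval_mono_eq_0[of _ "Z 1" _ "Z 2"]) (use unit_subst_UT2 k that in auto)
  then have "eval_gpoly alg (unit_subst I) f = 0" if "f \<in> multilinear B r k" for f I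
    using multilinear_keysD[OF that] by (simp add: vec_eq_iff eval_nth)
  then have sub: "f \<in> graded_identities alg B" if "f \<in> multilinear B r k" for f
    using identity_iff[OF that] that by blast
  have "graded_cocharacter alg B r k \<sigma> \<tau> = (\<Sum>x\<in>({} :: nat set). (0 :: 'f))"
    unfolding graded_cocharacter_def
    by (rule quotient_trace_frame[OF subspace_multilinear subspace_identities _ linear_perm_gpoly])
      (use perm_multilinear[OF assms(1,2)] perm_identities[OF assms(1,2)] sub in auto)
  then show ?thesis by simp
qed

text \<open>The entries \<open>(i, j)\<close> and the substitutions \<open>I\<close> that form a system of coordinates on the multilinear
  elements modulo identities, for at most one odd variable. The upper left entry is nonzero only if every variable is
  replaced with \<open>e\<^sub>1\<^sub>1\<close>, the lower right entry only if every variable is replaced with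
  \<open>e\<^sub>2\<^sub>2\<close>, and both vanish if there is an odd variable.\<close>

definition coords :: "nat \<Rightarrow> nat \<Rightarrow> (2 \<times> 2 \<times> nat set) set" where
  "coords r k = (\<lambda>I. (1, 2, I)) ` Pow {1..r} \<union> (if k = 0 then {(1, 1, {1..r}), (2, 2, {})} else {})"

fun coord :: "2 \<times> 2 \<times> nat set \<Rightarrow> ('w, 'f) gpoly \<Rightarrow> 'f" where
  "coord (i, j, I) f = eval_gpoly alg (unit_subst I) f $ i $ j"

lemma eval_unit_subst_eq_0:
  assumes f: "f \<in> multilinear B r k" and k: "k \<le> 1"
    and 0: "\<And>x. x \<in> coords r k \<Longrightarrow> coord x f = 0" and I: "I \<subseteq> {1..r}"
  shows "eval_gpoly alg (unit_subst I) f = 0"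
proof -
  have 12: "eval_gpoly alg (unit_subst I) f $ 1 $ 2 = 0"
    using 0[of "(1, 2, I)"] I by (auto simp: coords_def)
  have 21: "eval_gpoly alg (unit_subst I) f $ 2 $ 1 = 0"
    using eval_mono_UT2[of _ "unit_subst I"] unit_subst_UT2 by (auto simp: eval_nth UT2_def intro!: sum.neutral)
  have 11: "eval_gpoly alg (unit_subst I) f $ 1 $ 1 = 0"
  proof (cases "k = 0 \<and> I = {1..r}")
    case True
    then show ?thesis using 0[of "(1, 1, I)"] by (simp add: coords_def)
  next
    case False
    have "\<exists>u\<in>Y ` {1..r} \<union> Z ` {1..k}. unit_subst I u $ 1 $ 1 = 0"
    proof (cases "k = 0")
      case True
      then obtain i where "i \<in> {1..r}" "i \<notin> I" using False I by blast
      then show ?thesis by (intro bexI[of _ "Y i"]) auto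
    next
      case False
      then show ?thesis by (intro bexI[of _ "Z k"]) auto
    qed
    then have "eval_mono alg (unit_subst I) m $ 1 $ 1 = 0" if "m \<in> keys f" for m
      using multilinear_keysD[OF f that] eval_mono_11_eq_0[of "unit_subst I" _ m] unit_subst_UT2 by blast
    then show ?thesis by (simp add: eval_nth)
  qed
  have 22: "eval_gpoly alg (unit_subst I) f $ 2 $ 2 = 0"
  proof (cases "k = 0 \<and> I = {}")
    case True
    then show ?thesis using 0[of "(2, 2, I)"] by (simp add: coords_def)
  next
    case False
    have "\<exists>u\<in>Y ` {1..r} \<union> Z ` {1..k}. unit_subst I u $ 2 $ 2 = 0"
    proof (cases "k = 0")
      case True
      then obtain i where "i \<in> {1..r}" "i \<in> I" using False I by blast
      then show ?thesis by (intro bexI[of _ "Y i"]) auto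
    next
      case False
      then show ?thesis by (intro bexI[of _ "Z k"]) auto
    qed
    then have "eval_mono alg (unit_subst I) m $ 2 $ 2 = 0" if "m \<in> keys f" for m
      using multilinear_keysD[OF f that] eval_mono_22_eq_0[of "unit_subst I" _ m] unit_subst_UT2 by blast
    then show ?thesis by (simp add: eval_nth)
  qed
  show ?thesis using 11 12 21 22 by (simp add: matrix2_eq_iff)
qed

lemma realizable_multilinear:
  assumes "realizable us h" "distinct us" "set us = Y ` {1..r} \<union> Z ` {1..k}"
  shows "\<exists>f\<in>multilinear B r k. \<forall>s. eval_gpoly alg s f = h s"
proof -
  obtain f where f: "f \<in> free_W_algebra B" "\<forall>m\<in>keys f. vars m = us" "\<forall>s. eval_gpoly alg s f = h s"
    using assms(1) by (auto simp: realizable_def)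
  then have "f \<in> multilinear B r k" using assms(2,3) by (simp add: multilinear_def)
  then show ?thesis using f(3) by blast
qed

definition Y_list :: "nat set \<Rightarrow> gvar list" where
  "Y_list I = map Y (sorted_list_of_set I)"

lemma Y_list: "finite I \<Longrightarrow> set (Y_list I) = Y ` I" "distinct (Y_list I)"
  by (auto simp: Y_list_def distinct_map inj_on_def)

lemma prod_unit_subst:
  assumes "finite I"
  shows "prod11 (unit_subst J) (Y_list I) = (if I \<subseteq> J then 1 else 0)"
    "prod22 (unit_subst J) (Y_list I) = (if I \<inter> J = {} then 1 else 0)"
proof -
  have *: "prod_list (map (\<lambda>u. unit_subst J u $ c $ c) (Y_list I)) = (\<Prod>i\<in>I. unit_subst J (Y i) $ c $ c)" for c :: 2
    using assms prod.distinct_set_conv_list[of "sorted_list_of_set I" "\<lambda>i. unit_subst J (Y i) $ c $ c"]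
    by (simp add: Y_list_def comp_def)
  show "prod11 (unit_subst J) (Y_list I) = (if I \<subseteq> J then 1 else 0)"
    unfolding prod11_def * using assms by (cases "I \<subseteq> J") (auto intro!: prod.neutral)
  show "prod22 (unit_subst J) (Y_list I) = (if I \<inter> J = {} then 1 else 0)"
    unfolding prod22_def * using assms by (cases "I \<inter> J = {}") (auto intro!: prod.neutral)
qed

lemma prod_unit_subst_both:
  assumes "finite N" "I \<subseteq> N" "J \<subseteq> N"
  shows "prod11 (unit_subst J) (Y_list I) * prod22 (unit_subst J) (Y_list (N - I)) = (if J = I then 1 else 0)"
proof -
  have "finite I" using assms(2,1) by (rule finite_subset)
  moreover have "J = I \<longleftrightarrow> I \<subseteq> J \<and> (N - I) \<inter> J = {}" using assms by blast
  ultimately show ?thesis using assms(1) by (simp only: prod_unit_subst finite_Diff) simp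
qed

text \<open>The dual basis consists of the realizable functions constructed above, with the variables \<open>y\<^sub>i\<close> for
  \<open>i \<in> I\<close> to the left and the others to the right of the change of the diagonal position.\<close>

lemma dual_coord:
  assumes k: "k \<le> 1" and rk: "r + k \<ge> 1" and x: "x \<in> coords r k"
  shows "\<exists>f\<in>multilinear B r k. \<forall>y\<in>coords r k. coord y f = (if y = x then 1 else 0)"
proof -
  let ?N = "{1..r}"
  have ne: "(1 :: 2) \<noteq> 2" by simp
  consider I where "x = (1, 2, I)" "I \<subseteq> ?N" "k = 0" | I where "x = (1, 2, I)" "I \<subseteq> ?N" "k = 1"
    | "x = (1, 1, ?N)" "k = 0" | "x = (2, 2, {})" "k = 0"
    using x k by (auto simp: coords_def split: if_splits)
  then show ?thesis
  proof cases
    case 1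
    then have fin: "finite I" by (meson finite_atLeastAtMost finite_subset)
    let ?us = "Y_list I @ Y_list (?N - I)"
    have set: "set ?us = Y ` ?N \<union> Z ` {1..k}" using 1 fin by (auto simp: Y_list)
    moreover have "distinct ?us" using fin by (auto simp: Y_list)
    moreover have "?us \<noteq> []" using set rk 1 by (metis image_is_empty atLeastatMost_empty_iff2 empty_set Un_empty add.right_neutral)
    ultimately obtain f where f: "f \<in> multilinear B r k"
      and ev: "\<And>s. eval_gpoly alg s f = ut 0 (prod11 s (Y_list I) * prod22 s (Y_list (?N - I))) 0"
      using realizable_multilinear[OF realizable_12[of "Y_list I" "Y_list (?N - I)"]] by blast
    have "coord y f = (if y = x then 1 else 0)" if "y \<in> coords r k" for y
      using that 1 ne by (auto simp: coords_def ev prod_unit_subst_both split: if_splits)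
    then show ?thesis using f by blast
  next
    case 2
    then have fin: "finite I" by (meson finite_atLeastAtMost finite_subset)
    let ?us = "Y_list I @ Z 1 # Y_list (?N - I)"
    have "set ?us = Y ` ?N \<union> Z ` {1..k}" using 2 fin by (auto simp: Y_list)
    moreover have "distinct ?us" using fin by (auto simp: Y_list)
    ultimately obtain f where f: "f \<in> multilinear B r k"
      and ev: "\<And>s. eval_gpoly alg s f = ut 0 (prod11 s (Y_list I) * s (Z 1) $ 1 $ 2 * prod22 s (Y_list (?N - I))) 0"
      using realizable_multilinear[OF realizable_12_strict[of "Y_list I" "Z 1" "Y_list (?N - I)"]] by blast
    have "coord y f = (if y = x then 1 else 0)" if "y \<in> coords r k" for y
      using that 2 ne by (auto simp: coords_def ev prod_unit_subst_both split: if_splits)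
    then show ?thesis using f by blast
  next
    case 3
    have set: "set (Y_list ?N) = Y ` ?N \<union> Z ` {1..k}" using 3 by (auto simp: Y_list)
    moreover have "Y_list ?N \<noteq> []" using rk 3 by (simp add: Y_list_def)
    ultimately obtain f where f: "f \<in> multilinear B r k"
      and ev: "\<And>s. eval_gpoly alg s f = ut (prod11 s (Y_list ?N)) 0 0"
      using realizable_multilinear[OF realizable_11[of "Y_list ?N"]] Y_list(2) by blast
    have "coord y f = (if y = x then 1 else 0)" if "y \<in> coords r k" for y
      using that 3 ne by (auto simp: coords_def ev prod_unit_subst split: if_splits)
    then show ?thesis using f by blast
  next
    case 4
    have set: "set (Y_list ?N) = Y ` ?N \<union> Z ` {1..k}" using 4 by (auto simp: Y_list)
    moreover have "Y_list ?N \<noteq> []" using rk 4 by (simp add: Y_list_def)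
    ultimately obtain f where f: "f \<in> multilinear B r k"
      and ev: "\<And>s. eval_gpoly alg s f = ut 0 0 (prod22 s (Y_list ?N))"
      using realizable_multilinear[OF realizable_22[of "Y_list ?N"]] Y_list(2) by blast
    have "coord y f = (if y = x then 1 else 0)" if "y \<in> coords r k" for y
      using that 4 ne by (auto simp: coords_def ev prod_unit_subst split: if_splits)
    then show ?thesis using f by blast
  qed
qed

text \<open>Permuting the variables permutes the coordinates, so the trace is the number of fixed coordinates.
  The two diagonal ones are always fixed.\<close>

theorem cocharacter_few_odd:
  assumes \<sigma>: "\<sigma> permutes {1..r}" and \<tau>: "\<tau> permutes {1..k}" and k: "k \<le> 1" and rk: "r + k \<ge> 1"
  shows "graded_cocharacter alg B r k \<sigma> \<tau>
    = of_nat (card {I \<in> Pow {1..r}. \<sigma> -` I = I}) + (if k = 0 then 2 else 0)"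
proof -
  let ?V = "multilinear B r k :: ('w, 'f) gpoly set" and ?X = "coords r k"
  obtain e where e: "\<And>x. x \<in> ?X \<Longrightarrow> e x \<in> ?V"
    and dual: "\<And>x y. x \<in> ?X \<Longrightarrow> y \<in> ?X \<Longrightarrow> coord y (e x) = (if y = x then 1 else 0)"
    using dual_coord[OF k rk] by metis
  have fin: "finite ?X" by (simp add: coords_def)
  have lin: "linear_functional (coord x)" for x
  proof -
    obtain i j I where "x = (i, j, I)" by (cases x)
    then have "coord x = (\<lambda>f. eval_gpoly alg (unit_subst I) f $ i $ j)" by auto
    then show ?thesis using linear_eval_nth by metis
  qed
  have "graded_cocharacter alg B r k \<sigma> \<tau> = (\<Sum>x\<in>?X. coord x (perm_gpoly \<sigma> \<tau> (e x)))"
    unfolding graded_cocharacter_def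
  proof (rule quotient_trace_frame[OF subspace_multilinear subspace_identities _ linear_perm_gpoly])
    show "perm_gpoly \<sigma> \<tau> ` ?V \<subseteq> ?V" using perm_multilinear[OF \<sigma> \<tau>] by blast
    show "perm_gpoly \<sigma> \<tau> ` (?V \<inter> graded_identities alg B) \<subseteq> ?V \<inter> graded_identities alg B"
      using perm_identities[OF \<sigma> \<tau>] by blast
    show "coord x f = 0" if "f \<in> ?V \<inter> graded_identities alg B" for x f
      using that unit_subst_graded by (cases x) (auto simp: graded_identities_def)
    fix v assume v: "v \<in> ?V"
    let ?w = "v - (\<Sum>x\<in>?X. fscale (coord x v) (e x))"
    have w: "?w \<in> ?V"
      using v e by (intro pm.subspace_diff[OF subspace_multilinear] pm.subspace_sum[OF subspace_multilinear]
          pm.subspace_scale[OF subspace_multilinear])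
    have "coord y ?w = 0" if y: "y \<in> ?X" for y
    proof -
      have "coord y ?w = coord y v - (\<Sum>x\<in>?X. coord x v * coord y (e x))"
        by (simp only: module_hom.diff[OF lin] module_hom.sum[OF lin] module_hom.scale[OF lin])
      also have "(\<Sum>x\<in>?X. coord x v * coord y (e x)) = (\<Sum>x\<in>?X. if y = x then coord y v else 0)"
        using dual y by (intro sum.cong) auto
      also have "\<dots> = coord y v" using fin y by simp
      finally show ?thesis by simp
    qed
    then have "\<forall>I\<subseteq>{1..r}. eval_gpoly alg (unit_subst I) ?w = 0" using eval_unit_subst_eq_0[OF w k] by blast
    then show "?w \<in> ?V \<inter> graded_identities alg B" using identity_iff[OF w] w by blast
  qed (use fin e lin in auto)
  also have "\<dots> = (\<Sum>x\<in>?X. case x of (i, j, I) \<Rightarrow> if \<sigma> -` I = I then 1 else 0)"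
  proof (rule sum.cong[OF refl])
    fix x assume x: "x \<in> ?X"
    obtain i j I where ijI: "x = (i, j, I)" by (cases x)
    have "unit_subst I \<circ> perm_var \<sigma> \<tau> = unit_subst (\<sigma> -` I)"
    proof
      fix u show "(unit_subst I \<circ> perm_var \<sigma> \<tau>) u = unit_subst (\<sigma> -` I) u" by (cases u) auto
    qed
    then have "coord x (perm_gpoly \<sigma> \<tau> (e x)) = coord (i, j, \<sigma> -` I) (e x)"
      by (simp add: ijI eval_perm)
    also have "\<dots> = (if \<sigma> -` I = I then 1 else 0)"
    proof -
      have "(i, j, \<sigma> -` I) \<in> ?X"
        using x permutes_vimage[OF \<sigma>] vimage_mono[of I "{1..r}" \<sigma>]
        by (auto simp: ijI coords_def split: if_splits)
      then have "coord (i, j, \<sigma> -` I) (e x) = (if (i, j, \<sigma> -` I) = x then 1 else 0)"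
        by (rule dual[OF x])
      then show ?thesis by (simp only: ijI prod.inject simp_thms)
    qed
    finally show "coord x (perm_gpoly \<sigma> \<tau> (e x)) = (case x of (i, j, I) \<Rightarrow> if \<sigma> -` I = I then 1 else 0)"
      by (simp add: ijI)
  qed
  also have "\<dots> = (\<Sum>I\<in>Pow {1..r}. if \<sigma> -` I = I then 1 else 0) + (if k = 0 then 2 else 0)"
  proof -
    have ne: "(1 :: 2) \<noteq> 2" by simp
    have "(\<Sum>x\<in>?X. case x of (i, j, I) \<Rightarrow> if \<sigma> -` I = I then 1 else 0)
      = (\<Sum>x\<in>(\<lambda>I. (1 :: 2, 2 :: 2, I)) ` Pow {1..r}. case x of (i, j, I) \<Rightarrow> if \<sigma> -` I = I then 1 else 0)
      + (\<Sum>x\<in>(if k = 0 then {(1 :: 2, 1 :: 2, {1..r}), (2, 2, {})} else {}).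
          case x of (i, j, I) \<Rightarrow> if \<sigma> -` I = I then 1 else (0 :: 'f))"
      unfolding coords_def using ne by (intro sum.union_disjoint) auto
    also have "(\<Sum>x\<in>(\<lambda>I. (1 :: 2, 2 :: 2, I)) ` Pow {1..r}. case x of (i, j, I) \<Rightarrow> if \<sigma> -` I = I then 1 else (0 :: 'f))
      = (\<Sum>I\<in>Pow {1..r}. if \<sigma> -` I = I then 1 else 0)"
      by (subst sum.reindex) (auto simp: inj_on_def)
    also have "(\<Sum>x\<in>(if k = 0 then {(1 :: 2, 1 :: 2, {1..r}), (2, 2, {})} else {}).
          case x of (i, j, I) \<Rightarrow> if \<sigma> -` I = I then 1 else (0 :: 'f)) = (if k = 0 then 2 else 0)"
      using ne permutes_vimage[OF \<sigma>] by simp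
    finally show ?thesis .
  qed
  also have "(\<Sum>I\<in>Pow {1..r}. if \<sigma> -` I = I then 1 else (0 :: 'f)) = of_nat (card {I \<in> Pow {1..r}. \<sigma> -` I = I})"
    by (simp add: sum.If_cases Int_def)
  finally show ?thesis .
qed

end

section \<open>Multiplicities\<close>

definition fixed_subsets :: "nat \<Rightarrow> nat \<Rightarrow> (nat \<Rightarrow> nat) \<Rightarrow> nat" where
  "fixed_subsets n j \<sigma> = card {T. T \<subseteq> {1..n} \<and> card T = j \<and> \<sigma> -` T = T}"

lemma irr_char_two_row_eq_diff:
  assumes \<sigma>: "\<sigma> permutes {1..n}" and j: "2 * j \<le> n"
  shows "irr_char (two_row_shape n j) \<sigma> = (of_nat (fixed_subsets n j \<sigma>)
    - (if j = 0 then 0 else of_nat (fixed_subsets n (j - 1) \<sigma>)) :: 'f::field_char_0)"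
proof -
  interpret two_row n j by unfold_locales (rule j)
  have "{T \<in> subsets. \<sigma> -` T = T} = {T. T \<subseteq> {1..n} \<and> card T = j \<and> \<sigma> -` T = T}"
    unfolding subsets_def by blast
  moreover have "{S \<in> facets. \<sigma> -` S = S}
    = (if j = 0 then {} else {T. T \<subseteq> {1..n} \<and> card T = j - 1 \<and> \<sigma> -` T = T})"
    unfolding facets_def by (cases j) auto
  ultimately show ?thesis
    unfolding irr_char_two_row_shape[OF \<sigma>] fixed_subsets_def by simp
qed

text \<open>A telescoping sum of the differences that give the irreducible characters.\<close>

lemma fixed_subsets_eq_sum:
  assumes \<sigma>: "\<sigma> permutes {1..n}" and j: "2 * j \<le> n"
  shows "of_nat (fixed_subsets n j \<sigma>) = (\<Sum>i\<le>j. irr_char (two_row_shape n i) \<sigma> :: 'f::field_char_0)"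
  using j by (induction j) (simp_all add: irr_char_two_row_eq_diff[OF \<sigma>])

lemma fixed_subsets_symmetric:
  assumes \<sigma>: "\<sigma> permutes {1..n}" and j: "j \<le> n"
  shows "fixed_subsets n (n - j) \<sigma> = fixed_subsets n j \<sigma>"
proof -
  let ?A = "\<lambda>j. {T. T \<subseteq> {1..n} \<and> card T = j \<and> \<sigma> -` T = T}"
  have compl: "{1..n} - T \<in> ?A (n - i)" if "T \<in> ?A i" for T i
    using that finite_subset[of T "{1..n}"] permutes_vimage[OF \<sigma>]
    by (auto simp: card_Diff_subset vimage_Diff)
  have "bij_betw (\<lambda>T. {1..n} - T) (?A (n - j)) (?A j)"
  proof (rule bij_betw_byWitness[where f' = "\<lambda>T. {1..n} - T"])
    show "(\<lambda>T. {1..n} - T) ` ?A (n - j) \<subseteq> ?A j" using compl[of _ "n - j"] j by force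
    show "(\<lambda>T. {1..n} - T) ` ?A j \<subseteq> ?A (n - j)" using compl by blast
  qed auto
  then show ?thesis unfolding fixed_subsets_def by (rule bij_betw_same_card)
qed

text \<open>By complementation the permutation character on \<open>j\<close>-subsets contains the shapes \<open>(n - i, i)\<close> with
  \<open>i \<le> min j (n - j)\<close>, each of them once. So the shape belonging to \<open>i\<close> occurs for the \<open>j\<close> between
  \<open>i\<close> and \<open>n - i\<close>.\<close>

lemma sum_fixed_subsets:
  assumes \<sigma>: "\<sigma> permutes {1..n}"
  shows "(\<Sum>j\<le>n. of_nat (fixed_subsets n j \<sigma>))
    = (\<Sum>i | 2 * i \<le> n. of_nat (n - 2 * i + 1) * irr_char (two_row_shape n i) \<sigma> :: 'f::field_char_0)"
proof -
  let ?\<chi> = "\<lambda>i. irr_char (two_row_shape n i) \<sigma> :: 'f"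
  let ?I = "{i. 2 * i \<le> n}"
  have finI: "finite ?I" by (rule finite_subset[of _ "{..n}"]) auto
  have "of_nat (fixed_subsets n j \<sigma>) = (\<Sum>i\<in>?I. if i \<le> j \<and> i \<le> n - j then ?\<chi> i else 0)"
    if j: "j \<le> n" for j
  proof -
    define l where "l = min j (n - j)"
    have l: "2 * l \<le> n" using j by (auto simp: l_def min_def)
    have "fixed_subsets n j \<sigma> = fixed_subsets n l \<sigma>"
      using fixed_subsets_symmetric[OF \<sigma> j] by (auto simp: l_def min_def)
    then have "of_nat (fixed_subsets n j \<sigma>) = (\<Sum>i\<le>l. ?\<chi> i)"
      using fixed_subsets_eq_sum[OF \<sigma> l] by simp
    also have "{..l} = {i \<in> ?I. i \<le> j \<and> i \<le> n - j}" using j by (auto simp: l_def)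
    finally show ?thesis unfolding sum.inter_filter[OF finI] .
  qed
  then have "(\<Sum>j\<le>n. of_nat (fixed_subsets n j \<sigma>)) = (\<Sum>j\<le>n. \<Sum>i\<in>?I. if i \<le> j \<and> i \<le> n - j then ?\<chi> i else 0)"
    by (intro sum.cong) auto
  also have "\<dots> = (\<Sum>i\<in>?I. \<Sum>j\<le>n. if i \<le> j \<and> i \<le> n - j then ?\<chi> i else 0)" by (rule sum.swap)
  also have "\<dots> = (\<Sum>i\<in>?I. of_nat (n - 2 * i + 1) * ?\<chi> i)"
  proof (rule sum.cong[OF refl])
    fix i assume i: "i \<in> ?I"
    have "(\<Sum>j\<le>n. if i \<le> j \<and> i \<le> n - j then ?\<chi> i else 0) = (\<Sum>j\<in>{j \<in> {..n}. i \<le> j \<and> i \<le> n - j}. ?\<chi> i)"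
      by (rule sum.inter_filter[symmetric]) simp
    also have "{j \<in> {..n}. i \<le> j \<and> i \<le> n - j} = {i..n - i}" using i by auto
    also have "(\<Sum>j\<in>{i..n - i}. ?\<chi> i) = of_nat (n - 2 * i + 1) * ?\<chi> i"
    proof -
      have "Suc (n - i) - i = n - 2 * i + 1" using i by auto
      then show ?thesis by simp
    qed
    finally show "(\<Sum>j\<le>n. if i \<le> j \<and> i \<le> n - j then ?\<chi> i else 0) = of_nat (n - 2 * i + 1) * ?\<chi> i" .
  qed
  finally show ?thesis .
qed

lemma card_fixed_Pow:
  "card {I \<in> Pow {1..n}. \<sigma> -` I = I} = (\<Sum>j\<le>n. fixed_subsets n j \<sigma>)"
proof -
  let ?A = "{I \<in> Pow {1..n}. \<sigma> -` I = I}"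
  have "card ?A = (\<Sum>j\<in>{..n}. card {I \<in> ?A. card I = j})"
  proof (rule sum_card_fibres)
    show "card ` ?A \<subseteq> {..n}" using card_mono[of "{1..n}"] by auto
  qed auto
  moreover have "{I \<in> ?A. card I = j} = {T. T \<subseteq> {1..n} \<and> card T = j \<and> \<sigma> -` T = T}" for j by auto
  ultimately show ?thesis by (simp add: fixed_subsets_def)
qed

lemma irr_char_one_row:
  assumes "\<tau> permutes {1..k}"
  shows "irr_char (one_row k) \<tau> = (1 :: 'f::field_char_0)"
proof -
  have "{T. T \<subseteq> {1..k} \<and> card T = 0 \<and> \<tau> -` T = T} = {{}}"
    using finite_subset[of _ "{1..k}"] by auto
  then have "fixed_subsets k 0 \<tau> = 1" unfolding fixed_subsets_def by simp
  then show ?thesis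
    using irr_char_two_row_eq_diff[OF assms, of 0, where 'f = 'f] by (simp add: two_row_shape_def)
qed

lemma partitions_le_1: "k \<le> 1 \<Longrightarrow> partitions k = {one_row k}"
proof -
  assume k: "k \<le> 1"
  have "p = one_row k" if p: "p \<in> partitions k" for p
  proof (cases p)
    case Nil
    then show ?thesis using p by (auto simp: partitions_def one_row_def)
  next
    case (Cons a q)
    then have "a \<noteq> 0" "a + sum_list q = k" "0 \<notin> set q" using p by (auto simp: partitions_def)
    then have "k = 1" "a = 1" "sum_list q = 0" using k by linarith+
    then have "q = []" using \<open>0 \<notin> set q\<close> by (cases q) auto
    then show ?thesis using Cons \<open>k = 1\<close> \<open>a = 1\<close> by (simp add: one_row_def)
  qed
  moreover have "one_row k \<in> partitions k" by (auto simp: partitions_def one_row_def)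
  ultimately show ?thesis by blast
qed

lemma two_row_shape_inject:
  "2 * i \<le> n \<Longrightarrow> 2 * j \<le> n \<Longrightarrow> two_row_shape n i = two_row_shape n j \<longleftrightarrow> i = j"
  by (auto simp: two_row_shape_def one_row_def split: if_splits)

lemma two_row_shape_partition: "2 * i \<le> n \<Longrightarrow> two_row_shape n i \<in> partitions n"
  using two_row.p_partition[of n i] by (simp add: two_row_def)

text \<open>Linear independence is applied to each of the two groups in turn: with \<open>\<tau>\<close> fixed, the coefficient of
  every character of the first group is zero, and these coefficients are combinations of characters of the second
  group.\<close>

lemma decomposition_unique:
  fixes ch :: "(nat \<Rightarrow> nat) \<Rightarrow> (nat \<Rightarrow> nat) \<Rightarrow> 'f::field_char_0"
  assumes m: "decomposes_with r k ch m" and m': "decomposes_with r k ch m'"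
    and p: "p \<in> partitions r" and q: "q \<in> partitions k"
  shows "m p q = m' p q"
proof -
  define d where "d p q = (of_nat (m p q) - of_nat (m' p q) :: 'f)" for p q
  have "(\<Sum>p\<in>partitions r. (\<Sum>q\<in>partitions k. d p q * irr_char q \<tau>) * irr_char p \<sigma>) = 0"
    if \<sigma>: "\<sigma> permutes {1..r}" and \<tau>: "\<tau> permutes {1..k}" for \<sigma> \<tau>
  proof -
    have "(\<Sum>p\<in>partitions r. (\<Sum>q\<in>partitions k. d p q * irr_char q \<tau>) * irr_char p \<sigma>)
      = (\<Sum>p\<in>partitions r. \<Sum>q\<in>partitions k. of_nat (m p q) * (irr_char p \<sigma> * irr_char q \<tau>)
          - of_nat (m' p q) * (irr_char p \<sigma> * irr_char q \<tau>))"
      unfolding sum_distrib_right by (intro sum.cong refl) (simp add: d_def algebra_simps)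
    also have "\<dots> = (\<Sum>p\<in>partitions r. \<Sum>q\<in>partitions k. of_nat (m p q) * (irr_char p \<sigma> * irr_char q \<tau>))
      - (\<Sum>p\<in>partitions r. \<Sum>q\<in>partitions k. of_nat (m' p q) * (irr_char p \<sigma> * irr_char q \<tau>))"
      by (simp only: sum_subtractf)
    also have "\<dots> = ch \<sigma> \<tau> - ch \<sigma> \<tau>"
    proof -
      have "ch \<sigma> \<tau> = (\<Sum>p\<in>partitions r. \<Sum>q\<in>partitions k. of_nat (l p q) * (irr_char p \<sigma> * irr_char q \<tau>))"
        if "decomposes_with r k ch l" for l
        using that \<sigma> \<tau> unfolding decomposes_with_def by blast
      from this[OF m] this[OF m'] show ?thesis by argo
    qed
    finally show ?thesis by simp
  qed
  then have "(\<Sum>q\<in>partitions k. d p q * irr_char q \<tau>) = 0" if "\<tau> permutes {1..k}" for \<tau>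
    using that p by (intro irr_char_independent[where d = "\<lambda>p. \<Sum>q\<in>partitions k. d p q * irr_char q \<tau>"])
  then have "d p q = 0" using q by (rule irr_char_independent)
  then show ?thesis by (simp add: d_def)
qed

text \<open>As a sum over \<open>i\<close>, which has at most one term, the multiplicity is zero for all shapes with more than
  two rows.\<close>

definition multiplicity :: "nat \<Rightarrow> nat \<Rightarrow> nat list \<Rightarrow> nat" where
  "multiplicity r k p =
     (\<Sum>i | 2 * i \<le> r \<and> two_row_shape r i = p. r - 2 * i + 1 + (if i = 0 \<and> k = 0 then 2 else 0))"

lemma multiplicity_two_row:
  assumes "2 * i \<le> r"
  shows "multiplicity r k (two_row_shape r i) = r - 2 * i + 1 + (if i = 0 \<and> k = 0 then 2 else 0)"
proof -
  have "{j. 2 * j \<le> r \<and> two_row_shape r j = two_row_shape r i} = {i}"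
    using assms two_row_shape_inject by auto
  then show ?thesis by (simp add: multiplicity_def)
qed

lemma multiplicity_other:
  assumes "\<And>i. 2 * i \<le> r \<Longrightarrow> p \<noteq> two_row_shape r i"
  shows "multiplicity r k p = 0"
proof -
  have "{i. 2 * i \<le> r \<and> two_row_shape r i = p} = {}" using assms by blast
  then show ?thesis unfolding multiplicity_def by (simp only: sum.empty)
qed

lemma sum_multiplicity:
  fixes f :: "nat list \<Rightarrow> 'f::field_char_0"
  shows "(\<Sum>p\<in>partitions r. of_nat (multiplicity r k p) * f p)
    = (\<Sum>i | 2 * i \<le> r. of_nat (r - 2 * i + 1) * f (two_row_shape r i)) + (if k = 0 then 2 * f (one_row r) else 0)"
proof -
  let ?I = "{i. 2 * i \<le> r}"
  have fin: "finite ?I" by (rule finite_subset[of _ "{..r}"]) auto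
  have inj: "inj_on (two_row_shape r) ?I" by (rule inj_onI) (simp add: two_row_shape_inject)
  have "(\<Sum>p\<in>partitions r. of_nat (multiplicity r k p) * f p)
    = (\<Sum>p\<in>two_row_shape r ` ?I. of_nat (multiplicity r k p) * f p)"
  proof (rule sum.mono_neutral_right)
    show "two_row_shape r ` ?I \<subseteq> partitions r" using two_row_shape_partition by blast
    show "\<forall>p\<in>partitions r - two_row_shape r ` ?I. of_nat (multiplicity r k p) * f p = 0"
      using multiplicity_other by auto
  qed simp
  also have "\<dots> = (\<Sum>i\<in>?I. of_nat (multiplicity r k (two_row_shape r i)) * f (two_row_shape r i))"
    by (simp add: sum.reindex[OF inj])
  also have "\<dots> = (\<Sum>i\<in>?I. of_nat (r - 2 * i + 1) * f (two_row_shape r i)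
      + (if i = 0 then (if k = 0 then 2 * f (one_row r) else 0) else 0))"
  proof (rule sum.cong[OF refl])
    fix i assume "i \<in> ?I"
    then have "2 * i \<le> r" by simp
    then show "of_nat (multiplicity r k (two_row_shape r i)) * f (two_row_shape r i)
      = of_nat (r - 2 * i + 1) * f (two_row_shape r i)
        + (if i = 0 then (if k = 0 then 2 * f (one_row r) else 0) else 0)"
      unfolding multiplicity_two_row[OF \<open>2 * i \<le> r\<close>]
      by (cases "i = 0") (simp_all add: two_row_shape_def algebra_simps)
  qed
  also have "\<dots> = (\<Sum>i\<in>?I. of_nat (r - 2 * i + 1) * f (two_row_shape r i))
      + (if k = 0 then 2 * f (one_row r) else 0)"
    using fin by (simp add: sum.distrib)
  finally show ?thesis .
qed


lemma (in UT2_action) cocharacter_decomposition: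
  assumes "r + k \<ge> 1"
  shows "decomposes_with r k (graded_cocharacter alg B r k)
    (\<lambda>p q. if k \<le> 1 then multiplicity r k p else 0)"
  unfolding decomposes_with_def
proof (intro allI impI)
  fix \<sigma> \<tau> assume \<sigma>: "\<sigma> permutes {1..r}" and \<tau>: "\<tau> permutes {1..k}"
  show "graded_cocharacter alg B r k \<sigma> \<tau> = (\<Sum>p\<in>partitions r. \<Sum>q\<in>partitions k.
    of_nat (if k \<le> 1 then multiplicity r k p else 0) * (irr_char p \<sigma> * irr_char q \<tau>))"
  proof (cases "k \<le> 1")
    case True
    have "graded_cocharacter alg B r k \<sigma> \<tau>
      = (\<Sum>i | 2 * i \<le> r. of_nat (r - 2 * i + 1) * irr_char (two_row_shape r i) \<sigma>) + (if k = 0 then 2 else 0)"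
      unfolding cocharacter_few_odd[OF \<sigma> \<tau> True assms] card_fixed_Pow of_nat_sum sum_fixed_subsets[OF \<sigma>] ..
    also have "\<dots> = (\<Sum>p\<in>partitions r. of_nat (multiplicity r k p) * irr_char p \<sigma>)"
      unfolding sum_multiplicity irr_char_one_row[OF \<sigma>] by simp
    finally show ?thesis
      using True by (simp add: partitions_le_1 irr_char_one_row[OF \<tau>])
  next
    case False
    then show ?thesis using cocharacter_many_odd[OF \<sigma> \<tau>] by simp
  qed
qed

theorem theorem6p3:
  fixes sc :: "'f::field_char_0 \<Rightarrow> 'w::ring_1 \<Rightarrow> 'w"
    and W :: "bit \<Rightarrow> 'w set"
    and B :: "'w set"
    and \<phi> :: "'w \<Rightarrow> 'f^2^2"
    and n r :: nat
  assumes "z2_graded_algebra sc W"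
    and "\<not> module.dependent sc B" and "module.span sc B = UNIV"
    and "graded_epi_UT2 sc W \<phi>"
    and "n \<ge> 1" and "r \<le> n"
  shows "(\<exists>m. decomposes_with r (n - r) (graded_cocharacter (UT2_alg \<phi>) B r (n - r)) m) \<and>
    (\<forall>m. decomposes_with r (n - r) (graded_cocharacter (UT2_alg \<phi>) B r (n - r)) m \<longrightarrow>
      (r = n \<longrightarrow>
         m [n] [] = n + 3 \<and>
         (\<forall>p q. p \<ge> 1 \<and> 2 * p + q = n \<longrightarrow> m [p + q, p] [] = q + 1) \<and>
         (\<forall>lam \<in> partitions r. \<forall>\<mu> \<in> partitions (n - r).
            \<not> (lam = [n] \<and> \<mu> = []) \<and>
            \<not> (\<exists>p q. p \<ge> 1 \<and> 2 * p + q = n \<and> lam = [p + q, p] \<and> \<mu> = []) \<longrightarrow>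
            m lam \<mu> = 0)) \<and>
      (r = n - 1 \<longrightarrow>
         m (one_row (n - 1)) [1] = n \<and>
         (\<forall>p q. p \<ge> 1 \<and> 2 * p + q = n - 1 \<longrightarrow> m [p + q, p] [1] = q + 1) \<and>
         (\<forall>lam \<in> partitions r. \<forall>\<mu> \<in> partitions (n - r).
            \<not> (lam = one_row (n - 1) \<and> \<mu> = [1]) \<and>
            \<not> (\<exists>p q. p \<ge> 1 \<and> 2 * p + q = n - 1 \<and> lam = [p + q, p] \<and> \<mu> = [1]) \<longrightarrow>
            m lam \<mu> = 0)) \<and>
      (r + 2 \<le> n \<longrightarrow>
         (\<forall>lam \<in> partitions r. \<forall>\<mu> \<in> partitions (n - r). m lam \<mu> = 0)))"
proof -
  interpret UT2_action sc W B \<phi>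
    using assms by (simp add: UT2_action_def UT2_action_axioms_def)
  define k where "k = n - r"
  have rk: "r + k \<ge> 1" and n: "n = r + k" using assms(5,6) by (simp_all add: k_def)
  let ?m = "\<lambda>p (q :: nat list). if k \<le> 1 then multiplicity r k p else 0"
  have dec: "decomposes_with r k (graded_cocharacter alg B r k) ?m"
    by (rule cocharacter_decomposition[OF rk])
  have two_row: "two_row_shape r p = [p + q, p]" if "p \<ge> 1" "2 * p + q = r" for p q
    using that by (auto simp: two_row_shape_def)
  show ?thesis
  proof (rule conjI, goal_cases)
    case 1
    show ?case using dec unfolding k_def by blast
  next
    case 2
    show ?case
    proof (intro allI impI, goal_cases)
      case (1 m)
      then have dec_m: "decomposes_with r k (graded_cocharacter alg B r k) m" by (simp add: k_def)
      have m: "m p q = (if k \<le> 1 then multiplicity r k p else 0)"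
        if "p \<in> partitions r" "q \<in> partitions k" for p q
        using decomposition_unique[OF dec_m dec that] .
      have row: "m (one_row r) (one_row k) = r + 1 + (if k = 0 then 2 else 0)" if "k \<le> 1"
        using m[OF two_row_shape_partition[of 0 r], of "one_row k"] multiplicity_two_row[of 0 r k] that
        by (simp add: partitions_le_1 two_row_shape_def)
      have rows: "m [p + q, p] (one_row k) = q + 1" if "k \<le> 1" "p \<ge> 1" "2 * p + q = r" for p q
        using m[OF two_row_shape_partition[of p r], of "one_row k"] multiplicity_two_row[of p r k] that two_row
        by (simp add: partitions_le_1)
      have other: "m lam \<mu> = 0"
        if part: "lam \<in> partitions r" "\<mu> \<in> partitions k" and one: "lam \<noteq> one_row r"
          and two: "\<And>p q. p \<ge> 1 \<Longrightarrow> 2 * p + q = r \<Longrightarrow> lam \<noteq> [p + q, p]" for lam \<mu>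
      proof -
        have "lam \<noteq> two_row_shape r i" if i: "2 * i \<le> r" for i
        proof (cases "i = 0")
          case True
          then show ?thesis using one by (simp add: two_row_shape_def)
        next
          case False
          then have "1 \<le> i" "2 * i + (r - 2 * i) = r" using i by auto
          then show ?thesis using two_row[of i "r - 2 * i"] two[of i "r - 2 * i"] by simp
        qed
        then show ?thesis using m[OF part] multiplicity_other[of r lam k] by simp
      qed
      have col: "\<mu> = one_row k" if "k \<le> 1" "\<mu> \<in> partitions k" for \<mu>
        using that partitions_le_1 by blast
      consider "k = 0" | "k = 1" | "k \<ge> 2" by linarith
      then show ?case
      proof cases
        case 1
        then have rn: "r = n" "r \<noteq> n - 1" "\<not> r + 2 \<le> n" and k1: "k \<le> 1"
          and shapes: "one_row k = []" "one_row r = [n]"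
          using rk n by (auto simp: one_row_def)
        have "m [n] [] = n + 3" using row[OF k1] 1 rn(1) unfolding shapes by simp
        moreover have "m [p + q, p] [] = q + 1" if "p \<ge> 1 \<and> 2 * p + q = n" for p q
          using rows[OF k1, of p q] that rn(1) unfolding shapes by simp
        moreover have "m lam \<mu> = 0" if "lam \<in> partitions r" "\<mu> \<in> partitions k"
          "\<not> (lam = [n] \<and> \<mu> = []) \<and>
           \<not> (\<exists>p q. p \<ge> 1 \<and> 2 * p + q = n \<and> lam = [p + q, p] \<and> \<mu> = [])" for lam \<mu>
          using other[OF that(1,2)] that(3) col[OF k1 that(2)] rn(1) unfolding shapes by blast
        ultimately show ?thesis unfolding k_def[symmetric] using rn(2,3) by blast
      next
        case 2
        then have rn: "r = n - 1" "r \<noteq> n" "\<not> r + 2 \<le> n" and k1: "k \<le> 1"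
          and shapes: "one_row k = [1]"
          using n by (auto simp: one_row_def)
        have "m (one_row r) [1] = r + 1" using row[OF k1] 2 unfolding shapes by simp
        moreover have "n - 1 = r" "r + 1 = n" using 2 n by simp_all
        ultimately have "m (one_row (n - 1)) [1] = n" by (simp only:)
        moreover have "m [p + q, p] [1] = q + 1" if "p \<ge> 1 \<and> 2 * p + q = n - 1" for p q
          using rows[OF k1, of p q] that rn(1) unfolding shapes by simp
        moreover have "m lam \<mu> = 0" if "lam \<in> partitions r" "\<mu> \<in> partitions k"
          "\<not> (lam = one_row (n - 1) \<and> \<mu> = [1]) \<and>
           \<not> (\<exists>p q. p \<ge> 1 \<and> 2 * p + q = n - 1 \<and> lam = [p + q, p] \<and> \<mu> = [1])" for lam \<mu>
          using other[OF that(1,2)] that(3) col[OF k1 that(2)] rn(1) unfolding shapes by blast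
        ultimately show ?thesis unfolding k_def[symmetric] using rn(2,3) by blast
      next
        case 3
        then show ?thesis unfolding k_def[symmetric] using m n by auto
      qed
    qed
  qed
qed

end
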